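(* Let $k$ be an algebraically closed field of characteristic zero, let $H=(H,\Delta,\varepsilon,\Phi,S,\alpha,\beta)$ be a finite-dimensional semisimple quasi-Hopf algebra over $k$ with canonical pivotal element $g\in H$, and let $\tau$ be an involution of the quasi-Hopf algebra $H$. Let $V$ be a finite-dimensional simple left $H$-module. Then $\nu^\tau(V)\in\{0,\pm1\}$ and the following statements are equivalent: (1) $\nu^\tau(V)\neq0$. (2) $\tau^\natural(V)$ is isomorphic to the dual module $V^\vee$ as an $H$-module. (3) There exists a non-degenerate bilinear form $b$ on $V$ satisfying $b(\tau(h)v,w)=b(v,S(h)w)$ for all $h\in H$ and $v,w\in V$. If one of the equivalent statements (1), (2), (3) holds, then a non-degenerate bilinear form $b$ on $V$ satisfying $b(\tau(h)v,w)=b(v,S(h)w)$ for all $h\in H$ and $v,w\in V$ is unique up to scalar multiples and satisfies $b(w,gv)=\nu^\tau(V)\cdot b(v,w)$ for all $v,w\in V$.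
   Context: A quasi-Hopf algebra (Drinfeld) is a datum $(H,\Delta,\varepsilon,\Phi,S,\alpha,\beta)$: an algebra $H$, algebra maps $\Delta:H\to H\otimes H$, $\varepsilon:H\to k$, an anti-algebra automorphism $S$, elements $\alpha,\beta\in H$ and an invertible $\Phi\in H^{\otimes3}$ with inverse $\overline{\Phi}$, satisfying $(\mathrm{id}\otimes\Delta)\Delta(h)=\Phi\,(\Delta\otimes\mathrm{id})\Delta(h)\,\overline{\Phi}$, counitality of $\varepsilon$, the pentagon identity $(\mathrm{id}\otimes\mathrm{id}\otimes\Delta)(\Phi)(\Delta\otimes\mathrm{id}\otimes\mathrm{id})(\Phi)=(1\otimes\Phi)(\mathrm{id}\otimes\Delta\otimes\mathrm{id})(\Phi)(\Phi\otimes1)$, $(\mathrm{id}\otimes\varepsilon\otimes\mathrm{id})(\Phi)=1$, $S(h_{(1)})\alpha h_{(2)}=\varepsilon(h)\alpha$, $h_{(1)}\beta S(h_{(2)})=\varepsilon(h)\beta$, $\Phi^1\beta S(\Phi^2)\alpha\Phi^3=1$ and $S(\overline{\Phi}{}^1)\alpha\overline{\Phi}{}^2\beta S(\overline{\Phi}{}^3)=1$. A morphism $f:H_1\to H_2$ of quasi-Hopf algebras is an algebra map with $\Delta_2f=(f\otimes f)\Delta_1$, $\varepsilon_2f=\varepsilon_1$, $\Phi_2=(f\otimes f\otimes f)(\Phi_1)$, $S_2f=fS_1$, $\alpha_2=f(\alpha_1)$, $\beta_2=f(\beta_1)$. An involution of $H$ is a morphism $\tau:H\to H$ of quasi-Hopf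 algebras with $\tau^2=\mathrm{id}_H$. The category of finite-dimensional left $H$-modules is a rigid monoidal category (associativity given by the action of $\Phi$); the dual of $V$ is $V^\vee=\mathrm{Hom}_k(V,k)$ with $\langle af,v\rangle=\langle f,S(a)v\rangle$, evaluation $e_V:V^\vee\otimes V\to k$, $e_V(\lambda\otimes v)=\langle\lambda,\alpha v\rangle$, and coevaluation $c_V:k\to V\otimes V^\vee$, $c_V(1)=\sum_i\beta v_i\otimes v^i$ for a basis $\{v_i\}$ of $V$ with dual basis $\{v^i\}$. For $H$ finite-dimensional semisimple (and $k$ algebraically closed of characteristic zero) this category has a canonical pivotal structure, i.e. an isomorphism $j:\mathrm{id}\to(-)^{\vee\vee}$ of $k$-linear monoidal functors such that for all $V$ the composite $e_{V^\vee}\circ(j_V\otimes\mathrm{id}_{V^\vee})\circ c_V:k\to k$ sends $1$ to $\dim_k(V)$. The canonical pivotal element is $g=\iota_H^{-1}(j_H(1))\in H$, where $\iota_H:H\to H^{\vee\vee}$ is the canonical map $\langle\iota_H(v),f\rangle=\langle f,v\rangle$. The element $g$ is invertible, $S(g)=g^{-1}$, $S^2(a)=gag^{-1}$ for $a\in H$, and $\tau(g)=g$ for any involution $\tau$. For a left $H$-module $V$, $\tau^\natural(V)$ is the vector space $V$ with $H$ acting by $h\cdot v=\tau(h)v$. The $\tau$-twisted Frobenius--Schur indicator $\nu^\tau(V)\in k$ of a finite-dimensional left $H$-module $V$ is defined as follows: let $V^\sharp$ be the space $V^\vee$ with $H$-action $\langle af,v\rangle=\langle f,S(\tau(a))v\rangle$;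 then $\nu^\tau(V)$ is the trace of the linear map $\mathrm{Hom}_H(V,V^\sharp)\to\mathrm{Hom}_H(V,V^\sharp)$ sending $f$ to the map $V\to V^\vee$, $v\mapsto\big(w\mapsto\langle f(w),gv\rangle\big)$. *)

theory Defs
  imports
    "HOL-Computational_Algebra.Polynomial"
    "HOL-Library.Function_Algebras"
begin

section \<open>Tensor powers of the algebra\<close>

text \<open>
  A finite formal sum of pure tensors is written as the list of its summands, so that a sum over
  Sweedler components is literally a \<open>sum_list\<close>. Two lists present the same element of the tensor
  power iff all multilinear forms agree on them; over a field the multilinear forms are the linear
  functionals on the tensor power, and these separate its points.
\<close>

definition mlin2 :: "('k::field \<Rightarrow> 'h::ab_group_add \<Rightarrow> 'h) \<Rightarrow> ('h \<Rightarrow> 'h \<Rightarrow> 'k) \<Rightarrow> bool" where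
  "mlin2 s F \<longleftrightarrow>
     (\<forall>b. Vector_Spaces.linear s (*) (\<lambda>x. F x b)) \<and>
     (\<forall>a. Vector_Spaces.linear s (*) (\<lambda>x. F a x))"

definition mlin3 :: "('k::field \<Rightarrow> 'h::ab_group_add \<Rightarrow> 'h) \<Rightarrow> ('h \<Rightarrow> 'h \<Rightarrow> 'h \<Rightarrow> 'k) \<Rightarrow> bool" where
  "mlin3 s F \<longleftrightarrow>
     (\<forall>b c. Vector_Spaces.linear s (*) (\<lambda>x. F x b c)) \<and>
     (\<forall>a c. Vector_Spaces.linear s (*) (\<lambda>x. F a x c)) \<and>
     (\<forall>a b. Vector_Spaces.linear s (*) (\<lambda>x. F a b x))"

definition mlin4 ::
    "('k::field \<Rightarrow> 'h::ab_group_add \<Rightarrow> 'h) \<Rightarrow> ('h \<Rightarrow> 'h \<Rightarrow> 'h \<Rightarrow> 'h \<Rightarrow> 'k) \<Rightarrow> bool" where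
  "mlin4 s F \<longleftrightarrow>
     (\<forall>b c d. Vector_Spaces.linear s (*) (\<lambda>x. F x b c d)) \<and>
     (\<forall>a c d. Vector_Spaces.linear s (*) (\<lambda>x. F a x c d)) \<and>
     (\<forall>a b d. Vector_Spaces.linear s (*) (\<lambda>x. F a b x d)) \<and>
     (\<forall>a b c. Vector_Spaces.linear s (*) (\<lambda>x. F a b c x))"

definition teq2 ::
    "('k::field \<Rightarrow> 'h::ab_group_add \<Rightarrow> 'h) \<Rightarrow> ('h \<times> 'h) list \<Rightarrow> ('h \<times> 'h) list \<Rightarrow> bool" where
  "teq2 s t u \<longleftrightarrow>
     (\<forall>F. mlin2 s F \<longrightarrow> (\<Sum>(x, y)\<leftarrow>t. F x y) = (\<Sum>(x, y)\<leftarrow>u. F x y))"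

definition teq3 ::
    "('k::field \<Rightarrow> 'h::ab_group_add \<Rightarrow> 'h) \<Rightarrow> ('h \<times> 'h \<times> 'h) list \<Rightarrow> ('h \<times> 'h \<times> 'h) list \<Rightarrow> bool" where
  "teq3 s t u \<longleftrightarrow>
     (\<forall>F. mlin3 s F \<longrightarrow> (\<Sum>(x, y, z)\<leftarrow>t. F x y z) = (\<Sum>(x, y, z)\<leftarrow>u. F x y z))"

definition teq4 ::
    "('k::field \<Rightarrow> 'h::ab_group_add \<Rightarrow> 'h) \<Rightarrow>
     ('h \<times> 'h \<times> 'h \<times> 'h) list \<Rightarrow> ('h \<times> 'h \<times> 'h \<times> 'h) list \<Rightarrow> bool" where
  "teq4 s t u \<longleftrightarrow>
     (\<forall>F. mlin4 s F \<longrightarrow> (\<Sum>(w, x, y, z)\<leftarrow>t. F w x y z) = (\<Sum>(w, x, y, z)\<leftarrow>u. F w x y z))"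

definition tmul2 :: "('h::times \<times> 'h) list \<Rightarrow> ('h \<times> 'h) list \<Rightarrow> ('h \<times> 'h) list" where
  "tmul2 t u = [(a * a', b * b'). (a, b) \<leftarrow> t, (a', b') \<leftarrow> u]"

definition tmul3 ::
    "('h::times \<times> 'h \<times> 'h) list \<Rightarrow> ('h \<times> 'h \<times> 'h) list \<Rightarrow> ('h \<times> 'h \<times> 'h) list" where
  "tmul3 t u = [(a * a', b * b', c * c'). (a, b, c) \<leftarrow> t, (a', b', c') \<leftarrow> u]"

definition tmul4 ::
    "('h::times \<times> 'h \<times> 'h \<times> 'h) list \<Rightarrow> ('h \<times> 'h \<times> 'h \<times> 'h) list \<Rightarrow> ('h \<times> 'h \<times> 'h \<times> 'h) list" where
  "tmul4 t u = [(a * a', b * b', c * c', d * d'). (a, b, c, d) \<leftarrow> t, (a', b', c', d') \<leftarrow> u]"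


section \<open>Quasi-Hopf algebras\<close>

record ('k, 'h) qha =
  scl :: "'k \<Rightarrow> 'h \<Rightarrow> 'h"
  cop :: "'h \<Rightarrow> ('h \<times> 'h) list"              \<comment> \<open>\<open>\<Delta>\<close>\<close>
  cou :: "'h \<Rightarrow> 'k"                          \<comment> \<open>\<open>\<epsilon>\<close>\<close>
  assoc :: "('h \<times> 'h \<times> 'h) list"             \<comment> \<open>\<open>\<Phi>\<close>\<close>
  assoc_inv :: "('h \<times> 'h \<times> 'h) list"         \<comment> \<open>the inverse of \<open>\<Phi>\<close>\<close>
  anti :: "'h \<Rightarrow> 'h"                         \<comment> \<open>\<open>S\<close>\<close>
  alp :: 'h                                 \<comment> \<open>\<open>\<alpha>\<close>\<close>
  bet :: 'h                                 \<comment> \<open>\<open>\<beta>\<close>\<close>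

locale quasi_hopf_algebra =
  fixes H :: "('k::field, 'h::ring_1) qha"
  assumes scl_vector_space: "vector_space (scl H)"
    and scl_mult_left: "scl H c (x * y) = scl H c x * y"
    and scl_mult_right: "scl H c (x * y) = x * scl H c y"
    and cop_add: "teq2 (scl H) (cop H (x + y)) (cop H x @ cop H y)"
    and cop_scl: "teq2 (scl H) (cop H (scl H c x)) [(scl H c a, b). (a, b) \<leftarrow> cop H x]"
    and cop_mult: "teq2 (scl H) (cop H (x * y)) (tmul2 (cop H x) (cop H y))"
    and cop_one: "teq2 (scl H) (cop H 1) [(1, 1)]"
    and cou_linear: "Vector_Spaces.linear (scl H) (*) (cou H)"
    and cou_mult: "cou H (x * y) = cou H x * cou H y"
    and cou_one: "cou H 1 = 1"
    and anti_linear: "Vector_Spaces.linear (scl H) (scl H) (anti H)"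
    and anti_mult: "anti H (x * y) = anti H y * anti H x"
    and anti_one: "anti H 1 = 1"
    and anti_bij: "bij (anti H)"
    and assoc_inv_right: "teq3 (scl H) (tmul3 (assoc H) (assoc_inv H)) [(1, 1, 1)]"
    and assoc_inv_left: "teq3 (scl H) (tmul3 (assoc_inv H) (assoc H)) [(1, 1, 1)]"
    and quasi_coassoc:
      "teq3 (scl H)
         [(a, b1, b2). (a, b) \<leftarrow> cop H h, (b1, b2) \<leftarrow> cop H b]
         (tmul3 (tmul3 (assoc H) [(a1, a2, b). (a, b) \<leftarrow> cop H h, (a1, a2) \<leftarrow> cop H a]) (assoc_inv H))"
    and counit_left: "(\<Sum>(a, b)\<leftarrow>cop H h. scl H (cou H a) b) = h"
    and counit_right: "(\<Sum>(a, b)\<leftarrow>cop H h. scl H (cou H b) a) = h"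
    and pentagon:
      "teq4 (scl H)
         (tmul4 [(a, b, c1, c2). (a, b, c) \<leftarrow> assoc H, (c1, c2) \<leftarrow> cop H c]
                [(a1, a2, b, c). (a, b, c) \<leftarrow> assoc H, (a1, a2) \<leftarrow> cop H a])
         (tmul4 (tmul4 [(1, a, b, c). (a, b, c) \<leftarrow> assoc H]
                       [(a, b1, b2, c). (a, b, c) \<leftarrow> assoc H, (b1, b2) \<leftarrow> cop H b])
                [(a, b, c, 1). (a, b, c) \<leftarrow> assoc H])"
    and assoc_counit: "teq2 (scl H) [(a, scl H (cou H b) c). (a, b, c) \<leftarrow> assoc H] [(1, 1)]"
    and anti_alp: "(\<Sum>(a, b)\<leftarrow>cop H h. anti H a * alp H * b) = scl H (cou H h) (alp H)"
    and anti_bet: "(\<Sum>(a, b)\<leftarrow>cop H h. a * bet H * anti H b) = scl H (cou H h) (bet H)"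
    and assoc_bet_alp: "(\<Sum>(a, b, c)\<leftarrow>assoc H. a * bet H * anti H b * alp H * c) = 1"
    and assoc_inv_alp_bet:
      "(\<Sum>(a, b, c)\<leftarrow>assoc_inv H. anti H a * alp H * b * bet H * anti H c) = 1"

definition qha_morphism ::
    "('k::field, 'h1::ring_1) qha \<Rightarrow> ('k, 'h2::ring_1) qha \<Rightarrow> ('h1 \<Rightarrow> 'h2) \<Rightarrow> bool" where
  "qha_morphism H1 H2 f \<longleftrightarrow>
     Vector_Spaces.linear (scl H1) (scl H2) f \<and>
     (\<forall>x y. f (x * y) = f x * f y) \<and> f 1 = 1 \<and>
     (\<forall>x. teq2 (scl H2) (cop H2 (f x)) [(f a, f b). (a, b) \<leftarrow> cop H1 x]) \<and>
     (\<forall>x. cou H2 (f x) = cou H1 x) \<and>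
     teq3 (scl H2) (assoc H2) [(f a, f b, f c). (a, b, c) \<leftarrow> assoc H1] \<and>
     (\<forall>x. anti H2 (f x) = f (anti H1 x)) \<and>
     alp H2 = f (alp H1) \<and> bet H2 = f (bet H1)"

definition qha_involution :: "('k::field, 'h::ring_1) qha \<Rightarrow> ('h \<Rightarrow> 'h) \<Rightarrow> bool" where
  "qha_involution H \<tau> \<longleftrightarrow> qha_morphism H H \<tau> \<and> \<tau> \<circ> \<tau> = id"


section \<open>Modules\<close>

text \<open>
  The carrier is a subspace of an ambient vector space; \<open>act\<close> matters only on the carrier. Linear
  maps between modules, in particular the elements of dual spaces, are required to vanish off the
  carrier of their domain, so that they are determined by their values on it.
\<close>

record ('k, 'h, 'v) lmod =
  carr :: "'v set"
  smul :: "'k \<Rightarrow> 'v \<Rightarrow> 'v"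
  act :: "'h \<Rightarrow> 'v \<Rightarrow> 'v"

locale left_module =
  fixes H :: "('k::field, 'h::ring_1) qha"
    and V :: "('k, 'h, 'v::ab_group_add) lmod"
  assumes smul_vector_space: "vector_space (smul V)"
    and carr_subspace: "module.subspace (smul V) (carr V)"
    and act_closed: "v \<in> carr V \<Longrightarrow> act V a v \<in> carr V"
    and act_add: "v \<in> carr V \<Longrightarrow> w \<in> carr V \<Longrightarrow> act V a (v + w) = act V a v + act V a w"
    and act_smul: "v \<in> carr V \<Longrightarrow> act V a (smul V c v) = smul V c (act V a v)"
    and act_plus: "v \<in> carr V \<Longrightarrow> act V (a + b) v = act V a v + act V b v"
    and act_scl: "v \<in> carr V \<Longrightarrow> act V (scl H c a) v = smul V c (act V a v)"
    and act_one: "v \<in> carr V \<Longrightarrow> act V 1 v = v"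
    and act_mult: "v \<in> carr V \<Longrightarrow> act V (a * b) v = act V a (act V b v)"

definition basis_of :: "('k::field \<Rightarrow> 'v::ab_group_add \<Rightarrow> 'v) \<Rightarrow> 'v set \<Rightarrow> 'v set \<Rightarrow> bool" where
  "basis_of s U B \<longleftrightarrow> \<not> module.dependent s B \<and> module.span s B = U"

definition fin_dim :: "('k::field \<Rightarrow> 'v::ab_group_add \<Rightarrow> 'v) \<Rightarrow> 'v set \<Rightarrow> bool" where
  "fin_dim s U \<longleftrightarrow> (\<exists>B. finite B \<and> basis_of s U B)"

definition fd_module ::
    "('k::field, 'h::ring_1) qha \<Rightarrow> ('k, 'h, 'v::ab_group_add) lmod \<Rightarrow> bool" where
  "fd_module H V \<longleftrightarrow> left_module H V \<and> fin_dim (smul V) (carr V)"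

definition submodule :: "('k::field, 'h, 'v::ab_group_add) lmod \<Rightarrow> 'v set \<Rightarrow> bool" where
  "submodule V U \<longleftrightarrow>
     U \<subseteq> carr V \<and> module.subspace (smul V) U \<and> (\<forall>a. \<forall>u\<in>U. act V a u \<in> U)"

definition simple_module :: "('k::field, 'h, 'v::ab_group_add) lmod \<Rightarrow> bool" where
  "simple_module V \<longleftrightarrow>
     carr V \<noteq> {0} \<and> (\<forall>U. submodule V U \<longrightarrow> U = {0} \<or> U = carr V)"

definition semisimple_module :: "('k::field, 'h, 'v::ab_group_add) lmod \<Rightarrow> bool" where
  "semisimple_module V \<longleftrightarrow>
     (\<forall>U. submodule V U \<longrightarrow>
        (\<exists>W. submodule V W \<and> U \<inter> W = {0} \<and> {u + w |u w. u \<in> U \<and> w \<in> W} = carr V))"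

definition regular_module :: "('k::field, 'h::ring_1) qha \<Rightarrow> ('k, 'h, 'h) lmod" where
  "regular_module H = \<lparr>carr = UNIV, smul = scl H, act = (*)\<rparr>"

definition fd_semisimple :: "('k::field, 'h::ring_1) qha \<Rightarrow> bool" where
  "fd_semisimple H \<longleftrightarrow> fin_dim (scl H) UNIV \<and> semisimple_module (regular_module H)"

definition unit_module :: "('k::field, 'h::ring_1) qha \<Rightarrow> ('k, 'h, 'k) lmod" where
  "unit_module H = \<lparr>carr = UNIV, smul = (*), act = (\<lambda>a c. cou H a * c)\<rparr>"

definition linear_on_mod ::
    "('k::field, 'h, 'v::ab_group_add) lmod \<Rightarrow> ('k \<Rightarrow> 'w::ab_group_add \<Rightarrow> 'w) \<Rightarrow> ('v \<Rightarrow> 'w) \<Rightarrow> bool" where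
  "linear_on_mod V s f \<longleftrightarrow>
     (\<forall>v\<in>carr V. \<forall>w\<in>carr V. f (v + w) = f v + f w) \<and>
     (\<forall>c. \<forall>v\<in>carr V. f (smul V c v) = s c (f v))"

definition Hom_mod ::
    "('k::field, 'h, 'v::ab_group_add) lmod \<Rightarrow> ('k, 'h, 'w::ab_group_add) lmod \<Rightarrow> ('v \<Rightarrow> 'w) set" where
  "Hom_mod V W =
     {f. linear_on_mod V (smul W) f \<and> (\<forall>v\<in>carr V. f v \<in> carr W) \<and>
         (\<forall>a. \<forall>v\<in>carr V. f (act V a v) = act W a (f v)) \<and> (\<forall>v. v \<notin> carr V \<longrightarrow> f v = 0)}"

definition iso_mod ::
    "('k::field, 'h, 'v::ab_group_add) lmod \<Rightarrow> ('k, 'h, 'w::ab_group_add) lmod \<Rightarrow> ('v \<Rightarrow> 'w) set" where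
  "iso_mod V W = {f \<in> Hom_mod V W. bij_betw f (carr V) (carr W)}"

definition fun_smul :: "('k \<Rightarrow> 'w \<Rightarrow> 'w) \<Rightarrow> 'k \<Rightarrow> ('v \<Rightarrow> 'w) \<Rightarrow> 'v \<Rightarrow> 'w" where
  "fun_smul s c f = (\<lambda>v. s c (f v))"

text \<open>\<open>Hom\<^sub>k(V, k)\<close> with the action \<open>\<langle>a f, v\<rangle> = \<langle>f, \<sigma>(a) v\<rangle>\<close>.\<close>

definition codual ::
    "('h \<Rightarrow> 'h) \<Rightarrow> ('k::field, 'h, 'v::ab_group_add) lmod \<Rightarrow> ('k, 'h, 'v \<Rightarrow> 'k) lmod" where
  "codual \<sigma> V =
     \<lparr>carr = {f. linear_on_mod V (*) f \<and> (\<forall>v. v \<notin> carr V \<longrightarrow> f v = 0)},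
      smul = fun_smul (*),
      act = (\<lambda>a f v. if v \<in> carr V then f (act V (\<sigma> a) v) else 0)\<rparr>"

definition dual ::
    "('k::field, 'h::ring_1) qha \<Rightarrow> ('k, 'h, 'v::ab_group_add) lmod \<Rightarrow> ('k, 'h, 'v \<Rightarrow> 'k) lmod" where
  "dual H V = codual (anti H) V"

definition sharp ::
    "('k::field, 'h::ring_1) qha \<Rightarrow> ('h \<Rightarrow> 'h) \<Rightarrow> ('k, 'h, 'v::ab_group_add) lmod \<Rightarrow>
     ('k, 'h, 'v \<Rightarrow> 'k) lmod" where
  "sharp H \<tau> V = codual (anti H \<circ> \<tau>) V"

definition natural_twist :: "('h \<Rightarrow> 'h) \<Rightarrow> ('k, 'h, 'v) lmod \<Rightarrow> ('k, 'h, 'v) lmod" where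
  "natural_twist \<tau> V = \<lparr>carr = carr V, smul = smul V, act = (\<lambda>h. act V (\<tau> h))\<rparr>"

text \<open>For \<open>f : V \<rightarrow> W\<close>, the transposed map from the dual of \<open>W\<close> to the dual of \<open>V\<close>.\<close>

definition transp ::
    "('k::field, 'h::ring_1) qha \<Rightarrow> ('k, 'h, 'w::ab_group_add) lmod \<Rightarrow> ('v \<Rightarrow> 'w) \<Rightarrow>
     ('w \<Rightarrow> 'k) \<Rightarrow> 'v \<Rightarrow> 'k" where
  "transp H W f = (\<lambda>l. if l \<in> carr (dual H W) then l \<circ> f else 0)"

definition bitransp ::
    "('k::field, 'h::ring_1) qha \<Rightarrow> ('k, 'h, 'v::ab_group_add) lmod \<Rightarrow>
     ('k, 'h, 'w::ab_group_add) lmod \<Rightarrow> ('v \<Rightarrow> 'w) \<Rightarrow> (('v \<Rightarrow> 'k) \<Rightarrow> 'k) \<Rightarrow> ('w \<Rightarrow> 'k) \<Rightarrow> 'k" where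
  "bitransp H V W f = transp H (dual H V) (transp H W f)"

definition iota ::
    "('k::field, 'h::ring_1) qha \<Rightarrow> ('k, 'h, 'v::ab_group_add) lmod \<Rightarrow> 'v \<Rightarrow> ('v \<Rightarrow> 'k) \<Rightarrow> 'k" where
  "iota H V v = (\<lambda>f. if f \<in> carr (dual H V) then f v else 0)"


section \<open>Rigid monoidal structure\<close>

definition bilinear_on_mods ::
    "('k::field, 'h, 'u::ab_group_add) lmod \<Rightarrow> ('k, 'h, 'v::ab_group_add) lmod \<Rightarrow>
     ('k \<Rightarrow> 'w::ab_group_add \<Rightarrow> 'w) \<Rightarrow> ('u \<Rightarrow> 'v \<Rightarrow> 'w) \<Rightarrow> bool" where
  "bilinear_on_mods M N s b \<longleftrightarrow>
     (\<forall>n\<in>carr N. linear_on_mod M s (\<lambda>m. b m n)) \<and> (\<forall>m\<in>carr M. linear_on_mod N s (b m))"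

text \<open>
  \<open>T\<close> together with \<open>t : M \<times> N \<rightarrow> T\<close> is the tensor product \<open>M \<otimes> N\<close>, by its universal property.
  It suffices to test the latter on bilinear forms: a linear map is bijective iff its transpose is.
\<close>

definition tensor_product ::
    "('k::field, 'h::ring_1) qha \<Rightarrow> ('k, 'h, 'u::ab_group_add) lmod \<Rightarrow>
     ('k, 'h, 'v::ab_group_add) lmod \<Rightarrow> ('k, 'h, 'w::ab_group_add) lmod \<Rightarrow>
     ('u \<Rightarrow> 'v \<Rightarrow> 'w) \<Rightarrow> bool" where
  "tensor_product H M N T t \<longleftrightarrow>
     bilinear_on_mods M N (smul T) t \<and>
     (\<forall>m\<in>carr M. \<forall>n\<in>carr N. t m n \<in> carr T) \<and>
     (\<forall>h. \<forall>m\<in>carr M. \<forall>n\<in>carr N.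
        act T h (t m n) = (\<Sum>(a, b)\<leftarrow>cop H h. t (act M a m) (act N b n))) \<and>
     (\<forall>F. bilinear_on_mods M N (*) F \<longrightarrow>
        (\<exists>!l. l \<in> carr (dual H T) \<and> (\<forall>m\<in>carr M. \<forall>n\<in>carr N. l (t m n) = F m n)))"

definition ev ::
    "('k::field, 'h::ring_1) qha \<Rightarrow> ('k, 'h, 'v::ab_group_add) lmod \<Rightarrow> ('v \<Rightarrow> 'k) \<Rightarrow> 'v \<Rightarrow> 'k" where
  "ev H V l v = l (act V (alp H) v)"

text \<open>
  The dual of a product. Let \<open>E : (N\<^sup>\<or> \<otimes> M\<^sup>\<or>) \<otimes> (M \<otimes> N) \<rightarrow> k\<close> be \<open>e\<^sub>N \<circ> (id \<otimes> (e\<^sub>M \<otimes> id))\<close> preceded by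
  the associativity isomorphisms, that is, by \<open>\<Phi>\<close> for the triple \<open>(N\<^sup>\<or>, M\<^sup>\<or>, M \<otimes> N)\<close> and then by
  the inverse of \<open>\<Phi>\<close> for the triple \<open>(M\<^sup>\<or>, M, N)\<close>.
\<close>

definition pair_ev ::
    "('k::field, 'h::ring_1) qha \<Rightarrow> ('k, 'h, 'u::ab_group_add) lmod \<Rightarrow>
     ('k, 'h, 'v::ab_group_add) lmod \<Rightarrow> ('v \<Rightarrow> 'k) \<Rightarrow> ('u \<Rightarrow> 'k) \<Rightarrow> 'u \<Rightarrow> 'v \<Rightarrow> 'k" where
  "pair_ev H M N \<phi> \<psi> m n =
     (\<Sum>(a, b, c)\<leftarrow>assoc H. \<Sum>(c1, c2)\<leftarrow>cop H c. \<Sum>(p, q, r)\<leftarrow>assoc_inv H.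
        ev H N (act (dual H N) a \<phi>) (act N (r * c2) n) *
        ev H M (act (dual H M) (p * b) \<psi>) (act M (q * c1) m))"

text \<open>
  An \<open>H\<close>-linear form \<open>E : X \<otimes> Y \<rightarrow> k\<close> corresponds to the \<open>H\<close>-linear map
  \<open>X \<rightarrow> X \<otimes> (Y \<otimes> Y\<^sup>\<or>) \<rightarrow> (X \<otimes> Y) \<otimes> Y\<^sup>\<or> \<rightarrow> Y\<^sup>\<or>\<close> given by the coevaluation of \<open>Y\<close>, the inverse of \<open>\<Phi>\<close>
  and \<open>E\<close>. With \<open>(p, q, r)\<close> running over the inverse of \<open>\<Phi>\<close>, it sends \<open>x\<close> to
  \<open>\<Sum>\<^sub>i E(p x, q \<beta> y\<^sub>i) r y\<^sup>i\<close>, whose value at \<open>y\<close> is \<open>E(p x, q \<beta> S(r) y)\<close>. For \<open>E = pair_ev\<close> this is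
  the canonical isomorphism from \<open>N\<^sup>\<or> \<otimes> M\<^sup>\<or>\<close> to the dual of \<open>M \<otimes> N\<close>, and for the multiplication
  \<open>E : k \<otimes> k \<rightarrow> k\<close> it is the canonical isomorphism from \<open>k\<close> to the dual of \<open>k\<close>.
\<close>

definition dual_tensor ::
    "('k::field, 'h::ring_1) qha \<Rightarrow> ('k, 'h, 'u::ab_group_add) lmod \<Rightarrow>
     ('k, 'h, 'v::ab_group_add) lmod \<Rightarrow> ('v \<Rightarrow> 'k) \<Rightarrow> ('u \<Rightarrow> 'k) \<Rightarrow> 'u \<Rightarrow> 'v \<Rightarrow> 'k" where
  "dual_tensor H M N \<phi> \<psi> m n =
     (\<Sum>(p, q, r)\<leftarrow>assoc_inv H. \<Sum>(p1, p2)\<leftarrow>cop H p. \<Sum>(s1, s2)\<leftarrow>cop H (q * bet H * anti H r).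
        pair_ev H M N (act (dual H N) p1 \<phi>) (act (dual H M) p2 \<psi>) (act M s1 m) (act N s2 n))"

definition dual_unit :: "('k::field, 'h::ring_1) qha \<Rightarrow> 'k \<Rightarrow> 'k \<Rightarrow> 'k" where
  "dual_unit H x y =
     (\<Sum>(p, q, r)\<leftarrow>assoc_inv H.
        act (unit_module H) p x * act (unit_module H) (q * bet H * anti H r) y)"


section \<open>The canonical pivotal structure\<close>

text \<open>
  The category of finite-dimensional modules is represented by its full subcategory of modules
  whose underlying space is a subspace of \<open>k\<^sup>\<nat>\<close>; every finite-dimensional module is isomorphic to
  one of these. A component at a module of another type (a tensor product, the unit object, the
  regular module) is obtained by transport along an isomorphism with such a module.
\<close>

type_synonym ('k, 'h) mod_obj = "('k, 'h, nat \<Rightarrow> 'k) lmod"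

type_synonym ('k, 'h) to_bidual =
  "('k, 'h) mod_obj \<Rightarrow> (nat \<Rightarrow> 'k) \<Rightarrow> ((nat \<Rightarrow> 'k) \<Rightarrow> 'k) \<Rightarrow> 'k"

text \<open>
  The monoidal structure of the double dual functor is the composite of the canonical isomorphism
  \<open>M\<^sup>\<or>\<^sup>\<or> \<otimes> N\<^sup>\<or>\<^sup>\<or> \<rightarrow> (N\<^sup>\<or> \<otimes> M\<^sup>\<or>)\<^sup>\<or>\<close> with the inverse of the transpose of
  \<open>N\<^sup>\<or> \<otimes> M\<^sup>\<or> \<rightarrow> (M \<otimes> N)\<^sup>\<or>\<close>. In the condition \<open>tensor\<close>, both sides are elements of
  \<open>(N\<^sup>\<or> \<otimes> M\<^sup>\<or>)\<^sup>\<or>\<close> evaluated at \<open>\<phi> \<otimes> \<psi>\<close>, and \<open>l\<close> is the image of \<open>\<phi> \<otimes> \<psi>\<close> in the dual of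
  \<open>T = M \<otimes> N\<close>. Similarly for the unit object, presented by \<open>\<theta> : k \<rightarrow> U\<close>.
\<close>

locale pivotal_structure =
  fixes H :: "('k::field, 'h::ring_1) qha"
    and j :: "('k, 'h) to_bidual"
  assumes component: "fd_module H M \<Longrightarrow> j M \<in> iso_mod M (dual H (dual H M))"
    and natural:
      "\<lbrakk>fd_module H M; fd_module H N; f \<in> Hom_mod M N; m \<in> carr M\<rbrakk> \<Longrightarrow>
         j N (f m) = bitransp H M N f (j M m)"
    and tensor:
      "\<lbrakk>fd_module H M; fd_module H N; fd_module H T; tensor_product H M N T t;
        m \<in> carr M; n \<in> carr N; \<phi> \<in> carr (dual H N); \<psi> \<in> carr (dual H M); l \<in> carr (dual H T);
        \<forall>m'\<in>carr M. \<forall>n'\<in>carr N. l (t m' n') = dual_tensor H M N \<phi> \<psi> m' n'\<rbrakk> \<Longrightarrow>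
         j T (t m n) l = dual_tensor H (dual H N) (dual H M) (j M m) (j N n) \<phi> \<psi>"
    and unit:
      "\<lbrakk>fd_module H U; \<theta> \<in> iso_mod (unit_module H) U; l \<in> carr (dual H U);
        \<forall>z. l (\<theta> z) = dual_unit H y z\<rbrakk> \<Longrightarrow>
         j U (\<theta> x) l = dual_unit H x y"

text \<open>
  The left-hand side of the equation is the image of \<open>1\<close> under the composite
  \<open>k \<rightarrow> M \<otimes> M\<^sup>\<or> \<rightarrow> M\<^sup>\<or>\<^sup>\<or> \<otimes> M\<^sup>\<or> \<rightarrow> k\<close> of \<open>c\<^sub>M\<close>, \<open>j\<^sub>M \<otimes> id\<close> and the evaluation of the dual of \<open>M\<close>; the
  coordinate functions of \<open>B\<close> form the dual basis.
\<close>

definition canonical_pivotal_structure ::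
    "('k::field, 'h::ring_1) qha \<Rightarrow> ('k, 'h) to_bidual \<Rightarrow> bool" where
  "canonical_pivotal_structure H j \<longleftrightarrow>
     pivotal_structure H j \<and>
     (\<forall>M B. fd_module H M \<and> basis_of (smul M) (carr M) B \<longrightarrow>
        (\<Sum>b\<in>B. ev H (dual H M) (j M (act M (bet H) b)) (\<lambda>v. module.representation (smul M) B v b))
        = of_nat (vector_space.dim (smul M) (carr M)))"

text \<open>
  \<open>\<iota>\<^sub>H(g) = j\<^sub>H(1)\<close>, where the component \<open>j\<^sub>H\<close> is the transport of \<open>j R\<close> along an isomorphism
  \<open>\<theta> : H \<rightarrow> R\<close>.
\<close>

definition canonical_pivotal_element :: "('k::field, 'h::ring_1) qha \<Rightarrow> 'h \<Rightarrow> bool" where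
  "canonical_pivotal_element H g \<longleftrightarrow>
     (\<exists>j. canonical_pivotal_structure H j \<and>
        (\<forall>R \<theta>. fd_module H R \<and> \<theta> \<in> iso_mod (regular_module H) R \<longrightarrow>
           bitransp H (regular_module H) R \<theta> (iota H (regular_module H) g) = j R (\<theta> 1)))"


section \<open>Twisted Frobenius-Schur indicators\<close>

definition trace_on ::
    "('k::field \<Rightarrow> 'v::ab_group_add \<Rightarrow> 'v) \<Rightarrow> 'v set \<Rightarrow> ('v \<Rightarrow> 'v) \<Rightarrow> 'k" where
  "trace_on s U f =
     (let B = (SOME B. basis_of s U B) in \<Sum>b\<in>B. module.representation s B (f b) b)"

definition fs_indicator ::
    "('k::field, 'h::ring_1) qha \<Rightarrow> 'h \<Rightarrow> ('h \<Rightarrow> 'h) \<Rightarrow> ('k, 'h, 'v::ab_group_add) lmod \<Rightarrow> 'k" where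
  "fs_indicator H g \<tau> V =
     trace_on (fun_smul (smul (sharp H \<tau> V))) (Hom_mod V (sharp H \<tau> V))
       (\<lambda>f v w. if v \<in> carr V \<and> w \<in> carr V then f w (act V g v) else 0)"

definition nondeg_bilinear_form ::
    "('k::field, 'h, 'v::ab_group_add) lmod \<Rightarrow> ('v \<Rightarrow> 'v \<Rightarrow> 'k) \<Rightarrow> bool" where
  "nondeg_bilinear_form V b \<longleftrightarrow>
     bilinear_on_mods V V (*) b \<and>
     (\<forall>v\<in>carr V. (\<forall>w\<in>carr V. b v w = 0) \<longrightarrow> v = 0) \<and>
     (\<forall>w\<in>carr V. (\<forall>v\<in>carr V. b v w = 0) \<longrightarrow> w = 0)"

definition tau_adjoint_form ::
    "('k::field, 'h::ring_1) qha \<Rightarrow> ('h \<Rightarrow> 'h) \<Rightarrow> ('k, 'h, 'v::ab_group_add) lmod \<Rightarrow>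
     ('v \<Rightarrow> 'v \<Rightarrow> 'k) \<Rightarrow> bool" where
  "tau_adjoint_form H \<tau> V b \<longleftrightarrow>
     (\<forall>h. \<forall>v\<in>carr V. \<forall>w\<in>carr V. b (act V (\<tau> h) v) w = b v (act V (anti H h) w))"

end

theory Submission
  imports Defs
begin

text \<open>
  A form adjoint with respect to \<open>\<tau>\<close> is an \<open>H\<close>-linear map from \<open>V\<close> to its twisted dual, so by Schur's
  lemma there is at most one up to scalars. Since \<open>S\<^sup>2(h) g = g h\<close>, the map sending \<open>b\<close> to
  \<open>(v, w) \<mapsto> b(w, g v)\<close> acts on this space by a scalar \<open>\<nu>\<close>, which is the indicator. Its square sends \<open>b\<close>
  to \<open>b(g v, g w) = b(v, S(\<tau>(g)) g w)\<close>, so \<open>\<nu>\<^sup>2 = 1\<close> as soon as \<open>S(g) g = 1\<close> and \<open>\<tau>(g) = g\<close> on \<open>V\<close>.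

  The first identity uses that the pivotal structure is monoidal: on \<open>H \<otimes> H\<close> this says that
  \<open>f \<Delta>(g) = (S \<otimes> S)(f\<^sub>2\<^sub>1) (g \<otimes> g)\<close> for the Drinfeld twist \<open>f\<close>, and applying
  \<open>x \<otimes> y \<mapsto> S(x) S(\<beta>) y\<close> gives \<open>S(g) g \<alpha> = \<epsilon>(g) \<alpha>\<close>, where \<open>S(g) g\<close> is central. For the second, \<open>\<tau>(g)\<close>
  is a multiple of \<open>g\<close> on \<open>V\<close> by Schur's lemma, and the normalisation \<open>tr(S(\<alpha>) g \<beta>) = dim\<close>, which holds
  for \<open>V\<close> and its twist by \<open>\<tau>\<close>, shows that the factor is 1.
\<close>

section \<open>Sums over Sweedler components\<close>

text \<open>The functional involving S(\<beta>) is the one under which both sides of the monoidality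
  equation collapse. Summing over the twist f with components x and y, one has S(x) S(\<beta>) y =
  \<epsilon>(\<beta>) \<alpha>, which rests on a snake identity extracted from the pentagon, and x
  \<beta> S(y) = \<epsilon>(\<beta>) S(\<alpha>), which appears on the other side because there f is
  flipped and carried through S. The scalar \<epsilon>(g) left at the end is 1: it is idempotent
  since \<epsilon> is invariant under S, and nonzero since j is bijective at the unit object.

  A further obstacle is that j has components only at modules on subspaces of
  \<open>k\<^sup>\<nat>\<close>. Each use of it at H, at H \<otimes> H, at the unit object or at V
  passes through an isomorphic copy, and for H \<otimes> H this requires a concrete model whose
  universal property can be checked.\<close>

lemma sum_list_map_concat:
  "sum_list (map f (concat xss)) = (\<Sum>xs\<leftarrow>xss. sum_list (map f xs))"
  by (induction xss) auto

lemma sum_list_map_swap: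
  fixes f :: "'a \<Rightarrow> 'b \<Rightarrow> 'c::comm_monoid_add"
  shows "(\<Sum>x\<leftarrow>xs. \<Sum>y\<leftarrow>ys. f x y) = (\<Sum>y\<leftarrow>ys. \<Sum>x\<leftarrow>xs. f x y)"
  by (induction xs) (auto simp: sum_list_addf)

lemma linear_sum_list_map:
  assumes "Vector_Spaces.linear s t f"
  shows "f (\<Sum>x\<leftarrow>xs. F x) = (\<Sum>x\<leftarrow>xs. f (F x))"
proof -
  interpret f: Vector_Spaces.linear s t f by (rule assms)
  show ?thesis by (induction xs) (auto simp: f.add f.zero)
qed

lemma vector_space_mult: "vector_space ((*) :: 'k::field \<Rightarrow> 'k \<Rightarrow> 'k)"
  by unfold_locales (auto simp: algebra_simps)

context quasi_hopf_algebra
begin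

abbreviation lin_form :: "('h \<Rightarrow> 'k) \<Rightarrow> bool" where
  "lin_form \<equiv> Vector_Spaces.linear (scl H) (*)"

abbreviation lin_endo :: "('h \<Rightarrow> 'h) \<Rightarrow> bool" where
  "lin_endo \<equiv> Vector_Spaces.linear (scl H) (scl H)"

text \<open>Two lists presenting the same tensor need not be equal, but every multilinear form takes
  the same value on both. Naming this value for \<Delta>(h), for \<Phi> and for its inverse turns
  the axioms into rewrite rules between scalars, each with a multilinearity side condition.\<close>

definition cop_sum :: "'h \<Rightarrow> ('h \<Rightarrow> 'h \<Rightarrow> 'k) \<Rightarrow> 'k" where
  "cop_sum h F = (\<Sum>(a, b)\<leftarrow>cop H h. F a b)"

definition phi_sum :: "('h \<Rightarrow> 'h \<Rightarrow> 'h \<Rightarrow> 'k) \<Rightarrow> 'k" where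
  "phi_sum F = (\<Sum>(a, b, c)\<leftarrow>assoc H. F a b c)"

definition phi_inv_sum :: "('h \<Rightarrow> 'h \<Rightarrow> 'h \<Rightarrow> 'k) \<Rightarrow> 'k" where
  "phi_inv_sum F = (\<Sum>(a, b, c)\<leftarrow>assoc_inv H. F a b c)"

lemmas sweedler_sum_defs = cop_sum_def phi_sum_def phi_inv_sum_def

sublocale scl: vector_space "scl H"
  by (rule scl_vector_space)

lemma lin_form_iff:
  "lin_form f \<longleftrightarrow> (\<forall>x y. f (x + y) = f x + f y) \<and> (\<forall>c x. f (scl H c x) = c * f x)"
  using scl_vector_space vector_space_mult by (auto simp: Vector_Spaces.linear_iff)

lemma lin_endo_iff:
  "lin_endo f \<longleftrightarrow> (\<forall>x y. f (x + y) = f x + f y) \<and> (\<forall>c x. f (scl H c x) = scl H c (f x))"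
  using scl_vector_space by (auto simp: Vector_Spaces.linear_iff)

lemma cop_sum_add: "mlin2 (scl H) F \<Longrightarrow> cop_sum (x + y) F = cop_sum x F + cop_sum y F"
  using cop_add[of x y] by (auto simp: teq2_def cop_sum_def)

lemma cop_sum_scl: "mlin2 (scl H) F \<Longrightarrow> cop_sum (scl H c x) F = c * cop_sum x F"
  using cop_scl[of c x]
  by (auto simp: teq2_def cop_sum_def split_def mlin2_def lin_form_iff sum_list_const_mult comp_def)

lemma cop_sum_mult:
  assumes "mlin2 (scl H) F"
  shows "cop_sum (x * y) F = cop_sum x (\<lambda>a b. cop_sum y (\<lambda>a' b'. F (a * a') (b * b')))"
  using cop_mult[of x y] assms
  by (auto simp: teq2_def cop_sum_def split_def tmul2_def sum_list_map_concat comp_def)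

lemma cop_sum_one: "mlin2 (scl H) F \<Longrightarrow> cop_sum 1 F = F 1 1"
  using cop_one by (auto simp: teq2_def cop_sum_def)

lemma phi_phi_inv: "mlin3 (scl H) F \<Longrightarrow>
    phi_sum (\<lambda>a b c. phi_inv_sum (\<lambda>p q r. F (a * p) (b * q) (c * r))) = F 1 1 1"
  using assoc_inv_right
  by (auto simp: teq3_def sweedler_sum_defs split_def tmul3_def sum_list_map_concat comp_def)

lemma phi_inv_phi: "mlin3 (scl H) F \<Longrightarrow>
    phi_inv_sum (\<lambda>p q r. phi_sum (\<lambda>a b c. F (p * a) (q * b) (r * c))) = F 1 1 1"
  using assoc_inv_left
  by (auto simp: teq3_def sweedler_sum_defs split_def tmul3_def sum_list_map_concat comp_def)

lemma pentagon_sum: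
  assumes "mlin4 (scl H) F"
  shows "phi_sum (\<lambda>a b c. cop_sum c (\<lambda>c1 c2. phi_sum (\<lambda>a' b' c'. cop_sum a' (\<lambda>a1 a2.
           F (a * a1) (b * a2) (c1 * b') (c2 * c'))))) =
         phi_sum (\<lambda>a b c. phi_sum (\<lambda>a' b' c'. cop_sum b' (\<lambda>b1 b2. phi_sum (\<lambda>a'' b'' c''.
           F (a' * a'') (a * b1 * b'') (b * b2 * c'') (c * c')))))"
  using pentagon assms
  by (auto simp: teq4_def sweedler_sum_defs split_def tmul4_def sum_list_map_concat comp_def)

section \<open>Linearity of Sweedler sums in their parameters\<close>

lemma lin_form_mult_const: "lin_form f \<Longrightarrow> lin_form (\<lambda>x. f x * c)"
  by (auto simp: lin_form_iff algebra_simps)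

lemma lin_form_const_mult: "lin_form f \<Longrightarrow> lin_form (\<lambda>x. c * f x)"
  by (auto simp: lin_form_iff algebra_simps)

lemma lin_endo_id: "lin_endo (\<lambda>x. x)"
  by (auto simp: lin_endo_iff)

lemma lin_endo_mult_const: "lin_endo f \<Longrightarrow> lin_endo (\<lambda>x. f x * c)"
  by (auto simp: lin_endo_iff algebra_simps scl_mult_left)

lemma lin_endo_const_mult: "lin_endo f \<Longrightarrow> lin_endo (\<lambda>x. c * f x)"
  by (auto simp: lin_endo_iff algebra_simps scl_mult_right)

lemma lin_endo_anti: "lin_endo f \<Longrightarrow> lin_endo (\<lambda>x. anti H (f x))"
  using anti_linear by (auto simp: lin_endo_iff)

lemma lin_form_comp: "lin_form g \<Longrightarrow> lin_endo f \<Longrightarrow> lin_form (\<lambda>x. g (f x))"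
  by (auto simp: lin_endo_iff lin_form_iff)

lemma lin_form_cou: "lin_endo f \<Longrightarrow> lin_form (\<lambda>x. cou H (f x))"
  using cou_linear by (rule lin_form_comp)

lemma lin_form_sum_list: "(\<And>y. lin_form (\<lambda>x. F x y)) \<Longrightarrow> lin_form (\<lambda>x. \<Sum>y\<leftarrow>ys. F x y)"
  by (induction ys) (auto simp: lin_form_iff algebra_simps)

lemma lin_form_phi_sum: "(\<And>a b c. lin_form (\<lambda>x. F x a b c)) \<Longrightarrow> lin_form (\<lambda>x. phi_sum (F x))"
  unfolding phi_sum_def by (rule lin_form_sum_list) (auto simp: split_def)

lemma lin_form_phi_inv_sum: "(\<And>a b c. lin_form (\<lambda>x. F x a b c)) \<Longrightarrow> lin_form (\<lambda>x. phi_inv_sum (F x))"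
  unfolding phi_inv_sum_def by (rule lin_form_sum_list) (auto simp: split_def)

lemma lin_form_cop_sum: "(\<And>a b. lin_form (\<lambda>x. F x a b)) \<Longrightarrow> lin_form (\<lambda>x. cop_sum h (F x))"
  unfolding cop_sum_def by (rule lin_form_sum_list) (auto simp: split_def)

lemma lin_form_cop_sum_arg: "mlin2 (scl H) F \<Longrightarrow> lin_endo f \<Longrightarrow> lin_form (\<lambda>x. cop_sum (f x) F)"
  by (auto simp: lin_form_iff lin_endo_iff cop_sum_add cop_sum_scl)

lemma mlin2I:
  "(\<And>b. lin_form (\<lambda>x. F x b)) \<Longrightarrow> (\<And>a. lin_form (\<lambda>x. F a x)) \<Longrightarrow> mlin2 (scl H) F"
  by (auto simp: mlin2_def)

lemma mlin3I:
  "(\<And>b c. lin_form (\<lambda>x. F x b c)) \<Longrightarrow> (\<And>a c. lin_form (\<lambda>x. F a x c)) \<Longrightarrow>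
    (\<And>a b. lin_form (\<lambda>x. F a b x)) \<Longrightarrow> mlin3 (scl H) F"
  by (auto simp: mlin3_def)

lemma mlin4I:
  "(\<And>b c d. lin_form (\<lambda>x. F x b c d)) \<Longrightarrow> (\<And>a c d. lin_form (\<lambda>x. F a x c d)) \<Longrightarrow>
    (\<And>a b d. lin_form (\<lambda>x. F a b x d)) \<Longrightarrow> (\<And>a b c. lin_form (\<lambda>x. F a b c x)) \<Longrightarrow> mlin4 (scl H) F"
  by (auto simp: mlin4_def)

lemma lin_form_mlin2:
  assumes "mlin2 (scl H) F" "lin_endo f"
  shows "lin_form (\<lambda>x. F (f x) b)" "lin_form (\<lambda>x. F a (f x))"
  using assms by (auto simp: mlin2_def lin_form_iff lin_endo_iff)

lemma lin_form_mlin3: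
  assumes "mlin3 (scl H) F" "lin_endo f"
  shows "lin_form (\<lambda>x. F (f x) b c)" "lin_form (\<lambda>x. F a (f x) c)" "lin_form (\<lambda>x. F a b (f x))"
  using assms by (auto simp: mlin3_def lin_form_iff lin_endo_iff)

lemma lin_form_mlin4:
  assumes "mlin4 (scl H) F" "lin_endo f"
  shows "lin_form (\<lambda>x. F (f x) b c d)" "lin_form (\<lambda>x. F a (f x) c d)"
    "lin_form (\<lambda>x. F a b (f x) d)" "lin_form (\<lambda>x. F a b c (f x))"
  using assms by (auto simp: mlin4_def lin_form_iff lin_endo_iff)

text \<open>A rewriting under a Sweedler sum asks that the surrounding expression be multilinear in
  the rewritten slots. These rules settle that by following the syntax of the expression.\<close>

lemmas lin_intros =
  mlin2I mlin3I mlin4I lin_form_mult_const lin_form_const_mult lin_endo_id lin_endo_mult_const lin_endo_const_mult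
  lin_endo_anti lin_form_cou lin_form_phi_sum lin_form_phi_inv_sum lin_form_cop_sum lin_form_cop_sum_arg

section \<open>Counit and antipode axioms under forms\<close>

lemma counit_left_sum: "lin_form f \<Longrightarrow> cop_sum h (\<lambda>a b. cou H a * f b) = f h"
  using counit_left[of h] linear_sum_list_map[of "scl H" "(*)" f "\<lambda>(a,b). scl H (cou H a) b" "cop H h"]
  by (simp add: cop_sum_def split_def lin_form_iff)

lemma counit_right_sum: "lin_form f \<Longrightarrow> cop_sum h (\<lambda>a b. cou H b * f a) = f h"
  using counit_right[of h] linear_sum_list_map[of "scl H" "(*)" f "\<lambda>(a,b). scl H (cou H b) a" "cop H h"]
  by (simp add: cop_sum_def split_def lin_form_iff)

lemma anti_alp_sum:
  "lin_form f \<Longrightarrow> cop_sum h (\<lambda>a b. f (anti H a * alp H * b)) = cou H h * f (alp H)"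
  using linear_sum_list_map[of "scl H" "(*)" f "\<lambda>(a,b). anti H a * alp H * b" "cop H h"]
  by (simp add: cop_sum_def split_def anti_alp[unfolded split_def] lin_form_iff)

lemma anti_bet_sum:
  "lin_form f \<Longrightarrow> cop_sum h (\<lambda>a b. f (a * bet H * anti H b)) = cou H h * f (bet H)"
  using linear_sum_list_map[of "scl H" "(*)" f "\<lambda>(a,b). a * bet H * anti H b" "cop H h"]
  by (simp add: cop_sum_def split_def anti_bet[unfolded split_def] lin_form_iff)

lemma bet_alp_sum:
  "lin_form f \<Longrightarrow> phi_sum (\<lambda>a b c. f (a * bet H * anti H b * alp H * c)) = f 1"
  using linear_sum_list_map[of "scl H" "(*)" f
      "\<lambda>(a,b,c). a * bet H * anti H b * alp H * c" "assoc H"]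
  by (simp add: phi_sum_def split_def assoc_bet_alp[unfolded split_def])

lemma alp_bet_sum:
  "lin_form f \<Longrightarrow> phi_inv_sum (\<lambda>a b c. f (anti H a * alp H * b * bet H * anti H c)) = f 1"
  using linear_sum_list_map[of "scl H" "(*)" f
      "\<lambda>(a,b,c). anti H a * alp H * b * bet H * anti H c" "assoc_inv H"]
  by (simp add: phi_inv_sum_def split_def assoc_inv_alp_bet[unfolded split_def])

lemma phi_sum_cou_mid:
  assumes "mlin2 (scl H) F"
  shows "phi_sum (\<lambda>a b c. cou H b * F a c) = F 1 1"
  using assoc_counit assms
  by (auto simp: teq2_def phi_sum_def split_def comp_def mlin2_def lin_form_iff)

lemma sweedler_sum_const_mult:
  "cop_sum h (\<lambda>a b. k * F a b) = k * cop_sum h F"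
  "phi_sum (\<lambda>a b c. k * G a b c) = k * phi_sum G"
  "phi_inv_sum (\<lambda>a b c. k * G a b c) = k * phi_inv_sum G"
  by (simp_all add: sweedler_sum_defs split_def sum_list_const_mult)

lemma sweedler_sum_swap:
  "cop_sum h (\<lambda>a b. phi_sum (\<lambda>x y z. F a b x y z)) = phi_sum (\<lambda>x y z. cop_sum h (\<lambda>a b. F a b x y z))"
  "cop_sum h (\<lambda>a b. phi_inv_sum (\<lambda>x y z. F a b x y z)) = phi_inv_sum (\<lambda>x y z. cop_sum h (\<lambda>a b. F a b x y z))"
  "phi_sum (\<lambda>a b c. phi_inv_sum (\<lambda>x y z. G a b c x y z)) = phi_inv_sum (\<lambda>x y z. phi_sum (\<lambda>a b c. G a b c x y z))"
  "cop_sum h (\<lambda>a b. cop_sum h' (\<lambda>x y. K a b x y)) = cop_sum h' (\<lambda>x y. cop_sum h (\<lambda>a b. K a b x y))"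
  "phi_sum (\<lambda>a b c. phi_sum (\<lambda>x y z. G a b c x y z)) = phi_sum (\<lambda>x y z. phi_sum (\<lambda>a b c. G a b c x y z))"
  "phi_inv_sum (\<lambda>a b c. phi_inv_sum (\<lambda>x y z. G a b c x y z)) = phi_inv_sum (\<lambda>x y z. phi_inv_sum (\<lambda>a b c. G a b c x y z))"
  by (simp only: sweedler_sum_defs split_def, rule sum_list_map_swap)+

text \<open>Applying the algebra map id \<otimes> \<epsilon> \<otimes> id to the product of \<Phi>
  and its inverse removes \<Phi>, by the axiom for its middle slot.\<close>

lemma phi_inv_sum_cou_mid:
  assumes F: "mlin2 (scl H) F"
  shows "phi_inv_sum (\<lambda>a b c. cou H b * F a c) = F 1 1"
proof -
  note li = lin_intros lin_form_mlin2[OF F]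
  have "F 1 1 = phi_sum (\<lambda>a b c. phi_inv_sum (\<lambda>p q r. cou H (b * q) * F (a * p) (c * r)))"
    by (subst phi_phi_inv[of "\<lambda>x y z. cou H y * F x z"]) (intro li | simp add: cou_one)+
  also have "\<dots> = phi_sum (\<lambda>a b c. cou H b * phi_inv_sum (\<lambda>p q r. cou H q * F (a * p) (c * r)))"
    by (simp add: cou_mult mult.assoc sweedler_sum_const_mult)
  also have "\<dots> = phi_inv_sum (\<lambda>a b c. cou H b * F a c)"
    by (subst phi_sum_cou_mid) (intro li | simp)+
  finally show ?thesis ..
qed

section \<open>Consequences of the pentagon identity\<close>

text \<open>Apply \<epsilon> to the second slot of the pentagon identity. The axiom for the middle
  slot and counitality leave \<Phi> = (1 \<otimes> (\<epsilon> \<otimes> id \<otimes> id)(\<Phi>))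
  \<Phi>.\<close>

lemma pentagon_counit_left:
  assumes K: "mlin3 (scl H) K"
  shows "phi_sum K = phi_sum (\<lambda>a b c. cou H a * phi_sum (\<lambda>a' b' c'. K a' (b * b') (c * c')))"
proof -
  note li = lin_intros lin_form_mlin3[OF K]
  have right: "cop_sum h (\<lambda>x y. cou H y * K (a * x) u v) = K (a * h) u v"
    and left: "cop_sum h (\<lambda>x y. cou H x * K a (u * (y * w)) v) = K a (u * (h * w)) v" for h a u v w
    by (rule counit_right_sum counit_left_sum, intro li)+
  have "phi_sum (\<lambda>a b c. cop_sum c (\<lambda>c1 c2. phi_sum (\<lambda>a' b' c'. cop_sum a' (\<lambda>a1 a2.
          cou H (b * a2) * K (a * a1) (c1 * b') (c2 * c'))))) =
        phi_sum (\<lambda>a b c. cou H b * cop_sum c (\<lambda>c1 c2. phi_sum (\<lambda>a' b' c'. K (a * a') (c1 * b') (c2 * c'))))"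
    by (simp add: cou_mult mult.assoc sweedler_sum_const_mult right)
  also have "\<dots> = cop_sum 1 (\<lambda>c1 c2. phi_sum (\<lambda>a' b' c'. K (1 * a') (c1 * b') (c2 * c')))"
    by (rule phi_sum_cou_mid) (intro li)
  also have "\<dots> = phi_sum K"
    by (subst cop_sum_one) (intro li | simp)+
  finally have lhs: "phi_sum K = phi_sum (\<lambda>a b c. cop_sum c (\<lambda>c1 c2. phi_sum (\<lambda>a' b' c'. cop_sum a' (\<lambda>a1 a2.
          cou H (b * a2) * K (a * a1) (c1 * b') (c2 * c')))))" ..
  have "phi_sum K = phi_sum (\<lambda>a b c. phi_sum (\<lambda>a' b' c'. cop_sum b' (\<lambda>b1 b2. phi_sum (\<lambda>a'' b'' c''.
           cou H (a * b1 * b'') * K (a' * a'') (b * b2 * c'') (c * c')))))"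
    unfolding lhs by (rule pentagon_sum[of "\<lambda>w x y z. cou H x * K w y z"]) (intro li)
  also have "\<dots> = phi_sum (\<lambda>a b c. cou H a * phi_sum (\<lambda>a' b' c'. cop_sum b' (\<lambda>b1 b2. cou H b1 *
      phi_sum (\<lambda>a'' b'' c''. cou H b'' * K (a' * a'') (b * b2 * c'') (c * c')))))"
    by (simp add: cou_mult mult.assoc sweedler_sum_const_mult)
  also have "\<dots> = phi_sum (\<lambda>a b c. cou H a * phi_sum (\<lambda>a' b' c'. cop_sum b' (\<lambda>b1 b2. cou H b1 *
      K (a' * 1) (b * b2 * 1) (c * c'))))"
    by (subst phi_sum_cou_mid) (intro li | simp)+
  also have "\<dots> = phi_sum (\<lambda>a b c. cou H a * phi_sum (\<lambda>a' b' c'. K a' (b * b') (c * c')))"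
    using left[of _ _ _ 1] by simp
  finally show ?thesis .
qed

text \<open>The same with \<epsilon> in the third slot, which leaves \<Phi> = \<Phi> ((id \<otimes>
  id \<otimes> \<epsilon>)(\<Phi>) \<otimes> 1).\<close>

lemma pentagon_counit_right:
  assumes K: "mlin3 (scl H) K"
  shows "phi_sum K = phi_sum (\<lambda>a b c. phi_sum (\<lambda>a' b' c'. cou H c' * K (a * a') (b * b') c))"
proof -
  note li = lin_intros lin_form_mlin3[OF K]
  have right: "cop_sum h (\<lambda>x y. cou H y * K u (x * w) v) = K u (h * w) v"
    and left: "cop_sum h (\<lambda>x y. cou H x * K u v (y * w)) = K u v (h * w)" for h u v w
    by (rule counit_right_sum counit_left_sum, intro li)+
  have "phi_sum (\<lambda>a b c. cop_sum c (\<lambda>c1 c2. phi_sum (\<lambda>a' b' c'. cop_sum a' (\<lambda>a1 a2.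
          cou H (c1 * b') * K (a * a1) (b * a2) (c2 * c'))))) =
        phi_sum (\<lambda>a b c. cop_sum c (\<lambda>c1 c2. cou H c1 * phi_sum (\<lambda>a' b' c'. cou H b' * cop_sum a' (\<lambda>a1 a2.
          K (a * a1) (b * a2) (c2 * c')))))"
    by (simp add: cou_mult mult.assoc sweedler_sum_const_mult)
  also have "\<dots> = phi_sum (\<lambda>a b c. cop_sum c (\<lambda>c1 c2. cou H c1 * cop_sum 1 (\<lambda>a1 a2.
          K (a * a1) (b * a2) (c2 * 1))))"
    by (subst phi_sum_cou_mid) (intro li | simp)+
  also have "\<dots> = phi_sum (\<lambda>a b c. cop_sum c (\<lambda>c1 c2. cou H c1 * K (a * 1) (b * 1) (c2 * 1)))"
    by (subst cop_sum_one) (intro li | simp)+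
  also have "\<dots> = phi_sum K"
    using left[of _ _ _ 1] by simp
  finally have lhs: "phi_sum K = phi_sum (\<lambda>a b c. cop_sum c (\<lambda>c1 c2. phi_sum (\<lambda>a' b' c'. cop_sum a' (\<lambda>a1 a2.
          cou H (c1 * b') * K (a * a1) (b * a2) (c2 * c')))))" ..
  have "phi_sum K = phi_sum (\<lambda>a b c. phi_sum (\<lambda>a' b' c'. cop_sum b' (\<lambda>b1 b2. phi_sum (\<lambda>a'' b'' c''.
           cou H (b * b2 * c'') * K (a' * a'') (a * b1 * b'') (c * c')))))"
    unfolding lhs by (rule pentagon_sum[of "\<lambda>w x y z. cou H y * K w x z"]) (intro li)
  also have "\<dots> = phi_sum (\<lambda>a b c. cou H b * phi_sum (\<lambda>a' b' c'. phi_sum (\<lambda>a'' b'' c''. cou H c'' *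
      cop_sum b' (\<lambda>b1 b2. cou H b2 * K (a' * a'') (a * (b1 * b'')) (c * c')))))"
  proof -
    have "cop_sum b' (\<lambda>b1 b2. cou H b2 * phi_sum (\<lambda>a'' b'' c''. cou H c'' * L b1 a'' b'')) =
      phi_sum (\<lambda>a'' b'' c''. cou H c'' * cop_sum b' (\<lambda>b1 b2. cou H b2 * L b1 a'' b''))" for b' L
      by (simp only: sweedler_sum_const_mult[symmetric] sweedler_sum_swap(1) mult.left_commute)
    then show ?thesis
      by (simp add: cou_mult mult.assoc sweedler_sum_const_mult)
  qed
  also have "\<dots> = phi_sum (\<lambda>a' b' c'. phi_sum (\<lambda>a'' b'' c''. cou H c'' *
      cop_sum b' (\<lambda>b1 b2. cou H b2 * K (a' * a'') (1 * (b1 * b'')) (1 * c'))))"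
    by (subst phi_sum_cou_mid) (intro li | simp)+
  also have "\<dots> = phi_sum (\<lambda>a b c. phi_sum (\<lambda>a' b' c'. cou H c' * K (a * a') (b * b') c))"
    by (simp add: right)
  finally show ?thesis .
qed

lemma phi_sum_cou_left:
  assumes F: "mlin2 (scl H) F"
  shows "phi_sum (\<lambda>a b c. cou H a * F b c) = F 1 1"
proof -
  note li = lin_intros lin_form_mlin2[OF F]
  \<comment> \<open>\<open>K\<close> first multiplies its argument by the inverse of \<Phi> on the
    right, so that the factor \<Phi> on both sides of \<open>pentagon_counit_left\<close>
    cancels.\<close>
  define K where "K x y z = phi_inv_sum (\<lambda>p q r. cou H (x * p) * F (y * q) (z * r))" for x y z
  have "F 1 1 = phi_sum K"
    unfolding K_def by (subst phi_phi_inv[of "\<lambda>x y z. cou H x * F y z"]) (intro li | simp add: cou_one)+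
  also have "\<dots> = phi_sum (\<lambda>a b c. cou H a * phi_sum (\<lambda>a' b' c'. K a' (b * b') (c * c')))"
    by (rule pentagon_counit_left) (unfold K_def, intro li)
  also have "\<dots> = phi_sum (\<lambda>a b c. cou H a * F b c)"
    unfolding K_def mult.assoc
    by (subst phi_phi_inv[of "\<lambda>x y z. cou H x * F (_ * y) (_ * z)"]) (intro li | simp add: cou_one)+
  finally show ?thesis ..
qed

lemma phi_sum_cou_right:
  assumes F: "mlin2 (scl H) F"
  shows "phi_sum (\<lambda>a b c. cou H c * F a b) = F 1 1"
proof -
  note li = lin_intros lin_form_mlin2[OF F]
  \<comment> \<open>Here \<Phi> stands to the left of the unknown factor, hence the inverse is
    multiplied on the left.\<close>
  define K where "K x y z = phi_inv_sum (\<lambda>p q r. cou H (r * z) * F (p * x) (q * y))" for x y z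
  have "F 1 1 = phi_inv_sum (\<lambda>p q r. phi_sum (\<lambda>a b c. cou H (r * c) * F (p * a) (q * b)))"
    by (subst phi_inv_phi[of "\<lambda>x y z. cou H z * F x y"]) (intro li | simp add: cou_one)+
  also have "\<dots> = phi_sum K"
    unfolding K_def by (simp only: sweedler_sum_swap)
  also have "\<dots> = phi_sum (\<lambda>a b c. phi_sum (\<lambda>a' b' c'. cou H c' * K (a * a') (b * b') c))"
    by (rule pentagon_counit_right) (unfold K_def, intro li)
  also have "\<dots> = phi_sum (\<lambda>a' b' c'. cou H c' * phi_sum (\<lambda>a b c. K (a * a') (b * b') c))"
    by (subst sweedler_sum_swap) (simp add: sweedler_sum_const_mult)
  also have "\<dots> = phi_sum (\<lambda>a' b' c'. cou H c' * phi_inv_sum (\<lambda>p q r. phi_sum (\<lambda>a b c.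
      cou H (r * c) * F (p * a * a') (q * b * b'))))"
    unfolding K_def by (simp only: sweedler_sum_swap(3) mult.assoc)
  also have "\<dots> = phi_sum (\<lambda>a b c. cou H c * F a b)"
    by (subst phi_inv_phi[of "\<lambda>x y z. cou H z * F (x * _) (y * _)"]) (intro li | simp add: cou_one)+
  finally show ?thesis ..
qed

lemma phi_inv_sum_cou_left:
  assumes F: "mlin2 (scl H) F"
  shows "phi_inv_sum (\<lambda>a b c. cou H a * F b c) = F 1 1"
proof -
  note li = lin_intros lin_form_mlin2[OF F]
  have "F 1 1 = phi_sum (\<lambda>a b c. phi_inv_sum (\<lambda>p q r. cou H (a * p) * F (b * q) (c * r)))"
    by (subst phi_phi_inv[of "\<lambda>x y z. cou H x * F y z"]) (intro li | simp add: cou_one)+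
  also have "\<dots> = phi_sum (\<lambda>a b c. cou H a * phi_inv_sum (\<lambda>p q r. cou H p * F (b * q) (c * r)))"
    by (simp add: cou_mult mult.assoc sweedler_sum_const_mult)
  also have "\<dots> = phi_inv_sum (\<lambda>a b c. cou H a * F b c)"
    by (subst phi_sum_cou_left) (intro li | simp)+
  finally show ?thesis ..
qed

text \<open>
  Multiply the pentagon identity by \<open>1 \<otimes> \<Phi>\<^sup>-\<^sup>1\<close> on the left and by \<open>(\<Delta> \<otimes> id \<otimes> id)(\<Phi>\<^sup>-\<^sup>1)\<close> on the right, and
  apply \<open>w \<otimes> x \<otimes> y \<otimes> z \<mapsto> w \<beta> S(x) \<alpha> y \<otimes> z\<close>.
\<close>

lemma zigzag:
  assumes G: "mlin2 (scl H) G"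
  shows "phi_sum (\<lambda>a b c. cop_sum c (\<lambda>c1 c2. phi_inv_sum (\<lambda>p q r.
      G (a * bet H * anti H (p * b) * alp H * (q * c1)) (r * c2)))) = G 1 1"
proof -
  note li = lin_intros lin_form_mlin2[OF G]
  define E where "E w x y z = G (w * bet H * anti H x * alp H * y) z" for w x y z
  have E: "mlin4 (scl H) E"
    unfolding E_def by (intro li)
  note le = lin_intros lin_form_mlin4[OF E]
  define F where "F w x y z = phi_inv_sum (\<lambda>p q r. phi_inv_sum (\<lambda>p' q' r'. cop_sum p' (\<lambda>p1 p2.
    E (w * p1) (p * x * p2) (q * y * q') (r * z * r'))))" for w x y z
  have F: "mlin4 (scl H) F"
    unfolding F_def by (intro le)
  have cop_bet: "cop_sum h (\<lambda>x y. G (u * x * bet H * anti H y * v) w) = cou H h * G (u * bet H * v) w"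
    for h u v w
    using anti_bet_sum[of "\<lambda>x. G (u * x * v) w" h] by (force simp: mult.assoc intro: li)
  have cop_alp: "cop_sum h (\<lambda>x y. G (u * anti H x * alp H * y * v) w) = cou H h * G (u * alp H * v) w"
    for h u v w
    using anti_alp_sum[of "\<lambda>x. G (u * x * v) w" h] by (force simp: mult.assoc intro: li)
  have "phi_sum (\<lambda>a b c. cop_sum c (\<lambda>c1 c2. phi_inv_sum (\<lambda>p q r. E a (p * b) (q * c1) (r * c2)))) =
    phi_sum (\<lambda>a b c. cop_sum c (\<lambda>c1 c2. phi_sum (\<lambda>a' b' c'. cop_sum a' (\<lambda>a1 a2.
           F (a * a1) (b * a2) (c1 * b') (c2 * c')))))"
  proof -
    have "phi_sum (\<lambda>a' b' c'. cop_sum a' (\<lambda>a1 a2. F (a * a1) (b * a2) (c1 * b') (c2 * c'))) =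
      phi_inv_sum (\<lambda>p q r. E a (p * b) (q * c1) (r * c2))" for a b c1 c2
    proof -
      have "phi_sum (\<lambda>a' b' c'. cop_sum a' (\<lambda>a1 a2. F (a * a1) (b * a2) (c1 * b') (c2 * c'))) =
        phi_inv_sum (\<lambda>p q r. phi_sum (\<lambda>a' b' c'. phi_inv_sum (\<lambda>p' q' r'. cop_sum a' (\<lambda>a1 a2. cop_sum p' (\<lambda>p1 p2.
          E (a * (a1 * p1)) (p * b * (a2 * p2)) (q * c1 * (b' * q')) (r * c2 * (c' * r')))))))"
        unfolding F_def by (simp only: sweedler_sum_swap(1-3) mult.assoc)
      also have "\<dots> = phi_inv_sum (\<lambda>p q r. phi_sum (\<lambda>a' b' c'. phi_inv_sum (\<lambda>p' q' r'. cop_sum (a' * p') (\<lambda>p1 p2.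
          E (a * p1) (p * b * p2) (q * c1 * (b' * q')) (r * c2 * (c' * r'))))))"
        by (subst cop_sum_mult) (intro le | simp)+
      also have "\<dots> = phi_inv_sum (\<lambda>p q r. cop_sum 1 (\<lambda>p1 p2.
          E (a * p1) (p * b * p2) (q * c1 * 1) (r * c2 * 1)))"
      proof -
        have "phi_sum (\<lambda>a' b' c'. phi_inv_sum (\<lambda>p' q' r'. cop_sum (a' * p') (\<lambda>p1 p2.
            E (a * p1) (p * b * p2) (q * c1 * (b' * q')) (r * c2 * (c' * r'))))) =
          cop_sum 1 (\<lambda>p1 p2. E (a * p1) (p * b * p2) (q * c1 * 1) (r * c2 * 1))" for p q r
          by (rule phi_phi_inv[of "\<lambda>x y z. cop_sum x (\<lambda>p1 p2. E (a * p1) (p * b * p2) (q * c1 * y) (r * c2 * z))"])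
            (intro le)
        then show ?thesis by simp
      qed
      also have "\<dots> = phi_inv_sum (\<lambda>p q r. E a (p * b) (q * c1) (r * c2))"
        by (subst cop_sum_one) (intro le | simp)+
      finally show ?thesis .
    qed
    then show ?thesis by simp
  qed
  also have "\<dots> = phi_sum (\<lambda>a b c. phi_sum (\<lambda>a' b' c'. cop_sum b' (\<lambda>b1 b2. phi_sum (\<lambda>a'' b'' c''.
           F (a' * a'') (a * b1 * b'') (b * b2 * c'') (c * c')))))"
    by (rule pentagon_sum) (rule F)
  also have "\<dots> = phi_inv_sum (\<lambda>p q r. phi_sum (\<lambda>a b c. phi_sum (\<lambda>a' b' c'. cop_sum b' (\<lambda>b1 b2.
      phi_sum (\<lambda>a'' b'' c''. phi_inv_sum (\<lambda>p' q' r'. cop_sum p' (\<lambda>p1 p2. E (a' * a'' * p1) (p * a * (b1 * b'' * p2))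
         (q * b * (b2 * c'' * q')) (r * c * (c' * r')))))))))"
    unfolding F_def by (simp only: sweedler_sum_swap(1-3) mult.assoc)
  also have "\<dots> = phi_sum (\<lambda>a' b' c'. cop_sum b' (\<lambda>b1 b2.
      phi_sum (\<lambda>a'' b'' c''. phi_inv_sum (\<lambda>p' q' r'. cop_sum p' (\<lambda>p1 p2. E (a' * a'' * p1) (1 * (b1 * b'' * p2))
         (1 * (b2 * c'' * q')) (1 * (c' * r')))))))"
    by (rule phi_inv_phi[of "\<lambda>x y z. phi_sum (\<lambda>a' b' c'. cop_sum b' (\<lambda>b1 b2.
      phi_sum (\<lambda>a'' b'' c''. phi_inv_sum (\<lambda>p' q' r'. cop_sum p' (\<lambda>p1 p2. E (a' * a'' * p1) (x * (b1 * b'' * p2))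
         (y * (b2 * c'' * q')) (z * (c' * r')))))))"]) (intro le)
  \<comment> \<open>From here on the right-hand side collapses. The coproduct of \<open>p'\<close>
    closes around \<beta> and leaves \<epsilon>, which removes the inverse of \<Phi>. The coproduct
    of \<open>b'\<close> closes around \<alpha>, and the resulting \<epsilon> removes one \<Phi>.
    The last \<Phi> is absorbed by the axiom that joins it to \<beta> and \<alpha>.\<close>
  also have "\<dots> = phi_sum (\<lambda>a' b' c'. cop_sum b' (\<lambda>b1 b2.
      phi_sum (\<lambda>a'' b'' c''. phi_inv_sum (\<lambda>p' q' r'. cou H p' *
        G (a' * a'' * bet H * anti H b'' * anti H b1 * alp H * b2 * c'' * q') (c' * r')))))"
  proof -
    have "cop_sum p' (\<lambda>p1 p2. E (a' * a'' * p1) (1 * (b1 * b'' * p2)) (1 * (b2 * c'' * q')) (1 * (c' * r')))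
      = cou H p' * G (a' * a'' * bet H * anti H b'' * anti H b1 * alp H * b2 * c'' * q') (c' * r')"
      for a' c' b1 b2 a'' b'' c'' p' q' r'
      using cop_bet[of p' "a' * a''" "anti H b'' * anti H b1 * alp H * b2 * c'' * q'" "c' * r'"]
      by (simp add: E_def anti_mult mult.assoc)
    then show ?thesis by simp
  qed
  also have "\<dots> = phi_sum (\<lambda>a' b' c'. cop_sum b' (\<lambda>b1 b2. phi_sum (\<lambda>a'' b'' c''.
        G (a' * a'' * bet H * anti H b'' * anti H b1 * alp H * b2 * c'' * 1) (c' * 1))))"
    by (subst phi_inv_sum_cou_left) (intro li | simp)+
  also have "\<dots> = phi_sum (\<lambda>a' b' c'. phi_sum (\<lambda>a'' b'' c''. cop_sum b' (\<lambda>b1 b2.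
        G (a' * a'' * bet H * anti H b'' * anti H b1 * alp H * b2 * c'') c')))"
    by (simp add: sweedler_sum_swap(1))
  also have "\<dots> = phi_sum (\<lambda>a' b' c'. cou H b' * phi_sum (\<lambda>a'' b'' c''.
        G (a' * (a'' * bet H * anti H b'' * alp H * c'')) c'))"
  proof -
    have "cop_sum b' (\<lambda>b1 b2. G (a' * a'' * bet H * anti H b'' * anti H b1 * alp H * b2 * c'') c') =
      cou H b' * G (a' * (a'' * bet H * anti H b'' * alp H * c'')) c'" for a' b' c' a'' b'' c''
      using cop_alp[of b' "a' * a'' * bet H * anti H b''" c'' c'] by (simp add: mult.assoc)
    then show ?thesis by (simp add: sweedler_sum_const_mult)
  qed
  also have "\<dots> = phi_sum (\<lambda>a'' b'' c''. G (1 * (a'' * bet H * anti H b'' * alp H * c'')) 1)"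
    by (rule phi_sum_cou_mid) (intro li)
  also have "\<dots> = G (1 * 1) 1"
    by (rule bet_alp_sum) (intro li)
  finally show ?thesis
    by (simp add: E_def)
qed

section \<open>The Drinfeld twist\<close>

text \<open>
  The pairing of a bilinear form with the Drinfeld twist \<open>f \<in> H \<otimes> H\<close>, which describes the canonical
  isomorphism from \<open>N\<^sup>\<or> \<otimes> M\<^sup>\<or>\<close> to the dual of \<open>M \<otimes> N\<close>.
\<close>

definition twist_sum :: "('h \<Rightarrow> 'h \<Rightarrow> 'k) \<Rightarrow> 'k" where
  "twist_sum F = phi_inv_sum (\<lambda>p q r. cop_sum p (\<lambda>p1 p2. cop_sum (q * bet H * anti H r) (\<lambda>s1 s2.
     phi_sum (\<lambda>a b c. cop_sum c (\<lambda>c1 c2. phi_inv_sum (\<lambda>p' q' r'.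
       F (anti H p2 * anti H (p' * b) * alp H * q' * c1 * s1)
         (anti H p1 * anti H a * alp H * r' * c2 * s2)))))))"

text \<open>This reordering and the next one bring innermost the coproduct that is about to close
  around \<beta>.\<close>

lemma cop_sum_inside:
  "cop_sum s (\<lambda>s1 s2. phi_sum (\<lambda>a b c. cop_sum c (\<lambda>c1 c2. phi_inv_sum (\<lambda>p q r. X s1 s2 a b c c1 c2 p q r)))) =
   phi_inv_sum (\<lambda>p q r. phi_sum (\<lambda>a b c. cop_sum c (\<lambda>c1 c2. cop_sum s (\<lambda>s1 s2. X s1 s2 a b c c1 c2 p q r))))"
  by (simp only: sweedler_sum_swap(1-3) sweedler_sum_swap(4)[where h = s])

lemma cop_sum_cop_sum_inside:
  "cop_sum t (\<lambda>t1 t2. cop_sum s (\<lambda>s1 s2. phi_sum (\<lambda>a b c. cop_sum c (\<lambda>c1 c2. phi_inv_sum (\<lambda>p q r.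
     Y t1 t2 s1 s2 a b c c1 c2 p q r))))) =
   cop_sum s (\<lambda>s1 s2. phi_sum (\<lambda>a b c. cop_sum c (\<lambda>c1 c2. phi_inv_sum (\<lambda>p q r. cop_sum t (\<lambda>t1 t2.
     Y t1 t2 s1 s2 a b c c1 c2 p q r)))))"
  by (simp only: sweedler_sum_swap(1,2) sweedler_sum_swap(4)[where h = t])

text \<open>The coproducts close one after the other: that of q \<beta> S(r) around \<beta>, then
  that of c around \<beta>, after which \<Phi> disappears; the inner inverse of \<Phi> then gives 1,
  and the coproduct of p closes around \<alpha>. Up to the factor \<epsilon>(\<beta>), the twist
  thus carries \<beta> to S(\<alpha>).\<close>

lemma twist_bet:
  assumes f: "lin_form f"
  shows "twist_sum (\<lambda>x y. f (x * bet H * anti H y)) = cou H (bet H) * f (anti H (alp H))"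
proof -
  note li = lin_intros lin_form_comp[OF f]
  have cop_bet: "cop_sum h (\<lambda>x y. f (u * x * bet H * anti H y * v)) = cou H h * f (u * bet H * v)"
    for h u v
    using anti_bet_sum[of "\<lambda>x. f (u * x * v)" h] by (force simp: mult.assoc intro: li)
  have phi_inv_sum_one: "phi_inv_sum (\<lambda>x y z. f (u * (anti H x * alp H * y * bet H * anti H z) * v)) = f (u * 1 * v)"
    for u v
    by (rule alp_bet_sum) (intro li)
  have cop_alp: "cop_sum h (\<lambda>x y. f (anti H (anti H x * alp H * y))) = cou H h * f (anti H (alp H))"
    for h
    by (rule anti_alp_sum) (intro li)
  have "twist_sum (\<lambda>x y. f (x * bet H * anti H y)) =
    phi_inv_sum (\<lambda>p q r. cop_sum p (\<lambda>p1 p2. phi_inv_sum (\<lambda>p' q' r'. phi_sum (\<lambda>a b c. cop_sum c (\<lambda>c1 c2.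
      cop_sum (q * bet H * anti H r) (\<lambda>s1 s2.
        f ((anti H p2 * anti H (p' * b) * alp H * q' * c1) * s1 * bet H * anti H s2 *
           (anti H c2 * (anti H r' * anti H (alp H) * anti H (anti H a) * anti H (anti H p1))))))))))"
    unfolding twist_sum_def
    by (simp only: cop_sum_inside mult.assoc anti_mult)
  also have "\<dots> = phi_inv_sum (\<lambda>p q r. cop_sum p (\<lambda>p1 p2. phi_inv_sum (\<lambda>p' q' r'. phi_sum (\<lambda>a b c. cop_sum c (\<lambda>c1 c2.
      cou H (q * bet H * anti H r) *
        f ((anti H p2 * anti H (p' * b) * alp H * q') * c1 * bet H * anti H c2 *
           (anti H r' * anti H (alp H) * anti H (anti H a) * anti H (anti H p1))))))))"
    by (simp only: cop_bet) (simp add: mult.assoc)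
  also have "\<dots> = phi_inv_sum (\<lambda>p q r. cop_sum p (\<lambda>p1 p2. phi_inv_sum (\<lambda>p' q' r'. cou H (q * bet H * anti H r) *
      phi_sum (\<lambda>a b c. cou H c *
        f ((anti H p2 * anti H (p' * b) * alp H * q') * bet H *
           (anti H r' * anti H (alp H) * anti H (anti H a) * anti H (anti H p1)))))))"
    by (simp only: cop_bet sweedler_sum_const_mult)
  also have "\<dots> = phi_inv_sum (\<lambda>p q r. cop_sum p (\<lambda>p1 p2. phi_inv_sum (\<lambda>p' q' r'. cou H (q * bet H * anti H r) *
        f ((anti H p2 * anti H (p' * 1) * alp H * q') * bet H *
           (anti H r' * anti H (alp H) * anti H (anti H 1) * anti H (anti H p1))))))"
    by (subst phi_sum_cou_right) (intro li | simp)+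
  also have "\<dots> = phi_inv_sum (\<lambda>p q r. cou H (q * bet H * anti H r) * cop_sum p (\<lambda>p1 p2. phi_inv_sum (\<lambda>p' q' r'.
        f (anti H p2 * (anti H p' * alp H * q' * bet H * anti H r') *
            (anti H (alp H) * anti H (anti H p1))))))"
    by (simp add: sweedler_sum_const_mult mult.assoc anti_one)
  also have "\<dots> = phi_inv_sum (\<lambda>p q r. cou H (q * bet H * anti H r) * cop_sum p (\<lambda>p1 p2.
        f (anti H (anti H p1 * alp H * p2))))"
    by (simp only: phi_inv_sum_one) (simp add: anti_mult mult.assoc)
  also have "\<dots> = phi_inv_sum (\<lambda>p q r. cou H q * (cou H p * (cou H (bet H * anti H r) * f (anti H (alp H)))))"
    by (simp add: cop_alp) (simp add: cou_mult mult_ac)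
  also have "\<dots> = cou H 1 * (cou H (bet H * anti H 1) * f (anti H (alp H)))"
    by (rule phi_inv_sum_cou_mid) (intro li)
  finally show ?thesis by (simp add: cou_one anti_one)
qed

text \<open>Here the coproduct of p closes around \<beta> first and removes the outer inverse of
  \<Phi>, which leaves the coproduct of \<beta> itself. Between its two parts stands the expression
  of \<open>zigzag\<close>; once that is gone, the coproduct closes around \<alpha>.\<close>

lemma twist_anti_bet:
  assumes f: "lin_form f"
  shows "twist_sum (\<lambda>x y. f (anti H x * anti H (bet H) * y)) = cou H (bet H) * f (alp H)"
proof -
  note li = lin_intros lin_form_comp[OF f]
  have cop_bet: "cop_sum h (\<lambda>x y. f (u * anti H (anti H y) * anti H (bet H) * anti H x * v)) =
      cou H h * f (u * anti H (bet H) * v)"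
    for h u v
    using anti_bet_sum[of "\<lambda>x. f (u * anti H x * v)" h]
    by (force simp: mult.assoc anti_mult intro: li)
  \<comment> \<open>What is left of the twist once the coproduct of p is absorbed, as a form in the
    coproduct of q \<beta> S(r).\<close>
  define Q where "Q s1 s2 = phi_sum (\<lambda>a b c. cop_sum c (\<lambda>c1 c2. phi_inv_sum (\<lambda>p' q' r'.
      f (anti H s1 * anti H (a * bet H * anti H (p' * b) * alp H * (q' * c1)) * alp H *
         (r' * c2) * s2))))" for s1 s2
  have Q: "mlin2 (scl H) Q"
    unfolding Q_def by (intro li)
  have "twist_sum (\<lambda>x y. f (anti H x * anti H (bet H) * y)) =
    phi_inv_sum (\<lambda>p q r. cop_sum (q * bet H * anti H r) (\<lambda>s1 s2. phi_sum (\<lambda>a b c. cop_sum c (\<lambda>c1 c2. phi_inv_sum (\<lambda>p' q' r'.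
      cop_sum p (\<lambda>p1 p2.
        f ((anti H s1 * anti H c1 * anti H q' * anti H (alp H) * anti H (anti H (p' * b))) *
          anti H (anti H p2) * anti H (bet H) * anti H p1 *
           (anti H a * alp H * r' * c2 * s2))))))))"
    unfolding twist_sum_def
    by (simp only: cop_sum_cop_sum_inside mult.assoc anti_mult)
  also have "\<dots> = phi_inv_sum (\<lambda>p q r. cou H p * cop_sum (q * bet H * anti H r) Q)"
    by (simp only: cop_bet sweedler_sum_const_mult Q_def) (simp add: sweedler_sum_const_mult anti_mult mult.assoc Q_def[abs_def])
  also have "\<dots> = cop_sum (1 * bet H * anti H 1) Q"
    by (rule phi_inv_sum_cou_left) (intro lin_intros Q)
  also have "\<dots> = cop_sum (bet H) (\<lambda>s1 s2. f (anti H s1 * alp H * s2))"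
    unfolding Q_def
    by (subst zigzag[of "\<lambda>x y. f (anti H _ * anti H x * alp H * y * _)"]) (intro li | simp add: anti_one)+
  also have "\<dots> = cou H (bet H) * f (alp H)"
    by (rule anti_alp_sum) (rule f)
  finally show ?thesis .
qed

text \<open>The value \<epsilon>(\<beta>) is not normalised to 1, so it has to be cancelled. It
  divides the result of applying \<epsilon> to the axiom \<Phi>^1 \<beta> S(\<Phi>^2) \<alpha>
  \<Phi>^3 = 1.\<close>

lemma cou_bet_nonzero: "cou H (bet H) \<noteq> 0"
proof
  assume "cou H (bet H) = 0"
  then have "phi_sum (\<lambda>a b c. cou H (a * bet H * anti H b * alp H * c)) = 0"
    by (simp add: cou_mult phi_sum_def split_def)
  then show False
    using bet_alp_sum[OF cou_linear] by (simp add: cou_one)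
qed

lemma linear_form_separates:
  assumes "x \<noteq> 0" obtains f where "lin_form f" "f x \<noteq> 0"
proof -
  have "scl.independent {x}" using assms by simp
  then obtain B where B: "{x} \<subseteq> B" "scl.independent B" "scl.span B = UNIV"
    by (metis scl.extend_basis_superset scl.independent_extend_basis scl.span_extend_basis)
  interpret vector_space_pair "scl H" "(*) :: 'k \<Rightarrow> 'k \<Rightarrow> 'k"
    by (intro vector_space_pair.intro scl_vector_space vector_space_mult)
  have "lin_form (\<lambda>v. scl.representation B v x)"
    by (rule scl.linear_representation) (use B in auto)
  moreover have "scl.representation B x x \<noteq> 0"
    using B by (simp add: scl.representation_basis)
  ultimately show ?thesis by (rule that)
qed

text \<open>The way back from equations of scalars to equations in H.\<close>

lemma lin_form_eqI: "(\<And>f. lin_form f \<Longrightarrow> f x = f y) \<Longrightarrow> x = y"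
  using linear_form_separates[of "x - y"] by (metis lin_form_iff add_diff_cancel_right' diff_add_cancel right_minus_eq)

text \<open>
  The first hypothesis says that \<open>f \<Delta>(g) = (S \<otimes> S)(f\<^sub>2\<^sub>1) (g \<otimes> g)\<close> for the Drinfeld twist \<open>f\<close>.
\<close>

lemma pivotal_anti_mult:
  assumes twist: "\<And>G. mlin2 (scl H) G \<Longrightarrow>
      twist_sum (\<lambda>x y. cop_sum g (\<lambda>g1 g2. G (x * g1) (y * g2))) = twist_sum (\<lambda>x y. G (anti H y * g) (anti H x * g))"
    and anti_anti_g: "\<And>h. anti H (anti H h) * g = g * h"
  shows "anti H g * g = scl H (cou H g) 1"
proof -
  define u where "u = anti H g * g"
  have comm: "u * h = h * u" for h
  proof -
    \<comment> \<open>With h = S(k) the element S(h) g is S(S(k)) g = g k, and this is what lets h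
      pass the factor S(g) g.\<close>
    obtain k where k: "h = anti H k" using anti_bij by (metis bij_pointE)
    have "u * h = anti H g * (anti H (anti H h) * g)" by (simp add: u_def mult.assoc anti_anti_g)
    also have "\<dots> = anti H (anti H h * g) * g" by (simp add: anti_mult mult.assoc)
    also have "\<dots> = h * u" by (simp add: k anti_anti_g) (simp add: u_def anti_mult mult.assoc)
    finally show ?thesis .
  qed
  \<comment> \<open>Evaluate the hypothesis at the form that sends x, y to S(x) S(\<beta>) y. On the
    left, S(g1) (\<epsilon>(\<beta>) \<alpha>) g2 sums to \<epsilon>(\<beta>) \<epsilon>(g)
    \<alpha>. On the right, S(g) S(x \<beta> S(y)) g sums to \<epsilon>(\<beta>) S(g) S(S(\<alpha>))
    g, which is \<epsilon>(\<beta>) u \<alpha>.\<close>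
  have ual: "f (u * alp H) = cou H g * f (alp H)" if f: "lin_form f" for f
  proof -
    note li = lin_intros lin_form_comp[OF f]
    have "cop_sum g (\<lambda>g1 g2. twist_sum (\<lambda>x y. f (anti H g1 * (anti H x * anti H (bet H) * y) * g2))) =
      twist_sum (\<lambda>x y. cop_sum g (\<lambda>g1 g2. f (anti H (x * g1) * anti H (bet H) * (y * g2))))"
      unfolding twist_sum_def by (simp only: sweedler_sum_swap(1,2) sweedler_sum_swap(4)[where h = g] anti_mult mult.assoc)
    also have "\<dots> = twist_sum (\<lambda>x y. f (anti H (anti H y * g) * anti H (bet H) * (anti H x * g)))"
      by (rule twist) (intro li)
    also have "\<dots> = twist_sum (\<lambda>x y. f (anti H g * anti H (x * bet H * anti H y) * g))"
      by (simp add: anti_mult mult.assoc)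
    also have "\<dots> = cou H (bet H) * f (anti H g * anti H (anti H (alp H)) * g)"
      by (rule twist_bet) (intro li)
    also have "anti H g * anti H (anti H (alp H)) * g = u * alp H"
      by (simp add: u_def mult.assoc anti_anti_g)
    also have "cop_sum g (\<lambda>g1 g2. twist_sum (\<lambda>x y. f (anti H g1 * (anti H x * anti H (bet H) * y) * g2))) =
        cop_sum g (\<lambda>g1 g2. cou H (bet H) * f (anti H g1 * alp H * g2))"
    proof -
      have "twist_sum (\<lambda>x y. f (anti H g1 * (anti H x * anti H (bet H) * y) * g2)) =
        cou H (bet H) * f (anti H g1 * alp H * g2)" for g1 g2
        by (rule twist_anti_bet) (intro li)
      then show ?thesis by simp
    qed
    also have "\<dots> = cou H (bet H) * (cou H g * f (alp H))"
      by (simp add: sweedler_sum_const_mult anti_alp_sum[OF f])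
    finally show ?thesis using cou_bet_nonzero by simp
  qed
  show ?thesis
    unfolding u_def[symmetric]
  proof (rule lin_form_eqI)
    fix f assume f: "lin_form f"
    note li = lin_intros lin_form_comp[OF f]
    \<comment> \<open>There is no inverse of \<alpha> to multiply by. Being central, u can instead
      be moved next to \<alpha> inside \<Phi>^1 \<beta> S(\<Phi>^2) \<alpha> \<Phi>^3 = 1, where it
      becomes \<epsilon>(g).\<close>
    have "f (u * 1) = phi_sum (\<lambda>a b c. f (u * (a * bet H * anti H b * alp H * c)))"
      by (rule bet_alp_sum[symmetric]) (intro li)
    also have "\<dots> = phi_sum (\<lambda>a b c. f (a * bet H * anti H b * (u * alp H) * c))"
      by (metis (no_types, opaque_lifting) comm mult.assoc)
    also have "\<dots> = phi_sum (\<lambda>a b c. cou H g * f (a * bet H * anti H b * alp H * c))"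
      by (subst ual[of "\<lambda>x. f (_ * x * _)"]) (intro li | simp)+
    also have "\<dots> = cou H g * f 1"
      by (simp add: sweedler_sum_const_mult bet_alp_sum[OF f])
    finally show "f u = f (scl H (cou H g) 1)"
      using f by (simp add: lin_form_iff)
  qed
qed

end

section \<open>Modules\<close>

lemma vector_space_fun_smul: "vector_space s \<Longrightarrow> vector_space (fun_smul s)"
  by (simp add: vector_space_def fun_smul_def fun_eq_iff)

lemma fin_dimI:
  assumes "vector_space s" "module.subspace s U" "finite A" "U \<subseteq> module.span s A"
  shows "fin_dim s U"
proof -
  interpret vector_space s by (rule assms(1))
  obtain B where B: "B \<subseteq> U" "independent B" "U \<subseteq> span B"
    using maximal_independent_subset[of U] by blast
  have "finite B"
    using independent_span_bound[OF assms(3) B(2)] B(1) assms(4) by blast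
  moreover have "span B = U"
    using B assms(2) span_minimal by blast
  ultimately show ?thesis
    using B(2) by (auto simp: fin_dim_def basis_of_def)
qed

lemma linear_on_mod_zero:
  assumes "left_module H V" "vector_space s" "linear_on_mod V s f"
  shows "f 0 = 0"
proof -
  interpret V: left_module H V by (rule assms)
  interpret vs: vector_space "smul V" by (rule V.smul_vector_space)
  interpret s: vector_space s by (rule assms)
  have "f (smul V 0 0) = s 0 (f 0)"
    using assms(3) vs.subspace_0[OF V.carr_subspace] unfolding linear_on_mod_def by blast
  then show ?thesis by simp
qed

lemma linear_on_mod_sum_list:
  assumes "left_module H V" "vector_space s" "linear_on_mod V s f" "\<And>x. F x \<in> carr V"
  shows "(\<Sum>x\<leftarrow>xs. F x) \<in> carr V" "f (\<Sum>x\<leftarrow>xs. F x) = (\<Sum>x\<leftarrow>xs. f (F x))"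
proof -
  interpret V: left_module H V by (rule assms)
  interpret vs: vector_space "smul V" by (rule V.smul_vector_space)
  show "(\<Sum>x\<leftarrow>xs. F x) \<in> carr V" for xs
    using assms(4) V.carr_subspace by (induction xs) (auto simp: vs.subspace_0 vs.subspace_add)
  then show "f (\<Sum>x\<leftarrow>xs. F x) = (\<Sum>x\<leftarrow>xs. f (F x))"
    using assms(3,4) linear_on_mod_zero[OF assms(1-3)]
    by (induction xs) (auto simp: linear_on_mod_def)
qed

lemma carr_dual: "carr (dual H V) = {f. linear_on_mod V (*) f \<and> (\<forall>v. v \<notin> carr V \<longrightarrow> f v = 0)}"
  by (simp add: dual_def codual_def)

lemma dual_separates:
  assumes "left_module H V" "v \<in> carr V" "v \<noteq> 0"
  obtains l where "l \<in> carr (dual H V)" "l v \<noteq> 0"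
proof -
  interpret V: left_module H V by (rule assms)
  interpret vs: vector_space "smul V" by (rule V.smul_vector_space)
  have "vs.independent {v}" using assms by simp
  then obtain B where B: "{v} \<subseteq> B" "vs.independent B" "vs.span B = UNIV"
    by (metis vs.extend_basis_superset vs.independent_extend_basis vs.span_extend_basis)
  define l where "l w = (if w \<in> carr V then vs.representation B w v else 0)" for w
  have "l \<in> carr (dual H V)"
    using B V.carr_subspace
    by (auto simp: carr_dual linear_on_mod_def l_def vs.representation_add vs.representation_scale
        vs.subspace_add vs.subspace_scale)
  moreover have "l v \<noteq> 0"
    using B assms by (simp add: l_def vs.representation_basis)
  ultimately show ?thesis by (rule that)
qed

lemma dual_eqI:
  assumes "left_module H V" "v \<in> carr V" "w \<in> carr V" "\<And>l. l \<in> carr (dual H V) \<Longrightarrow> l v = l w"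
  shows "v = w"
proof (rule ccontr)
  interpret V: left_module H V by (rule assms)
  interpret vs: vector_space "smul V" by (rule V.smul_vector_space)
  assume "v \<noteq> w"
  then have ne: "v - w \<noteq> 0" and d: "v - w \<in> carr V"
    using assms vs.subspace_diff[OF V.carr_subspace] by auto
  obtain l where l: "l \<in> carr (dual H V)" "l (v - w) \<noteq> 0"
    using dual_separates[OF assms(1) d ne] by blast
  have "l (v - w + w) = l (v - w) + l w"
    using l(1) d assms(3) unfolding carr_dual linear_on_mod_def by blast
  with l(2) assms(4)[OF l(1)] show False by simp
qed

lemma (in left_module) carr_zero: "0 \<in> carr V"
  and carr_add: "v \<in> carr V \<Longrightarrow> w \<in> carr V \<Longrightarrow> v + w \<in> carr V"
  and carr_smul: "v \<in> carr V \<Longrightarrow> smul V c v \<in> carr V"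
proof -
  interpret vs: vector_space "smul V" by (rule smul_vector_space)
  show "0 \<in> carr V" "v \<in> carr V \<Longrightarrow> w \<in> carr V \<Longrightarrow> v + w \<in> carr V"
    "v \<in> carr V \<Longrightarrow> smul V c v \<in> carr V"
    using carr_subspace by (auto simp: vs.subspace_def)
qed

text \<open>Stated for any unital linear map that reverses products, so that it covers
  \<open>dual\<close>, where it is S, and \<open>sharp\<close>, where it is S after \<tau>.\<close>

lemma left_module_codual:
  assumes V: "left_module H V"
    and \<sigma>: "\<And>a b. \<sigma> (a + b) = \<sigma> a + \<sigma> b" "\<And>c a. \<sigma> (scl H c a) = scl H c (\<sigma> a)" "\<sigma> 1 = 1"
      "\<And>a b. \<sigma> (a * b) = \<sigma> b * \<sigma> a"
  shows "left_module H (codual \<sigma> V)"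
proof -
  interpret V: left_module H V by (rule V)
  let ?s = "fun_smul ((*) :: 'a \<Rightarrow> 'a \<Rightarrow> 'a) :: 'a \<Rightarrow> ('c \<Rightarrow> 'a) \<Rightarrow> ('c \<Rightarrow> 'a)"
  have vf: "vector_space ?s"
    by (intro vector_space_fun_smul vector_space_mult)
  interpret fs: vector_space ?s by (rule vf)
  show ?thesis
  proof (rule left_module.intro)
    show "vector_space (smul (codual \<sigma> V))"
      using vf by (simp add: codual_def)
    show "module.subspace (smul (codual \<sigma> V)) (carr (codual \<sigma> V))"
      by (auto simp: codual_def fs.subspace_def linear_on_mod_def fun_smul_def algebra_simps)
    show "act (codual \<sigma> V) a l \<in> carr (codual \<sigma> V)" if "l \<in> carr (codual \<sigma> V)" for a l
      using that V.carr_add V.carr_smul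
      by (simp add: codual_def linear_on_mod_def V.act_closed V.act_add V.act_smul)
  qed (simp_all add: codual_def linear_on_mod_def fun_smul_def fun_eq_iff \<sigma>
         V.act_closed V.act_plus V.act_scl V.act_one V.act_mult)
qed

lemma left_module_dual:
  assumes "quasi_hopf_algebra H" "left_module H V"
  shows "left_module H (dual H V)"
proof -
  interpret quasi_hopf_algebra H by (rule assms)
  show ?thesis
    unfolding dual_def using anti_linear
    by (intro left_module_codual[OF assms(2)]) (simp_all add: lin_endo_iff anti_mult anti_one)
qed

lemma transport_module:
  fixes V :: "('k::field, 'h::ring_1, 'v::ab_group_add) lmod"
    and s :: "'k \<Rightarrow> 'w::ab_group_add \<Rightarrow> 'w"
  assumes V: "fd_module H V" and s: "vector_space s"
    and r: "linear_on_mod V s r" and inj: "inj_on r (carr V)"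
  obtains M \<theta> where "fd_module H M" "\<theta> \<in> iso_mod V M" "smul M = s" "carr M = r ` carr V"
proof -
  interpret V: left_module H V using V by (simp add: fd_module_def)
  interpret vs: vector_space "smul V" by (rule V.smul_vector_space)
  interpret s: vector_space s by (rule s)
  note carr = V.carr_subspace[unfolded vs.subspace_def]
  have r0: "r 0 = 0"
    using linear_on_mod_zero[OF V.left_module_axioms s r] .
  have radd: "r (v + w) = r v + r w" if "v \<in> carr V" "w \<in> carr V" for v w
    using r that by (auto simp: linear_on_mod_def)
  have rscl: "r (smul V c v) = s c (r v)" if "v \<in> carr V" for c v
    using r that by (auto simp: linear_on_mod_def)
  define M where "M = \<lparr>carr = r ` carr V, smul = s,
    act = (\<lambda>a f. r (act V a (inv_into (carr V) r f)))\<rparr>"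
  have actM: "act M a (r v) = r (act V a v)" if "v \<in> carr V" for a v
    using that inj by (simp add: M_def)
  have sub: "s.subspace (r ` carr V)"
  proof (rule s.subspaceI)
    show "0 \<in> r ` carr V"
      using carr by (metis imageI r0)
    show "x + y \<in> r ` carr V" if "x \<in> r ` carr V" "y \<in> r ` carr V" for x y
      using that carr by (auto simp flip: radd)
    show "s c x \<in> r ` carr V" if "x \<in> r ` carr V" for c x
      using that carr by (auto simp flip: rscl)
  qed
  have carrM: "carr M = r ` carr V" and smulM: "smul M = s" by (simp_all add: M_def)
  have lM: "left_module H M"
  proof (rule left_module.intro)
    show "vector_space (smul M)" "module.subspace (smul M) (carr M)"
      using s sub by (simp_all add: M_def)
    fix f f' a b c
    assume "f \<in> carr M"
    then obtain v where v: "v \<in> carr V" "f = r v" by (auto simp: carrM)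
    note simps = smulM v actM V.act_closed V.act_one V.act_mult V.act_plus V.act_scl V.act_add V.act_smul
    show "act M a f \<in> carr M" "act M 1 f = f" "act M (a * b) f = act M a (act M b f)"
      using v(1) by (simp_all add: carrM simps)
    show "act M (a + b) f = act M a f + act M b f" "act M (scl H c a) f = smul M c (act M a f)"
      using v(1) by (simp_all add: simps flip: radd rscl)
    show "act M a (smul M c f) = smul M c (act M a f)"
      using v(1) carr by (simp add: simps flip: rscl)
    assume "f' \<in> carr M"
    then obtain w where w: "w \<in> carr V" "f' = r w" by (auto simp: carrM)
    show "act M a (f + f') = act M a f + act M a f'"
      using v(1) w carr by (simp add: simps flip: radd)
  qed
  obtain B where B: "finite B" "vs.span B = carr V"
    using V by (auto simp: fd_module_def fin_dim_def basis_of_def)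
  have "r v \<in> s.span (r ` B)" if "v \<in> vs.span B" for v
  proof -
    have "v \<in> carr V \<and> r v \<in> s.span (r ` B)"
      using that
    proof (induction rule: vs.span_induct)
      case base
      show ?case using carr
        by (auto simp: vs.subspace_def r0 radd rscl s.span_zero s.span_add s.span_scale)
    next
      case (step x)
      then have "x \<in> carr V" "r x \<in> r ` B"
        using vs.span_base[of x B] B(2) by auto
      then show ?case using s.span_base by blast
    qed
    then show ?thesis by simp
  qed
  then have "r ` carr V \<subseteq> s.span (r ` B)" using B by auto
  then have "fin_dim s (r ` carr V)"
    using fin_dimI[OF s sub _ ] B(1) by blast
  then have fd: "fd_module H M"
    using lM by (simp add: fd_module_def M_def)
  \<comment> \<open>Members of \<open>Hom_mod\<close> vanish off the carrier, so r has to be cut off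
    there.\<close>
  let ?r = "\<lambda>v. if v \<in> carr V then r v else 0"
  have "bij_betw ?r (carr V) (carr M) \<longleftrightarrow> bij_betw r (carr V) (carr M)"
    by (rule bij_betw_cong) simp
  moreover have "?r \<in> Hom_mod V M"
    using carr by (simp add: Hom_mod_def linear_on_mod_def smulM carrM radd rscl V.act_closed actM)
  ultimately have "?r \<in> iso_mod V M"
    using inj by (simp add: iso_mod_def carrM bij_betw_def)
  with fd show ?thesis using that smulM carrM by blast
qed

text \<open>Coordinates in a finite basis, padded with zeros, embed V into
  \<open>k\<^sup>\<nat>\<close>. A pivotal structure has components only at such modules, so appeals
  to it start by choosing a copy of this kind.\<close>

lemma fd_module_representative:
  fixes V :: "('k::field, 'h::ring_1, 'v::ab_group_add) lmod"
  assumes V: "fd_module H V"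
  obtains M :: "('k, 'h) mod_obj" and \<theta> where "fd_module H M" "\<theta> \<in> iso_mod V M"
proof -
  interpret V: left_module H V using V by (simp add: fd_module_def)
  interpret vs: vector_space "smul V" by (rule V.smul_vector_space)
  obtain B where B: "finite B" "vs.independent B" "vs.span B = carr V"
    using V by (auto simp: fd_module_def fin_dim_def basis_of_def)
  obtain e where e: "bij_betw e {0..<card B} B"
    using ex_bij_betw_nat_finite[OF B(1)] by blast
  define r where "r v i = (if i < card B then vs.representation B v (e i) else 0)" for v i
  have "linear_on_mod V (fun_smul (*)) r"
    using B by (auto simp: linear_on_mod_def r_def fun_eq_iff fun_smul_def
        vs.representation_add vs.representation_scale)
  moreover have "inj_on r (carr V)"
  proof (rule inj_onI)
    fix v w assume vw: "v \<in> carr V" "w \<in> carr V" "r v = r w"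
    have "vs.representation B v b = vs.representation B w b" if "b \<in> B" for b
    proof -
      have "b \<in> e ` {0..<card B}"
        unfolding bij_betw_imp_surj_on[OF e] by (rule that)
      then obtain i where "i < card B" "b = e i" by force
      then show ?thesis using fun_cong[OF vw(3), of i] by (simp add: r_def)
    qed
    then have "(\<Sum>b\<in>B. smul V (vs.representation B v b) b) = (\<Sum>b\<in>B. smul V (vs.representation B w b) b)"
      by simp
    then show "v = w"
      using vs.sum_representation_eq[OF B(2) _ B(1) order.refl] vw B(3) by simp
  qed
  ultimately show ?thesis
    by (rule transport_module[OF V vector_space_fun_smul[OF vector_space_mult]]) (rule that)
qed

lemma fun_smul_apply: "fun_smul s c f x = s c (f x)"
  by (simp add: fun_smul_def)

lemma sum_list_fun_apply: "(\<Sum>x\<leftarrow>xs. F x) y = (\<Sum>x\<leftarrow>xs. F x y)"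
  for F :: "'a \<Rightarrow> 'b \<Rightarrow> 'c::ab_group_add"
  by (induction xs) auto

context quasi_hopf_algebra
begin

lemma left_module_regular: "left_module H (regular_module H)"
proof (rule left_module.intro)
  show "vector_space (smul (regular_module H))"
    by (simp add: regular_module_def scl_vector_space)
  fix a b v w :: 'h and c :: 'k
  show "act (regular_module H) a (smul (regular_module H) c v) =
      smul (regular_module H) c (act (regular_module H) a v)"
    by (simp add: regular_module_def scl_mult_right)
  show "act (regular_module H) (scl H c a) v = smul (regular_module H) c (act (regular_module H) a v)"
    by (simp add: regular_module_def scl_mult_left)
qed (simp_all add: regular_module_def distrib_left distrib_right mult.assoc)

lemma fd_unit_module: "fd_module H (unit_module H)"
proof -
  have sub: "module.subspace ((*) :: 'k \<Rightarrow> 'k \<Rightarrow> 'k) UNIV"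
    and "fin_dim ((*) :: 'k \<Rightarrow> 'k \<Rightarrow> 'k) UNIV"
  proof -
    interpret k: vector_space "(*) :: 'k \<Rightarrow> 'k \<Rightarrow> 'k" by (rule vector_space_mult)
    show sub: "k.subspace UNIV" by (rule k.subspace_UNIV)
    have "UNIV \<subseteq> k.span {1}"
    proof
      fix x :: 'k show "x \<in> k.span {1}"
        using k.span_scale[OF k.span_base[of 1 "{1}"], of x] by simp
    qed
    then show "fin_dim ((*) :: 'k \<Rightarrow> 'k \<Rightarrow> 'k) UNIV"
      by (intro fin_dimI[OF vector_space_mult sub, of "{1}"]) simp_all
  qed
  moreover have "left_module H (unit_module H)"
  proof (rule left_module.intro)
    have cou: "cou H (x + y) = cou H x + cou H y" "cou H (scl H c x) = c * cou H x" for x y c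
      using cou_linear by (simp_all add: lin_form_iff)
    show "vector_space (smul (unit_module H))"
      by (simp add: unit_module_def vector_space_mult)
    show "module.subspace (smul (unit_module H)) (carr (unit_module H))"
      using sub by (simp add: unit_module_def)
    fix a b :: 'h and c v :: 'k
    show "act (unit_module H) (a + b) v = act (unit_module H) a v + act (unit_module H) b v"
      by (simp add: unit_module_def cou distrib_right)
    show "act (unit_module H) (scl H c a) v = smul (unit_module H) c (act (unit_module H) a v)"
      by (simp add: unit_module_def cou mult.assoc)
  qed (simp_all add: unit_module_def distrib_left cou_mult cou_one mult_ac)
  ultimately show ?thesis by (simp add: fd_module_def unit_module_def)
qed

section \<open>The Drinfeld twist on modules and a model of H \<otimes> H\<close>

lemma twist_sum_add: "twist_sum (\<lambda>x y. F x y + G x y) = twist_sum F + twist_sum G"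
  by (simp add: twist_sum_def sweedler_sum_defs split_def sum_list_addf)

lemma twist_sum_sum: "finite B \<Longrightarrow> twist_sum (\<lambda>x y. \<Sum>b\<in>B. F b x y) = (\<Sum>b\<in>B. twist_sum (F b))"
proof (induction B rule: finite_induct)
  case empty
  show ?case by (simp add: twist_sum_def sweedler_sum_defs split_def)
qed (simp add: twist_sum_add)

lemma cop_sum_sum: "finite B \<Longrightarrow> cop_sum h (\<lambda>x y. \<Sum>b\<in>B. F b x y) = (\<Sum>b\<in>B. cop_sum h (F b))"
  by (induction B rule: finite_induct) (simp_all add: cop_sum_def split_def sum_list_addf)

text \<open>Moving every action on a dual over to the argument, by S, gathers all components of
  \<Phi>, its inverse and the coproducts into one tensor acting on m and n, the same for all
  modules. This is where the twist comes from.\<close>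

lemma dual_tensor_eq:
  assumes M: "left_module H M" and N: "left_module H N"
    and m: "m \<in> carr M" and n: "n \<in> carr N"
  shows "dual_tensor H M N \<phi> \<psi> m n = twist_sum (\<lambda>x y. \<psi> (act M x m) * \<phi> (act N y n))"
proof -
  interpret M: left_module H M by (rule M)
  interpret N: left_module H N by (rule N)
  show ?thesis
    unfolding twist_sum_def cop_sum_def phi_sum_def phi_inv_sum_def dual_tensor_def pair_ev_def ev_def
    using m n
    by (simp add: dual_def codual_def M.act_closed N.act_closed anti_mult
        M.act_mult[symmetric] N.act_mult[symmetric] mult.assoc mult.commute[of "\<phi> _"])
qed

text \<open>Over a finite basis a bilinear form is a finite sum of products of linear forms.
  Monoidality of j speaks directly about such products only.\<close>

lemma mlin2_expand:
  assumes G: "mlin2 (scl H) G" and B: "finite B" "scl.independent B" "scl.span B = UNIV"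
  shows "G x y = (\<Sum>b\<in>B. scl.representation B x b * G b y)"
proof -
  have lin: "lin_form (\<lambda>x. G x y)" using G by (simp add: mlin2_def)
  interpret l: Vector_Spaces.linear "scl H" "(*)" "\<lambda>x. G x y" by (rule lin)
  have "G x y = G (\<Sum>b\<in>B. scl H (scl.representation B x b) b) y"
    using scl.sum_representation_eq[OF B(2) _ B(1) order.refl] B(3) by simp
  also have "\<dots> = (\<Sum>b\<in>B. scl.representation B x b * G b y)"
    by (simp add: l.sum l.scale)
  finally show ?thesis .
qed

lemma lin_form_representation:
  assumes "scl.independent B" "scl.span B = UNIV"
  shows "lin_form (\<lambda>x. scl.representation B x b)"
  by (rule scl.linear_representation) (use assms in auto)

text \<open>
  A concrete model of \<open>H \<otimes> H\<close>: the functionals on bilinear forms spanned by the evaluations.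
\<close>

definition pure :: "'h \<Rightarrow> 'h \<Rightarrow> ('h \<Rightarrow> 'h \<Rightarrow> 'k) \<Rightarrow> 'k" where
  "pure m n F = (if mlin2 (scl H) F then F m n else 0)"

text \<open>With functionals instead of a quotient of lists, equality of tensors is equality of
  functions. The value 0 of \<open>pure\<close> at forms that are not bilinear makes it bilinear in
  its two arguments; the action respects this value, so that it preserves the span.\<close>

definition tensor_square :: "('k, 'h, ('h \<Rightarrow> 'h \<Rightarrow> 'k) \<Rightarrow> 'k) lmod" where
  "tensor_square = \<lparr>carr = module.span (fun_smul (*)) (range (case_prod pure)), smul = fun_smul (*),
     act = (\<lambda>h \<xi> F. if mlin2 (scl H) F then \<xi> (\<lambda>m n. cop_sum h (\<lambda>a b. F (a * m) (b * n))) else 0)\<rparr>"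

lemma vector_space_tensor_square: "vector_space (smul tensor_square)"
  by (simp add: tensor_square_def vector_space_fun_smul vector_space_mult)

lemma act_pure:
  "act tensor_square h (pure m n) = (\<Sum>(a, b)\<leftarrow>cop H h. pure (a * m) (b * n))"
proof
  fix F
  have "mlin2 (scl H) (\<lambda>m n. cop_sum h (\<lambda>a b. F (a * m) (b * n)))" if F: "mlin2 (scl H) F"
    by (intro lin_intros lin_form_mlin2[OF F])
  then show "act tensor_square h (pure m n) F = (\<Sum>(a, b)\<leftarrow>cop H h. pure (a * m) (b * n)) F"
    by (simp add: sum_list_fun_apply split_def pure_def) (simp add: tensor_square_def pure_def cop_sum_def split_def)
qed

text \<open>Linearity in the form passes from pure tensors to their span. It is what makes the
  action additive in h, because h enters only through the form at which the functional is
  evaluated.\<close>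

lemma tensor_square_additive:
  assumes "\<xi> \<in> carr tensor_square"
  shows "(mlin2 (scl H) F \<longrightarrow> mlin2 (scl H) G \<longrightarrow> \<xi> (\<lambda>m n. F m n + G m n) = \<xi> F + \<xi> G) \<and>
    (mlin2 (scl H) F \<longrightarrow> \<xi> (\<lambda>m n. c * F m n) = c * \<xi> F) \<and> (\<not> mlin2 (scl H) F \<longrightarrow> \<xi> F = 0)"
proof -
  interpret T: vector_space "smul tensor_square" by (rule vector_space_tensor_square)
  have "\<xi> \<in> T.span (range (case_prod pure))" using assms by (simp add: tensor_square_def)
  then show ?thesis
  proof (induction rule: T.span_induct)
    case base
    show ?case
      by (rule T.subspaceI) (simp_all add: tensor_square_def fun_smul_def distrib_left mult.left_commute)
  next
    case (step \<xi>)
    then obtain m n where "\<xi> = pure m n" by auto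
    moreover have "mlin2 (scl H) (\<lambda>m n. F m n + G m n)" if "mlin2 (scl H) F" "mlin2 (scl H) G"
      using that by (simp add: mlin2_def lin_form_iff algebra_simps)
    moreover have "mlin2 (scl H) (\<lambda>m n. c * F m n)" if F: "mlin2 (scl H) F"
      by (intro lin_intros lin_form_mlin2[OF F])
    ultimately show ?case by (simp add: pure_def)
  qed
qed

lemma left_module_tensor_square: "left_module H tensor_square"
proof -
  interpret T: vector_space "smul tensor_square" by (rule vector_space_tensor_square)
  have carrT: "carr tensor_square = T.span (range (case_prod pure))" by (simp add: tensor_square_def)
  have add: "act tensor_square h (\<xi> + \<zeta>) = act tensor_square h \<xi> + act tensor_square h \<zeta>"
    and scale: "act tensor_square h (smul tensor_square c \<xi>) = smul tensor_square c (act tensor_square h \<xi>)"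
    for h c \<xi> \<zeta>
    by (auto simp: tensor_square_def fun_smul_def)
  have ml: "mlin2 (scl H) (\<lambda>m n. cop_sum h (\<lambda>a b. F (a * m) (b * n)))" if F: "mlin2 (scl H) F" for F h
    by (intro lin_intros lin_form_mlin2[OF F])
  have ml': "mlin2 (scl H) (\<lambda>a b. F (a * m) (b * n))" if F: "mlin2 (scl H) F" for F m n
    by (intro lin_intros lin_form_mlin2[OF F])
  show ?thesis
  proof (rule left_module.intro)
    show "vector_space (smul tensor_square)" by (rule vector_space_tensor_square)
    show "T.subspace (carr tensor_square)" by (simp add: carrT)
    fix \<xi> \<zeta> a b c assume \<xi>: "\<xi> \<in> carr tensor_square"
    show "act tensor_square a \<xi> \<in> carr tensor_square"
      using \<xi> unfolding carrT
    proof (induction rule: T.span_induct)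
      case base
      have "act tensor_square a 0 = 0" by (auto simp: tensor_square_def)
      then show ?case
        by (auto simp: T.subspace_def add scale T.span_zero intro: T.span_add T.span_scale)
    next
      case (step \<xi>)
      then obtain m n where \<xi>: "\<xi> = pure m n" by auto
      have "(\<Sum>(a, b)\<leftarrow>xs. pure (a * m) (b * n)) \<in> T.span (range (case_prod pure))" for xs
      proof (induction xs)
        case (Cons p xs)
        have "(case p of (a, b) \<Rightarrow> pure (a * m) (b * n)) \<in> T.span (range (case_prod pure))"
          by (rule T.span_base) (auto split: prod.split)
        from T.span_add[OF this Cons] show ?case by (simp only: list.map sum_list.Cons)
      qed (simp only: list.map sum_list.Nil T.span_zero)
      then show ?case by (simp only: \<xi> act_pure)
    qed
    show "act tensor_square a (\<xi> + \<zeta>) = act tensor_square a \<xi> + act tensor_square a \<zeta>"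
      "act tensor_square a (smul tensor_square c \<xi>) = smul tensor_square c (act tensor_square a \<xi>)"
      by (rule add scale)+
    have actF: "act tensor_square h \<xi> F = \<xi> (\<lambda>m n. cop_sum h (\<lambda>a b. F (a * m) (b * n)))"
      if "mlin2 (scl H) F" for h \<xi> F
      using that by (simp add: tensor_square_def)
    have act0: "act tensor_square h \<xi> F = 0" if "\<not> mlin2 (scl H) F" for h \<xi> F
      using that by (simp add: tensor_square_def)
    let ?F = "\<lambda>h F m n. cop_sum h (\<lambda>a b. F (a * m) (b * n))"
    show "act tensor_square (a + b) \<xi> = act tensor_square a \<xi> + act tensor_square b \<xi>"
    proof
      fix F
      have "\<xi> (?F (a + b) F) = \<xi> (?F a F) + \<xi> (?F b F)" if F: "mlin2 (scl H) F"
      proof -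
        have "?F (a + b) F = (\<lambda>m n. ?F a F m n + ?F b F m n)"
          by (intro ext cop_sum_add ml' F)
        then show ?thesis
          using tensor_square_additive[OF \<xi>, of "?F a F" "?F b F"] ml[OF F] by metis
      qed
      then show "act tensor_square (a + b) \<xi> F = (act tensor_square a \<xi> + act tensor_square b \<xi>) F"
        by (cases "mlin2 (scl H) F") (simp_all add: actF act0)
    qed
    show "act tensor_square (scl H c a) \<xi> = smul tensor_square c (act tensor_square a \<xi>)"
    proof
      fix F
      have "\<xi> (?F (scl H c a) F) = c * \<xi> (?F a F)" if F: "mlin2 (scl H) F"
      proof -
        have "?F (scl H c a) F = (\<lambda>m n. c * ?F a F m n)"
          by (intro ext cop_sum_scl ml' F)
        then show ?thesis
          using tensor_square_additive[OF \<xi>, of "?F a F" _ c] ml[OF F] by metis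
      qed
      moreover have "smul tensor_square c \<zeta> F = c * \<zeta> F" for \<zeta>
        by (simp add: tensor_square_def fun_smul_def)
      ultimately show "act tensor_square (scl H c a) \<xi> F = smul tensor_square c (act tensor_square a \<xi>) F"
        by (cases "mlin2 (scl H) F") (simp_all add: actF act0)
    qed
    show "act tensor_square 1 \<xi> = \<xi>"
    proof
      fix F
      have "?F 1 F = F" if F: "mlin2 (scl H) F"
        by (intro ext) (simp add: cop_sum_one[OF ml'[OF F]])
      then show "act tensor_square 1 \<xi> F = \<xi> F"
        using tensor_square_additive[OF \<xi>, of F]
        by (cases "mlin2 (scl H) F") (simp_all add: actF act0)
    qed
    show "act tensor_square (a * b) \<xi> = act tensor_square a (act tensor_square b \<xi>)"
    proof
      fix F
      \<comment> \<open>An element acts by changing the form, hence the reversed order.\<close>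
      have "?F (a * b) F = ?F b (?F a F)" if F: "mlin2 (scl H) F"
        by (intro ext, subst cop_sum_mult[OF ml'[OF F]], subst sweedler_sum_swap(4)) (simp add: mult.assoc)
      then show "act tensor_square (a * b) \<xi> F = act tensor_square a (act tensor_square b \<xi>) F"
        by (cases "mlin2 (scl H) F") (simp_all add: actF act0 ml)
    qed
  qed
qed

lemma fd_tensor_square:
  assumes fin: "fin_dim (scl H) UNIV"
  shows "fd_module H tensor_square"
proof -
  interpret T: vector_space "smul tensor_square" by (rule vector_space_tensor_square)
  have carrT: "carr tensor_square = T.span (range (case_prod pure))" by (simp add: tensor_square_def)
  obtain B where B: "finite B" "scl.span B = UNIV"
    using fin by (auto simp: fin_dim_def basis_of_def)
  have bilin: "pure (x + x') y = pure x y + pure x' y" "pure x (y + y') = pure x y + pure x y'"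
    "pure (scl H c x) y = smul tensor_square c (pure x y)"
    "pure x (scl H c y) = smul tensor_square c (pure x y)" for x x' y y' c
    by (auto simp: pure_def fun_eq_iff mlin2_def lin_form_iff tensor_square_def fun_smul_def)
  have zero: "pure 0 y = 0" "pure x 0 = 0" for x y
    using bilin(1)[of 0 0] bilin(2)[of _ 0 0] by simp_all
  let ?S = "T.span (case_prod pure ` (B \<times> B))"
  have "pure x b \<in> ?S" if b: "b \<in> B" for x b
  proof -
    have "x \<in> scl.span B" by (simp add: B)
    then show ?thesis
    proof (induction rule: scl.span_induct)
      case base
      show ?case by (auto simp: scl.subspace_def bilin zero T.span_zero intro: T.span_add T.span_scale)
    next
      case (step x)
      show ?case by (rule T.span_base) (use step b in auto)
    qed
  qed
  then have "pure x y \<in> ?S" for x y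
  proof -
    have "y \<in> scl.span B" by (simp add: B)
    then show ?thesis
    proof (induction rule: scl.span_induct)
      case base
      show ?case by (auto simp: scl.subspace_def bilin zero T.span_zero intro: T.span_add T.span_scale)
    next
      case (step y)
      then show ?case using \<open>\<And>x b. b \<in> B \<Longrightarrow> pure x b \<in> ?S\<close> by blast
    qed
  qed
  then have "carr tensor_square \<subseteq> ?S"
    unfolding carrT by (intro T.span_minimal) auto
  then have "fin_dim (smul tensor_square) (carr tensor_square)"
    using fin_dimI[OF vector_space_tensor_square _ _ \<open>carr tensor_square \<subseteq> ?S\<close>] B(1) carrT by simp
  then show ?thesis by (simp add: fd_module_def left_module_tensor_square)
qed

end

lemma iso_modD:
  assumes "\<theta> \<in> iso_mod V M"
  shows "bij_betw \<theta> (carr V) (carr M)" "\<theta> \<in> Hom_mod V M"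
    "v \<in> carr V \<Longrightarrow> \<theta> v \<in> carr M"
    "v \<in> carr V \<Longrightarrow> w \<in> carr V \<Longrightarrow> \<theta> (v + w) = \<theta> v + \<theta> w"
    "v \<in> carr V \<Longrightarrow> \<theta> (smul V c v) = smul M c (\<theta> v)"
    "v \<in> carr V \<Longrightarrow> \<theta> (act V a v) = act M a (\<theta> v)"
  using assms by (auto simp: iso_mod_def Hom_mod_def linear_on_mod_def)

lemma dualD:
  assumes "l \<in> carr (dual H V)"
  shows "v \<in> carr V \<Longrightarrow> w \<in> carr V \<Longrightarrow> l (v + w) = l v + l w"
    "v \<in> carr V \<Longrightarrow> l (smul V c v) = c * l v"
    "v \<notin> carr V \<Longrightarrow> l v = 0"
  using assms by (auto simp: carr_dual linear_on_mod_def)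

lemma dual_zero: "left_module H V \<Longrightarrow> l \<in> carr (dual H V) \<Longrightarrow> l 0 = 0"
  using linear_on_mod_zero[OF _ vector_space_mult] by (auto simp: carr_dual)

lemma act_dual: "act (dual H V) a l v = (if v \<in> carr V then l (act V (anti H a) v) else 0)"
  by (simp add: dual_def codual_def)

section \<open>The pivotal element\<close>

text \<open>Collects what concerns g apart from the normalisation by dimensions, which enters in
  \<open>tau_pivotal_element\<close>.\<close>

locale pivotal_element = quasi_hopf_algebra H + piv: pivotal_structure H j
  for H :: "('k::field, 'h::ring_1) qha" and j +
  fixes g :: 'h
  assumes fin: "fin_dim (scl H) UNIV"
    and j_one: "\<And>R \<theta>. fd_module H R \<Longrightarrow> \<theta> \<in> iso_mod (regular_module H) R \<Longrightarrow>
      bitransp H (regular_module H) R \<theta> (iota H (regular_module H) g) = j R (\<theta> 1)"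
begin

lemma fd_regular: "fd_module H (regular_module H)"
  using fin left_module_regular by (simp add: fd_module_def regular_module_def)

lemma dual_regular: "carr (dual H (regular_module H)) = {l. lin_form l}"
  by (auto simp: carr_dual linear_on_mod_def regular_module_def lin_form_iff)

lemma iso_regularD:
  assumes "\<theta> \<in> iso_mod (regular_module H) R"
  shows "bij_betw \<theta> UNIV (carr R)" "\<theta> x \<in> carr R" "\<theta> (x + y) = \<theta> x + \<theta> y"
    "\<theta> (scl H c x) = smul R c (\<theta> x)" "act R a (\<theta> x) = \<theta> (a * x)" "inv \<theta> (\<theta> x) = x"
    "r \<in> carr R \<Longrightarrow> \<theta> (inv \<theta> r) = r"
proof -
  show b: "bij_betw \<theta> UNIV (carr R)" and "\<theta> x \<in> carr R" "\<theta> (x + y) = \<theta> x + \<theta> y"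
    "\<theta> (scl H c x) = smul R c (\<theta> x)" "act R a (\<theta> x) = \<theta> (a * x)"
    using iso_modD[OF assms] by (auto simp: regular_module_def)
  show "inv \<theta> (\<theta> x) = x" "r \<in> carr R \<Longrightarrow> \<theta> (inv \<theta> r) = r"
    using b by (simp_all add: bij_betw_def f_inv_into_f)
qed

lemma inv_regularD:
  assumes "fd_module H R" "\<theta> \<in> iso_mod (regular_module H) R" "r \<in> carr R"
  shows "r' \<in> carr R \<Longrightarrow> inv \<theta> (r + r') = inv \<theta> r + inv \<theta> r'"
    "inv \<theta> (smul R c r) = scl H c (inv \<theta> r)" "inv \<theta> (act R a r) = a * inv \<theta> r"
  using iso_regularD[OF assms(2)] assms(3) by metis+

text \<open>Naturality along the module map from the regular module to M that sends 1 to m reduces j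
  at m to j at 1, where g is defined.\<close>

lemma j_eq:
  assumes M: "fd_module H M" and m: "m \<in> carr M" and l: "l \<in> carr (dual H M)"
  shows "j M m l = l (act M g m)"
proof -
  obtain R :: "('k, 'h) mod_obj" and \<theta> where R: "fd_module H R" and \<theta>: "\<theta> \<in> iso_mod (regular_module H) R"
    using fd_module_representative[OF fd_regular] by blast
  interpret M: left_module H M using M by (simp add: fd_module_def)
  interpret R: left_module H R using R by (simp add: fd_module_def)
  note \<theta>D = iso_regularD[OF \<theta>] and invD = inv_regularD[OF R \<theta>]
  define f where "f r = (if r \<in> carr R then act M (inv \<theta> r) m else 0)" for r
  have f\<theta>: "f (\<theta> x) = act M x m" for x
    by (simp add: f_def \<theta>D)
  have "f \<in> Hom_mod R M"
    using m by (simp add: Hom_mod_def linear_on_mod_def f_def invD R.carr_add R.carr_smul R.act_closed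
        M.act_closed M.act_plus M.act_scl M.act_mult)
  then have "j M (f (\<theta> 1)) = bitransp H R M f (j R (\<theta> 1))"
    by (intro piv.natural M R) (auto simp: \<theta>D)
  moreover have "f (\<theta> 1) = m" using m by (simp add: f\<theta> M.act_one)
  ultimately have "j M m = bitransp H R M f (j R (\<theta> 1))" by simp
  moreover have "j R (\<theta> 1) \<in> carr (dual H (dual H R))"
    using iso_modD(3)[OF piv.component[OF R]] by (simp add: \<theta>D)
  ultimately have "j M m l = j R (\<theta> 1) (l \<circ> f)"
    using l by (simp add: bitransp_def transp_def)
  moreover have lf: "l \<circ> f \<in> carr (dual H R)"
    using m dualD[OF l] dual_zero[OF M.left_module_axioms l]
    by (simp add: carr_dual linear_on_mod_def f_def invD R.carr_add R.carr_smul
        M.act_closed M.act_plus M.act_scl)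
  moreover have "iota H (regular_module H) g \<in> carr (dual H (dual H (regular_module H)))"
  proof -
    have "lin_form (\<lambda>x. f x + f' x)" "lin_form (\<lambda>x. c * f x)" if "lin_form f" "lin_form f'" for f f' c
      using that by (auto simp: lin_form_iff algebra_simps)
    moreover have "smul (dual H (regular_module H)) = fun_smul (*)"
      by (simp add: dual_def codual_def)
    ultimately show ?thesis
      by (auto simp: carr_dual[of H "dual H _"] linear_on_mod_def iota_def dual_regular fun_smul_def
          plus_fun_def)
  qed
  then have "bitransp H (regular_module H) R \<theta> (iota H (regular_module H) g) (l \<circ> f) = l (f (\<theta> g))"
  proof -
    have "l \<circ> f \<circ> \<theta> \<in> carr (dual H (regular_module H))"
      using dualD[OF lf] by (simp add: dual_regular lin_form_iff \<theta>D)
    with lf \<open>iota H _ g \<in> _\<close> show ?thesis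
      by (simp add: bitransp_def transp_def iota_def)
  qed
  ultimately show ?thesis
    by (simp add: j_one[OF R \<theta>] f\<theta>)
qed

text \<open>By \<open>j_eq\<close> a component of j is the action of g followed by evaluation on the
  dual, and it is bijective.\<close>

lemma g_injective:
  assumes V: "fd_module H V" and v: "v \<in> carr V" "act V g v = 0"
  shows "v = 0"
proof -
  obtain M :: "('k, 'h) mod_obj" and \<theta> where M: "fd_module H M" and \<theta>: "\<theta> \<in> iso_mod V M"
    using fd_module_representative[OF V] by blast
  interpret V: left_module H V using V by (simp add: fd_module_def)
  interpret M: left_module H M using M by (simp add: fd_module_def)
  note \<theta>D = iso_modD[OF \<theta>]
  have \<theta>0: "\<theta> 0 = 0" using \<theta>D(4)[OF V.carr_zero V.carr_zero] by simp
  have jM: "bij_betw (j M) (carr M) (carr (dual H (dual H M)))"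
    using iso_modD(1)[OF piv.component[OF M]] .
  have M0: "act M g 0 = 0" using M.act_add[OF M.carr_zero M.carr_zero, of g] by simp
  have "j M (\<theta> v) l = j M 0 l" for l
  proof (cases "l \<in> carr (dual H M)")
    case True
    have "act M g (\<theta> v) = 0" using v \<theta>D(6)[of v g] \<theta>0 by simp
    then show ?thesis using True v by (simp add: j_eq[OF M] \<theta>D M.carr_zero M0)
  next
    case False
    have "j M (\<theta> v) \<in> carr (dual H (dual H M))" "j M 0 \<in> carr (dual H (dual H M))"
      using jM \<theta>D(3)[OF v(1)] M.carr_zero by (auto simp: bij_betw_def)
    then show ?thesis using False by (simp add: dualD(3))
  qed
  then have "j M (\<theta> v) = j M 0" by blast
  then have "\<theta> v = 0"
    using jM \<theta>D(3)[OF v(1)] M.carr_zero by (auto simp: bij_betw_def inj_on_def)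
  then show ?thesis
    using \<theta>D(1) \<theta>0 v(1) V.carr_zero by (auto simp: bij_betw_def inj_on_def)
qed

text \<open>Linearity of j over H gives j(h 1) = h j(1) at the regular module, and h acts on the
  double dual through S^2.\<close>

lemma anti_anti_g: "anti H (anti H h) * g = g * h"
proof -
  obtain R :: "('k, 'h) mod_obj" and \<theta> where R: "fd_module H R" and \<theta>: "\<theta> \<in> iso_mod (regular_module H) R"
    using fd_module_representative[OF fd_regular] by blast
  interpret R: left_module H R using R by (simp add: fd_module_def)
  note \<theta>D = iso_regularD[OF \<theta>]
  interpret D: left_module H "dual H R" by (rule left_module_dual[OF quasi_hopf_algebra_axioms R.left_module_axioms])
  have "\<theta> (g * h) = \<theta> (anti H (anti H h) * g)"
  proof (rule dual_eqI[OF R.left_module_axioms])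
    fix l assume l: "l \<in> carr (dual H R)"
    have "l (\<theta> (g * h)) = j R (act R h (\<theta> 1)) l"
      using l by (simp add: j_eq[OF R] \<theta>D)
    also have "\<dots> = act (dual H (dual H R)) h (j R (\<theta> 1)) l"
      using iso_modD(6)[OF piv.component[OF R], of "\<theta> 1" h] by (simp add: \<theta>D(2))
    also have "\<dots> = l (\<theta> (anti H (anti H h) * g))"
      using l D.act_closed[OF l] by (simp add: act_dual[of H "dual H R"] j_eq[OF R] \<theta>D(2,5) act_dual)
    finally show "l (\<theta> (g * h)) = l (\<theta> (anti H (anti H h) * g))" .
  qed (simp_all add: \<theta>D)
  then show ?thesis using \<theta>D(6) by metis
qed

lemma cou_g_nonzero: "cou H g \<noteq> 0"
  using g_injective[OF fd_unit_module, of 1] by (auto simp: unit_module_def)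

text \<open>Apply \<epsilon> to S(h1) \<alpha> h2 = \<epsilon>(h) \<alpha>. The factor
  \<epsilon>(\<alpha>) can be cancelled because \<Phi>^1 \<beta> S(\<Phi>^2) \<alpha> \<Phi>^3 =
  1.\<close>

lemma cou_anti: "cou H (anti H h) = cou H h"
proof -
  have "phi_sum (\<lambda>a b c. cou H (a * bet H * anti H b * alp H * c)) = 1"
    using bet_alp_sum[OF cou_linear] by (simp add: cou_one)
  then have "cou H (alp H) \<noteq> 0"
    by (auto simp: cou_mult phi_sum_def split_def)
  moreover have "cou H (alp H) * cou H (anti H h) = cou H (alp H) * cou H h"
  proof -
    have "cou H (alp H) * cou H (anti H h) = cou H (alp H) * cop_sum h (\<lambda>a b. cou H b * cou H (anti H a))"
      by (subst counit_right_sum[of "\<lambda>x. cou H (anti H x)"]) (intro lin_intros, simp)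
    also have "\<dots> = cop_sum h (\<lambda>a b. cou H (anti H a * alp H * b))"
      by (simp add: cou_mult mult_ac flip: sweedler_sum_const_mult)
    also have "\<dots> = cou H (alp H) * cou H h"
      by (simp add: anti_alp_sum[OF cou_linear])
    finally show ?thesis .
  qed
  ultimately show ?thesis by simp
qed

text \<open>Compatibility of j with the tensor product of two copies of H, at 1 \<otimes> 1: on the
  product, j is the action of g through \<Delta>(g); on the factors, it is g in each.\<close>

lemma twist_product:
  assumes \<phi>: "lin_form \<phi>" and \<psi>: "lin_form \<psi>"
  shows "cop_sum g (\<lambda>g1 g2. twist_sum (\<lambda>x y. \<psi> (x * g1) * \<phi> (y * g2))) =
    twist_sum (\<lambda>x y. \<psi> (anti H y * g) * \<phi> (anti H x * g))"
proof -
  obtain R :: "('k, 'h) mod_obj" and \<theta> where R: "fd_module H R" and \<theta>: "\<theta> \<in> iso_mod (regular_module H) R"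
    using fd_module_representative[OF fd_regular] by blast
  interpret R: left_module H R using R by (simp add: fd_module_def)
  note \<theta>D = iso_regularD[OF \<theta>] and invD = inv_regularD[OF R \<theta>]
  obtain T :: "('k, 'h) mod_obj" and \<rho> where T: "fd_module H T" and \<rho>: "\<rho> \<in> iso_mod tensor_square T"
    using fd_module_representative[OF fd_tensor_square[OF fin]] by blast
  interpret T: left_module H T using T by (simp add: fd_module_def)
  interpret T0: left_module H tensor_square by (rule left_module_tensor_square)
  interpret T0s: vector_space "smul tensor_square" by (rule vector_space_tensor_square)
  note \<rho>D = iso_modD[OF \<rho>]
  have carrT: "carr tensor_square = T0s.span (range (case_prod pure))" by (simp add: tensor_square_def)
  have pure_carr: "pure m n \<in> carr tensor_square" for m n
    unfolding carrT by (rule T0s.span_base) auto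
  have bilin: "pure (x + x') y = pure x y + pure x' y" "pure x (y + y') = pure x y + pure x y'"
    "pure (scl H c x) y = smul tensor_square c (pure x y)"
    "pure x (scl H c y) = smul tensor_square c (pure x y)" for x x' y y' c
    by (auto simp: pure_def fun_eq_iff mlin2_def lin_form_iff tensor_square_def fun_smul_def)
  define t where "t r s = \<rho> (pure (inv \<theta> r) (inv \<theta> s))" for r s
  have t\<theta>: "t (\<theta> x) (\<theta> y) = \<rho> (pure x y)" for x y
    by (simp add: t_def \<theta>D)
  \<comment> \<open>Evaluation at \<open>F\<close>, read on the copy \<open>T\<close> of H \<otimes>
    H. For bilinear \<open>F\<close> it is the linear form that the universal property asks
    for.\<close>
  define L where "L F x = (if x \<in> carr T then inv_into (carr tensor_square) \<rho> x F else 0)" for F x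
  have L\<rho>: "L F (\<rho> \<xi>) = \<xi> F" if "\<xi> \<in> carr tensor_square" for F \<xi>
    using that \<rho>D(1,3) by (simp add: L_def bij_betw_def)
  have L_dual: "L F \<in> carr (dual H T)" for F
  proof -
    have "L F (x + y) = L F x + L F y \<and> L F (smul T c x) = c * L F x"
      if "x \<in> carr T" "y \<in> carr T" for x y c
    proof -
      have "x \<in> \<rho> ` carr tensor_square" "y \<in> \<rho> ` carr tensor_square"
        using that \<rho>D(1) by (simp_all add: bij_betw_def)
      then obtain \<xi> \<zeta> where *: "\<xi> \<in> carr tensor_square" "\<zeta> \<in> carr tensor_square" "x = \<rho> \<xi>" "y = \<rho> \<zeta>"
        by blast
      have "L F (\<rho> (smul tensor_square c \<xi>)) = c * \<xi> F"
        using * by (subst L\<rho>) (auto simp: T0.carr_smul, simp add: tensor_square_def fun_smul_def)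
      moreover have "L F (\<rho> (\<xi> + \<zeta>)) = \<xi> F + \<zeta> F"
        using * by (subst L\<rho>) (auto simp: T0.carr_add)
      ultimately show ?thesis using * by (simp add: \<rho>D L\<rho>)
    qed
    then show ?thesis by (auto simp: carr_dual linear_on_mod_def) (simp add: L_def)
  qed
  have Lt: "L F (t (\<theta> x) (\<theta> y)) = F x y" if "mlin2 (scl H) F" for F x y
    using that by (simp add: t\<theta> L\<rho> pure_carr pure_def)
  have tp: "tensor_product H R R T t"
    unfolding tensor_product_def
  proof (intro conjI allI impI ballI)
    show "bilinear_on_mods R R (smul T) t"
      by (simp add: bilinear_on_mods_def linear_on_mod_def t_def invD bilin \<rho>D pure_carr)
    show "t m n \<in> carr T" if "m \<in> carr R" "n \<in> carr R" for m n
      by (simp add: t_def \<rho>D pure_carr)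
    show "act T h (t m n) = (\<Sum>(a, b)\<leftarrow>cop H h. t (act R a m) (act R b n))"
      if "m \<in> carr R" "n \<in> carr R" for h m n
    proof -
      have "act T h (t m n) = \<rho> (\<Sum>p\<leftarrow>cop H h. case p of (a, b) \<Rightarrow> pure (a * inv \<theta> m) (b * inv \<theta> n))"
        by (simp add: t_def \<rho>D(6)[OF pure_carr, symmetric] act_pure)
      also have "\<dots> = (\<Sum>p\<leftarrow>cop H h. \<rho> (case p of (a, b) \<Rightarrow> pure (a * inv \<theta> m) (b * inv \<theta> n)))"
        using \<rho>D(2) by (intro linear_on_mod_sum_list[OF left_module_tensor_square T.smul_vector_space])
          (auto simp: Hom_mod_def pure_carr)
      finally show ?thesis
        using that by (simp add: t_def invD split_def)
    qed
    fix F assume F: "bilinear_on_mods R R (*) F"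
    let ?F = "\<lambda>x y. F (\<theta> x) (\<theta> y)"
    have mF: "mlin2 (scl H) ?F"
      using F by (auto simp: mlin2_def lin_form_iff bilinear_on_mods_def linear_on_mod_def \<theta>D)
    show "\<exists>!l. l \<in> carr (dual H T) \<and> (\<forall>m\<in>carr R. \<forall>n\<in>carr R. l (t m n) = F m n)"
    proof (rule ex1I)
      show "L ?F \<in> carr (dual H T) \<and> (\<forall>m\<in>carr R. \<forall>n\<in>carr R. L ?F (t m n) = F m n)"
        using L_dual Lt[OF mF] \<theta>D(7) by metis
      fix l assume l: "l \<in> carr (dual H T) \<and> (\<forall>m\<in>carr R. \<forall>n\<in>carr R. l (t m n) = F m n)"
      have "l (\<rho> \<xi>) = L ?F (\<rho> \<xi>)" if "\<xi> \<in> carr tensor_square" for \<xi>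
      proof -
        have "\<xi> \<in> carr tensor_square \<and> l (\<rho> \<xi>) = L ?F (\<rho> \<xi>)"
          using that unfolding carrT
        proof (induction rule: T0s.span_induct)
          case base
          have ld: "l \<in> carr (dual H T)" using l by simp
          have "\<rho> 0 = 0" using \<rho>D(4)[OF T0.carr_zero T0.carr_zero] by simp
          then show ?case
            unfolding carrT[symmetric]
            by (intro T0s.subspaceI) (auto simp: T0.carr_zero T0.carr_add T0.carr_smul \<rho>D
                dualD[OF ld] dualD[OF L_dual] dual_zero[OF T.left_module_axioms ld]
                dual_zero[OF T.left_module_axioms L_dual])
        next
          case (step \<xi>)
          then obtain x y where \<xi>: "\<xi> = pure x y" by auto
          have "l (t (\<theta> x) (\<theta> y)) = ?F x y" using l \<theta>D(2) by blast
          then show ?case using pure_carr[of x y] Lt[OF mF, of x y] by (simp add: \<xi> carrT t\<theta>)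
        qed
        then show ?thesis by simp
      qed
      then have "l x = L ?F x" if "x \<in> carr T" for x
      proof -
        have "x \<in> \<rho> ` carr tensor_square"
          using that by (simp only: bij_betw_imp_surj_on[OF \<rho>D(1)])
        then show ?thesis using \<open>\<And>\<xi>. \<xi> \<in> carr tensor_square \<Longrightarrow> l (\<rho> \<xi>) = L ?F (\<rho> \<xi>)\<close> by blast
      qed
      moreover have "l x = L ?F x" if "x \<notin> carr T" for x
        using that l dualD(3)[OF L_dual] by (auto simp: dualD(3))
      ultimately show "l = L ?F" by blast
    qed
  qed
  define \<phi>' where "\<phi>' r = (if r \<in> carr R then \<phi> (inv \<theta> r) else 0)" for r
  define \<psi>' where "\<psi>' r = (if r \<in> carr R then \<psi> (inv \<theta> r) else 0)" for r
  have \<phi>': "\<phi>' \<in> carr (dual H R)" and \<psi>': "\<psi>' \<in> carr (dual H R)"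
    using \<phi> \<psi> by (auto simp: carr_dual linear_on_mod_def \<phi>'_def \<psi>'_def invD R.carr_add R.carr_smul lin_form_iff)
  have \<phi>'\<theta>: "\<phi>' (\<theta> x) = \<phi> x" and \<psi>'\<theta>: "\<psi>' (\<theta> x) = \<psi> x" for x
    by (simp_all add: \<phi>'_def \<psi>'_def \<theta>D)
  \<comment> \<open>The bilinear form whose linearisation is the image of \<phi>' \<otimes> \<psi>'
    in the dual of \<open>T\<close>.\<close>
  define F where "F m n = twist_sum (\<lambda>x y. \<psi> (x * m) * \<phi> (y * n))" for m n
  have mF: "mlin2 (scl H) F"
    unfolding F_def twist_sum_def by (intro lin_intros lin_form_comp[OF \<phi>] lin_form_comp[OF \<psi>])
  have F: "L F (t m n) = dual_tensor H R R \<phi>' \<psi>' m n" if mn: "m \<in> carr R" "n \<in> carr R" for m n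
  proof -
    obtain x y where "m = \<theta> x" "n = \<theta> y" using mn \<theta>D(7) by metis
    then show ?thesis
      by (simp add: Lt[OF mF] dual_tensor_eq[OF R.left_module_axioms R.left_module_axioms] \<theta>D(2,5)
          \<phi>'\<theta> \<psi>'\<theta>) (simp add: F_def)
  qed
  have D: "left_module H (dual H R)"
    by (rule left_module_dual[OF quasi_hopf_algebra_axioms R.left_module_axioms])
  interpret D: left_module H "dual H R" by (rule D)
  have "L F (act T g (t (\<theta> 1) (\<theta> 1))) = j T (t (\<theta> 1) (\<theta> 1)) (L F)"
    by (subst j_eq[OF T _ L_dual]) (simp_all add: t\<theta> \<rho>D pure_carr)
  also have "\<dots> = dual_tensor H (dual H R) (dual H R) (j R (\<theta> 1)) (j R (\<theta> 1)) \<phi>' \<psi>'"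
    by (rule piv.tensor[OF R R T tp]) (use F L_dual \<phi>' \<psi>' in \<open>simp_all add: \<theta>D\<close>)
  \<comment> \<open>The twist now acts on duals, hence through S, and passing to the dual has
    reversed the factors: x meets \<phi> and y meets \<psi>.\<close>
  also have "\<dots> = twist_sum (\<lambda>x y. \<psi> (anti H y * g) * \<phi> (anti H x * g))"
    using D.act_closed[OF \<phi>'] D.act_closed[OF \<psi>']
    by (simp add: dual_tensor_eq[OF D D \<phi>' \<psi>'] j_eq[OF R] \<theta>D(2,5) act_dual \<phi>'\<theta> \<psi>'\<theta> mult.commute)
  also have "L F (act T g (t (\<theta> 1) (\<theta> 1))) = L F (\<rho> (act tensor_square g (pure 1 1)))"
    by (simp add: t\<theta> \<rho>D(6)[OF pure_carr])
  also have "\<dots> = cop_sum g F"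
    by (subst L\<rho>[OF T0.act_closed[OF pure_carr]])
      (simp add: act_pure sum_list_fun_apply split_def pure_def mF cop_sum_def)
  finally show ?thesis by (simp add: F_def[abs_def])
qed

text \<open>By \<open>mlin2_expand\<close> it is enough to treat products of linear forms, which is
  \<open>twist_product\<close>.\<close>

lemma twist_g:
  assumes G: "mlin2 (scl H) G"
  shows "twist_sum (\<lambda>x y. cop_sum g (\<lambda>g1 g2. G (x * g1) (y * g2))) = twist_sum (\<lambda>x y. G (anti H y * g) (anti H x * g))"
proof -
  obtain B where B: "finite B" "scl.independent B" "scl.span B = UNIV"
    using fin by (auto simp: fin_dim_def basis_of_def)
  let ?r = "scl.representation B"
  note expand = mlin2_expand[OF G B]
  have swap: "twist_sum (\<lambda>x y. cop_sum g (\<lambda>g1 g2. K x y g1 g2)) = cop_sum g (\<lambda>g1 g2. twist_sum (\<lambda>x y. K x y g1 g2))" for K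
    unfolding twist_sum_def by (simp only: sweedler_sum_swap(1,2) sweedler_sum_swap(4)[where h = g])
  have "twist_sum (\<lambda>x y. cop_sum g (\<lambda>g1 g2. G (x * g1) (y * g2))) =
    cop_sum g (\<lambda>g1 g2. twist_sum (\<lambda>x y. \<Sum>b\<in>B. ?r (x * g1) b * G b (y * g2)))"
    by (subst swap) (subst expand, rule refl)
  also have "\<dots> = (\<Sum>b\<in>B. cop_sum g (\<lambda>g1 g2. twist_sum (\<lambda>x y. ?r (x * g1) b * G b (y * g2))))"
    by (simp only: twist_sum_sum[OF B(1)] cop_sum_sum[OF B(1)])
  also have "\<dots> = (\<Sum>b\<in>B. twist_sum (\<lambda>x y. ?r (anti H y * g) b * G b (anti H x * g)))"
    by (intro sum.cong refl twist_product lin_form_representation[OF B(2,3)] lin_form_mlin2(2)[OF G lin_endo_id])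
  also have "\<dots> = twist_sum (\<lambda>x y. \<Sum>b\<in>B. ?r (anti H y * g) b * G b (anti H x * g))"
    by (simp only: twist_sum_sum[OF B(1)])
  also have "\<dots> = twist_sum (\<lambda>x y. G (anti H y * g) (anti H x * g))"
    by (subst (2) expand) (rule refl)
  finally show ?thesis .
qed

lemma anti_g_mult: "anti H g * g = 1"
proof -
  have *: "anti H g * g = scl H (cou H g) 1"
    by (rule pivotal_anti_mult[OF twist_g anti_anti_g])
  have "cou H g * cou H g = cou H g"
    using arg_cong[OF *, of "cou H"] cou_linear by (simp add: cou_mult cou_anti cou_one lin_form_iff)
  then have "cou H g = 1" using cou_g_nonzero by simp
  then show ?thesis using * by simp
qed

end

section \<open>Schur's lemma\<close>

text \<open>Take a nonzero polynomial p of least degree with p(T) v = 0 and a root c of it, so that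
  p = (X - c) q. Then q(T) v is nonzero by minimality, and T multiplies it by c.\<close>

lemma exists_eigenvector:
  fixes s :: "'k::alg_closed_field \<Rightarrow> 'v::ab_group_add \<Rightarrow> 'v"
  assumes s: "vector_space s" and fin: "fin_dim s U" and v: "v \<in> U" "v \<noteq> 0"
    and closed: "\<And>x. x \<in> U \<Longrightarrow> T x \<in> U"
    and add: "\<And>x y. x \<in> U \<Longrightarrow> y \<in> U \<Longrightarrow> T (x + y) = T x + T y"
    and scale: "\<And>c x. x \<in> U \<Longrightarrow> T (s c x) = s c (T x)"
  obtains c w where "w \<in> U" "w \<noteq> 0" "T w = s c w"
proof -
  interpret vector_space s by (rule s)
  obtain B where B: "finite B" "independent B" "span B = U"
    using fin by (auto simp: fin_dim_def basis_of_def)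
  have U: "0 \<in> U" "\<And>x y. x \<in> U \<Longrightarrow> y \<in> U \<Longrightarrow> x + y \<in> U" "\<And>c x. x \<in> U \<Longrightarrow> s c x \<in> U"
    using B(3) span_zero span_add span_scale by auto
  have T0: "T 0 = 0" using scale[OF U(1), of 0] by simp
  \<comment> \<open>This is p(T) v, evaluated by Horner's scheme.\<close>
  define ev where "ev p = fold_coeffs (\<lambda>a w. s a v + T w) p 0" for p
  have ev0: "ev 0 = 0" by (simp add: ev_def)
  have evC: "ev (pCons a p) = s a v + T (ev p)" for a p
    by (cases "a = 0"; cases "p = 0") (auto simp: ev_def T0)
  have evU: "ev p \<in> U" for p
    by (induction p) (simp_all add: ev0 evC U v closed)
  have ev_add: "ev (p + q) = ev p + ev q" for p q
    by (induction p q rule: poly_induct2) (simp_all add: ev0 evC evU add scale_left_distrib add_ac)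
  have ev_smult: "ev (smult c p) = s c (ev p)" for c p
    by (induction p) (simp_all add: ev0 evC evU scale scale_right_distrib)
  have ev_sum: "ev (\<Sum>i\<in>I. P i) = (\<Sum>i\<in>I. ev (P i))" if "finite I" for I :: "nat set" and P
    using that by (induction rule: finite_induct) (simp_all add: ev0 ev_add)
  define t where "t i = (T ^^ i) v" for i
  have tU: "t i \<in> U" for i by (induction i) (simp_all add: t_def v closed)
  have ev_monom: "ev (monom c i) = s c (t i)" for c i
    by (induction i) (simp_all add: monom_0 monom_Suc evC ev0 T0 t_def scale tU[unfolded t_def])
  have "\<exists>p. p \<noteq> 0 \<and> ev p = 0"
  \<comment> \<open>There are \<open>card B + 1\<close> iterates of v. If they are distinct, a
    linear dependence gives the coefficients of p. Dependence is a property of sets and does not see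
    repetitions, so coinciding iterates are treated apart, with p = X^i - X^k.\<close>
  proof (cases "inj_on t {..card B}")
    case True
    have "dependent (t ` {..card B})"
    proof (rule ccontr)
      assume "independent (t ` {..card B})"
      then have "card (t ` {..card B}) \<le> card B"
        using independent_span_bound[OF B(1)] tU B(3) by auto
      then show False by (simp add: card_image[OF True])
    qed
    then obtain S u w where S: "finite S" "S \<subseteq> t ` {..card B}" "(\<Sum>x\<in>S. s (u x) x) = 0" "w \<in> S" "u w \<noteq> 0"
      unfolding dependent_explicit by blast
    define I where "I = {i \<in> {..card B}. t i \<in> S}"
    have I: "finite I" "bij_betw t I S"
      using S(2) True by (auto simp: I_def bij_betw_def inj_on_def)
    define p where "p = (\<Sum>i\<in>I. monom (u (t i)) i)"
    have "ev p = (\<Sum>i\<in>I. s (u (t i)) (t i))"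
      by (simp add: p_def ev_sum[OF I(1)] ev_monom)
    also have "\<dots> = 0"
      using sum.reindex_bij_betw[OF I(2), of "\<lambda>x. s (u x) x"] S(3) by simp
    finally have "ev p = 0" .
    moreover obtain k where k: "k \<in> I" "t k = w"
      using I(2) S(4) by (auto simp: bij_betw_def)
    have "coeff p k = u w"
      using k I(1) by (simp add: p_def coeff_sum)
    then have "p \<noteq> 0" using S(5) by auto
    ultimately show ?thesis by blast
  next
    case False
    then obtain i k where ik: "i \<noteq> k" "t i = t k" by (auto simp: inj_on_def)
    have "ev (monom 1 i + smult (-1) (monom 1 k)) = 0"
      using ik by (simp only: ev_add ev_smult ev_monom) simp
    moreover have "coeff (monom 1 i + smult (-1) (monom 1 k)) i \<noteq> (0 :: 'k)"
      using ik by simp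
    then have "monom 1 i + smult (-1) (monom 1 k) \<noteq> (0 :: 'k poly)" by (metis coeff_0)
    ultimately show ?thesis by blast
  qed
  then obtain p where p: "p \<noteq> 0" "ev p = 0" and min: "\<And>q. degree q < degree p \<Longrightarrow> q \<noteq> 0 \<Longrightarrow> ev q \<noteq> 0"
    using exists_least_iff[of "\<lambda>n. \<exists>p. degree p = n \<and> p \<noteq> 0 \<and> ev p = 0"] by auto
  have "degree p \<noteq> 0"
  proof
    assume "degree p = 0"
    then obtain a where "p = [:a:]" by (auto elim: degree_eq_zeroE)
    with p v show False by (simp add: evC ev0 T0)
  qed
  then obtain c where "poly p c = 0" using alg_closed_imp_poly_has_root[of p] by auto
  then obtain q where q: "p = [:- c, 1:] * q" by (auto simp: poly_eq_0_iff_dvd dvd_def)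
  then have "q \<noteq> 0" using p by auto
  then have "degree q < degree p" unfolding q by (subst degree_mult_eq) auto
  then have "ev q \<noteq> 0" using min \<open>q \<noteq> 0\<close> by blast
  moreover have "ev p = s (- c) (ev q) + T (ev q)"
  proof -
    have "p = smult (- c) q + pCons 0 q" by (simp add: q)
    then have "ev p = s (- c) (ev q) + (s 0 v + T (ev q))" by (simp only: ev_add ev_smult evC)
    then show ?thesis by simp
  qed
  then have "T (ev q) = s c (ev q)" using p(2) by simp
  ultimately show ?thesis using that[of "ev q" c] evU by blast
qed

lemma simple_module_full:
  assumes "simple_module V" "submodule V U" "u \<in> U" "u \<noteq> 0"
  shows "U = carr V"
  using assms by (auto simp: simple_module_def)

text \<open>For an eigenvalue c of the composite of f' with the inverse of f, the set where f' = c f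
  is a nonzero submodule. Taking an isomorphism f as reference, and not the identity, lets the
  result compare forms on V as well as the actions of g and \<open>\<tau> g\<close>.\<close>

lemma schur:
  fixes H :: "('k::alg_closed_field, 'h::ring_1) qha"
  assumes V: "fd_module H V" "simple_module V" and W: "left_module H W"
    and f: "f \<in> iso_mod V W" and f': "f' \<in> Hom_mod V W"
  obtains c where "\<And>v. v \<in> carr V \<Longrightarrow> f' v = smul W c (f v)"
proof -
  interpret V: left_module H V using V by (simp add: fd_module_def)
  interpret W: left_module H W by (rule W)
  interpret Ws: vector_space "smul W" by (rule W.smul_vector_space)
  interpret Vs: vector_space "smul V" by (rule V.smul_vector_space)
  note fD = iso_modD[OF f]
  have f'D: "v \<in> carr V \<Longrightarrow> w \<in> carr V \<Longrightarrow> f' (v + w) = f' v + f' w"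
    "v \<in> carr V \<Longrightarrow> f' (smul V c v) = smul W c (f' v)"
    "v \<in> carr V \<Longrightarrow> f' v \<in> carr W" "v \<in> carr V \<Longrightarrow> f' (act V a v) = act W a (f' v)" for v w c a
    using f' by (auto simp: Hom_mod_def linear_on_mod_def)
  define T where "T v = inv_into (carr V) f (f' v)" for v
  have T: "T v \<in> carr V" "f (T v) = f' v" if "v \<in> carr V" for v
    using f'D(3)[OF that] fD(1) unfolding T_def bij_betw_def
    by (auto intro: inv_into_into f_inv_into_f)
  have inj: "v = w" if "f v = f w" "v \<in> carr V" "w \<in> carr V" for v w
    using fD(1) that by (auto simp: bij_betw_def inj_on_def)
  have "carr V \<noteq> {0}" using V by (simp add: simple_module_def)
  then obtain v where v: "v \<in> carr V" "v \<noteq> 0" using V.carr_zero by blast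
  have T_add: "T (x + y) = T x + T y" if "x \<in> carr V" "y \<in> carr V" for x y
    using that by (intro inj) (simp_all add: T f'D fD V.carr_add)
  have T_smul: "T (smul V c x) = smul V c (T x)" if "x \<in> carr V" for c x
    using that by (intro inj) (simp_all add: T f'D[OF that] fD V.carr_smul)
  have "fin_dim (smul V) (carr V)" using V by (simp add: fd_module_def)
  then obtain c w where w: "w \<in> carr V" "w \<noteq> 0" "T w = smul V c w"
    by (rule exists_eigenvector[OF V.smul_vector_space _ v T(1) T_add T_smul])
  let ?U = "{v \<in> carr V. f' v = smul W c (f v)}"
  have "submodule V ?U"
  proof -
    have zero: "f 0 = 0" "f' 0 = 0"
      using fD(4)[OF V.carr_zero V.carr_zero] f'D(1)[OF V.carr_zero V.carr_zero] by simp_all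
    have "Vs.subspace ?U"
      by (rule Vs.subspaceI) (simp_all add: zero V.carr_zero V.carr_add V.carr_smul fD f'D
          Ws.scale_right_distrib mult.commute)
    then show ?thesis
      by (auto simp: submodule_def V.act_closed fD f'D W.act_smul)
  qed
  moreover have "f' w = smul W c (f w)"
    using T(2)[OF w(1)] w by (simp add: fD)
  ultimately have "?U = carr V"
    using simple_module_full[OF V(2), of ?U w] w by simp
  then have "f' v = smul W c (f v)" if "v \<in> carr V" for v
    using that by blast
  then show ?thesis by (rule that)
qed

section \<open>Forms adjoint with respect to the involution\<close>

text \<open>The basis in \<open>trace_on\<close> is chosen arbitrarily, but for a scalar map only
  its cardinality matters.\<close>

lemma trace_on_scalar:
  assumes s: "vector_space s" and B: "basis_of s U B" "finite B"
    and f: "\<And>u. u \<in> U \<Longrightarrow> f u = s c u"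
  shows "trace_on s U f = c * of_nat (card B)"
proof -
  interpret vector_space s by (rule s)
  define C where "C = (SOME B. basis_of s U B)"
  have "basis_of s U C" unfolding C_def using B(1) by (rule someI)
  then have C: "independent C" "span C = U" by (simp_all add: basis_of_def)
  have "card C = card B"
    using dim_span_eq_card_independent[OF C(1)] dim_span_eq_card_independent[of B] B(1)
    by (simp add: basis_of_def C(2) del: dim_span)
  have "representation C (f b) b = c" if "b \<in> C" for b
  proof -
    have "b \<in> span C" using that by (rule span_base)
    moreover from this have "f b = s c b" using C(2) f by simp
    ultimately show ?thesis
      using C(1) that by (simp add: representation_scale representation_basis)
  qed
  then have "trace_on s U f = (\<Sum>b\<in>C. c)"
    unfolding trace_on_def Let_def C_def[symmetric] by simp
  then show ?thesis by (simp add: \<open>card C = card B\<close> mult.commute)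
qed

locale involutive_module = quasi_hopf_algebra H + V: left_module H V
  for H :: "('k::field, 'h::ring_1) qha" and V :: "('k, 'h, 'v::ab_group_add) lmod" +
  fixes \<tau> :: "'h \<Rightarrow> 'h"
  assumes invol: "qha_involution H \<tau>"
begin

lemma tau:
  shows tau_tau: "\<tau> (\<tau> a) = a"
    and tau_add: "\<tau> (a + b) = \<tau> a + \<tau> b" and tau_scl: "\<tau> (scl H c a) = scl H c (\<tau> a)"
    and tau_mult: "\<tau> (a * b) = \<tau> a * \<tau> b" and tau_one: "\<tau> 1 = 1"
    and tau_anti: "anti H (\<tau> a) = \<tau> (anti H a)"
    and tau_alp: "\<tau> (alp H) = alp H" and tau_bet: "\<tau> (bet H) = bet H"
  using invol by (auto simp: qha_involution_def qha_morphism_def lin_endo_iff fun_eq_iff)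

lemma left_module_natural_twist:
  assumes "left_module H M" shows "left_module H (natural_twist \<tau> M)"
proof -
  interpret M: left_module H M by (rule assms)
  show ?thesis
    by (rule left_module.intro) (simp_all add: natural_twist_def M.smul_vector_space M.carr_subspace
      M.act_closed M.act_add M.act_smul M.act_plus M.act_scl M.act_one M.act_mult tau)
qed

abbreviation sharp_V :: "('k, 'h, 'v \<Rightarrow> 'k) lmod" where
  "sharp_V \<equiv> sharp H \<tau> V"

abbreviation Hom_sharp :: "('v \<Rightarrow> 'v \<Rightarrow> 'k) set" where
  "Hom_sharp \<equiv> Hom_mod V sharp_V"

lemma left_module_sharp: "left_module H sharp_V"
  unfolding sharp_def
  by (rule left_module_codual[OF V.left_module_axioms])
    (use anti_linear in \<open>simp_all add: tau lin_endo_iff anti_mult anti_one flip: tau_anti\<close>)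

lemma sharp_simps:
  "carr sharp_V = {f. linear_on_mod V (*) f \<and> (\<forall>v. v \<notin> carr V \<longrightarrow> f v = 0)}"
  "smul sharp_V = fun_smul (*)"
  "act sharp_V a f v = (if v \<in> carr V then f (act V (anti H (\<tau> a)) v) else 0)"
  by (simp_all add: sharp_def codual_def)

text \<open>As \<tau> is its own inverse, the twist can be moved from the source to the target,
  where it turns the dual into \<open>sharp\<close>.\<close>

lemma iso_natural_twist: "iso_mod (natural_twist \<tau> V) (dual H V) = iso_mod V sharp_V"
proof -
  have "(\<forall>a. \<forall>v\<in>carr V. f (act V (\<tau> a) v) = act (dual H V) a (f v)) \<longleftrightarrow>
    (\<forall>a. \<forall>v\<in>carr V. f (act V a v) = act (dual H V) (\<tau> a) (f v))" for f
    by (metis tau_tau)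
  moreover have "act (dual H V) (\<tau> a) = act sharp_V a" for a
    by (simp add: dual_def sharp_def codual_def fun_eq_iff)
  moreover have "carr (dual H V) = carr sharp_V" "smul (dual H V) = smul sharp_V"
    by (simp_all add: dual_def sharp_def codual_def)
  ultimately show ?thesis
    by (simp add: iso_mod_def Hom_mod_def natural_twist_def linear_on_mod_def)
qed

text \<open>This is currying. The same curried function serves as module map and as form, since
  vanishing off the carrier is demanded in both readings.\<close>

lemma Hom_sharp_iff:
  "f \<in> Hom_sharp \<longleftrightarrow> bilinear_on_mods V V (*) f \<and>
     (\<forall>a. \<forall>v\<in>carr V. \<forall>w\<in>carr V. f (act V a v) w = f v (act V (anti H (\<tau> a)) w)) \<and>
     (\<forall>v w. v \<notin> carr V \<or> w \<notin> carr V \<longrightarrow> f v w = 0)" (is "_ \<longleftrightarrow> ?R")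
proof
  assume f: "f \<in> Hom_sharp"
  then have *: "v \<in> carr V \<Longrightarrow> f v \<in> carr sharp_V" "v \<notin> carr V \<Longrightarrow> f v = 0"
    "v \<in> carr V \<Longrightarrow> f (act V a v) = act sharp_V a (f v)"
    "v \<in> carr V \<Longrightarrow> w \<in> carr V \<Longrightarrow> f (v + w) = f v + f w"
    "v \<in> carr V \<Longrightarrow> f (smul V c v) = fun_smul (*) c (f v)" for v w a c
    by (auto simp: Hom_mod_def linear_on_mod_def sharp_simps(2))
  have "bilinear_on_mods V V (*) f"
    unfolding bilinear_on_mods_def
  proof (intro conjI ballI)
    show "linear_on_mod V (*) (f v)" if "v \<in> carr V" for v
      using *(1)[OF that] by (simp add: sharp_simps(1))
    show "linear_on_mod V (*) (\<lambda>v. f v w)" for w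
      by (simp add: linear_on_mod_def * fun_smul_apply)
  qed
  moreover have "f v w = 0" if "v \<notin> carr V \<or> w \<notin> carr V" for v w
    using that *(1)[of v] *(2)[of v] by (cases "v \<in> carr V") (auto simp: sharp_simps(1))
  ultimately show ?R by (simp add: *(3) sharp_simps(3))
next
  assume R: ?R
  then have bil: "linear_on_mod V (*) (f v)" "linear_on_mod V (*) (\<lambda>w. f w v)" if "v \<in> carr V" for v
    using that by (auto simp: bilinear_on_mods_def)
  have "f (v + w) x = f v x + f w x" if "v \<in> carr V" "w \<in> carr V" for v w x
    using R bil(2)[of x] that by (cases "x \<in> carr V") (simp_all add: linear_on_mod_def)
  moreover have "f (smul V c v) x = c * f v x" if "v \<in> carr V" for v x c
    using R bil(2)[of x] that by (cases "x \<in> carr V") (simp_all add: linear_on_mod_def)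
  moreover have "f (act V a v) x = act sharp_V a (f v) x" if "v \<in> carr V" for a v x
    using R that by (cases "x \<in> carr V") (simp_all add: sharp_simps(3))
  ultimately show "f \<in> Hom_sharp"
    using R bil by (simp add: Hom_mod_def linear_on_mod_def[of V "fun_smul (*)"] sharp_simps(1,2) fun_smul_def fun_eq_iff)
qed

text \<open>The forms in statement (3) are arbitrary off the carrier, whereas members of
  \<open>Hom_mod\<close> vanish there.\<close>

definition restrict_form :: "('v \<Rightarrow> 'v \<Rightarrow> 'k) \<Rightarrow> 'v \<Rightarrow> 'v \<Rightarrow> 'k" where
  "restrict_form b v w = (if v \<in> carr V \<and> w \<in> carr V then b v w else 0)"

lemma tau_adjoint_iff:
  "tau_adjoint_form H \<tau> V b \<longleftrightarrow>
    (\<forall>a. \<forall>v\<in>carr V. \<forall>w\<in>carr V. b (act V a v) w = b v (act V (anti H (\<tau> a)) w))"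
  unfolding tau_adjoint_form_def by (metis tau_tau)

lemma restrict_form_Hom_sharp:
  assumes "bilinear_on_mods V V (*) b" "tau_adjoint_form H \<tau> V b"
  shows "restrict_form b \<in> Hom_sharp"
  using assms unfolding Hom_sharp_iff tau_adjoint_iff
  by (simp add: bilinear_on_mods_def linear_on_mod_def restrict_form_def V.carr_add V.carr_smul V.act_closed)

text \<open>Injectivity is nondegeneracy. Surjectivity is a count of dimensions: the dual is spanned
  by the coordinate functionals of a basis of V, and the images of the basis vectors are equally
  many independent elements of it.\<close>

lemma nondeg_iso:
  assumes fd: "fin_dim (smul V) (carr V)"
    and b: "nondeg_bilinear_form V b" "tau_adjoint_form H \<tau> V b"
  shows "restrict_form b \<in> iso_mod V sharp_V"
proof -
  interpret vs: vector_space "smul V" by (rule V.smul_vector_space)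
  let ?s = "fun_smul ((*) :: 'k \<Rightarrow> 'k \<Rightarrow> 'k) :: 'k \<Rightarrow> ('v \<Rightarrow> 'k) \<Rightarrow> ('v \<Rightarrow> 'k)"
  interpret fs: vector_space ?s
    by (intro vector_space_fun_smul vector_space_mult)
  let ?f = "restrict_form b"
  have f: "?f \<in> Hom_sharp"
    using b by (intro restrict_form_Hom_sharp) (auto simp: nondeg_bilinear_form_def)
  have f_carr: "?f v \<in> carr sharp_V" and f_add: "w \<in> carr V \<Longrightarrow> ?f (v + w) = ?f v + ?f w"
    and f_smul: "?f (smul V c v) = ?s c (?f v)" if "v \<in> carr V" for v w c
    using f that by (auto simp: Hom_mod_def linear_on_mod_def sharp_simps(2))
  have ker: "v = 0" if v: "v \<in> carr V" "?f v = 0" for v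
  proof -
    have "b v w = 0" if "w \<in> carr V" for w
      using fun_cong[OF v(2), of w] v(1) that by (simp add: restrict_form_def)
    then show ?thesis using b(1) v(1) by (auto simp: nondeg_bilinear_form_def)
  qed
  have inj: "inj_on ?f (carr V)"
  proof (rule inj_onI)
    fix v w assume vw: "v \<in> carr V" "w \<in> carr V" "?f v = ?f w"
    have d: "v - w \<in> carr V" using vs.subspace_diff[OF V.carr_subspace] vw by blast
    have "?f (v - w + w) = ?f (v - w) + ?f w" by (rule f_add[OF d vw(2)])
    then have "?f (v - w) = 0" using vw(3) by simp
    then show "v = w" using ker[OF d] by simp
  qed
  obtain B where B: "finite B" "vs.independent B" "vs.span B = carr V"
    using fd by (auto simp: fin_dim_def basis_of_def)
  have BV: "B \<subseteq> carr V" using vs.span_superset B(3) by blast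
  \<comment> \<open>\<open>representation\<close> is 0 outside the span of \<open>B\<close>, so
    these coordinate functionals vanish off the carrier, as elements of the dual must.\<close>
  define d where "d b = (\<lambda>v. vs.representation B v b)" for b
  have f0: "?f 0 = 0" using f_add[OF V.carr_zero V.carr_zero] by simp
  have f_sum: "(\<Sum>x\<in>A. smul V (u x) x) \<in> carr V \<and> ?f (\<Sum>x\<in>A. smul V (u x) x) = (\<Sum>x\<in>A. ?s (u x) (?f x))"
    if "finite A" "A \<subseteq> carr V" for A u
    using that
    by (induction rule: finite_induct) (simp_all add: V.carr_zero f0 V.carr_add V.carr_smul f_add f_smul)
  have spanning: "l \<in> fs.span (d ` B)" if l: "l \<in> carr sharp_V" for l
  proof -
    have ll: "linear_on_mod V (*) l" "\<And>v. v \<notin> carr V \<Longrightarrow> l v = 0" using l by (auto simp: sharp_simps(1))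
    have l0: "l 0 = 0"
      by (rule linear_on_mod_zero[OF V.left_module_axioms vector_space_mult ll(1)])
    have l_sum: "(\<Sum>x\<in>A. smul V (u x) x) \<in> carr V \<and> l (\<Sum>x\<in>A. smul V (u x) x) = (\<Sum>x\<in>A. u x * l x)"
      if "finite A" "A \<subseteq> carr V" for A u
      using that ll(1)
      by (induction rule: finite_induct) (simp_all add: V.carr_zero l0 V.carr_add V.carr_smul linear_on_mod_def subset_iff)
    have "l = (\<Sum>b\<in>B. ?s (l b) (d b))"
    proof
      fix v
      have sum_apply: "(\<Sum>b\<in>B. ?s (l b) (d b)) v = (\<Sum>b\<in>B. d b v * l b)"
        using B(1) by (induction rule: finite_induct) (simp_all add: fun_smul_def mult.commute)
      show "l v = (\<Sum>b\<in>B. ?s (l b) (d b)) v"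
      proof (cases "v \<in> carr V")
        case True
        then have "v = (\<Sum>b\<in>B. smul V (d b v) b)"
          using vs.sum_representation_eq[OF B(2) _ B(1) order.refl] B(3) by (simp add: d_def)
        then show ?thesis using l_sum[OF B(1) BV, of "\<lambda>b. d b v"] by (simp only: sum_apply)
      next
        case False
        then have "d b v = 0" for b using B by (simp add: d_def vs.representation_def)
        then show ?thesis using False by (simp only: sum_apply) (simp add: ll(2))
      qed
    qed
    also have "\<dots> \<in> fs.span (d ` B)"
      by (intro fs.span_sum fs.span_scale fs.span_base) auto
    finally show ?thesis .
  qed
  have indep: "fs.independent (?f ` B)"
  proof
    assume "fs.dependent (?f ` B)"
    then obtain A u x where A: "A \<subseteq> ?f ` B" "(\<Sum>x\<in>A. ?s (u x) x) = 0" "x \<in> A" "u x \<noteq> 0" "finite A"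
      unfolding fs.dependent_explicit by blast
    then obtain A' where A': "A' \<subseteq> B" "A = ?f ` A'" by (auto simp: subset_image_iff)
    have fin: "finite A'" using A'(1) B(1) finite_subset by blast
    have injA: "inj_on ?f A'" using inj A'(1) BV by (meson inj_on_subset order.trans)
    have A'V: "A' \<subseteq> carr V" using A'(1) BV by blast
    have "(\<Sum>x\<in>A'. ?s (u (?f x)) (?f x)) = 0"
      using A(2) by (simp add: A'(2) sum.reindex[OF injA])
    then have "?f (\<Sum>x\<in>A'. smul V (u (?f x)) x) = 0"
      using f_sum[OF fin A'V, of "\<lambda>x. u (?f x)"] by simp
    then have "(\<Sum>x\<in>A'. smul V (u (?f x)) x) = 0"
      using ker f_sum[OF fin A'V, of "\<lambda>x. u (?f x)"] by blast
    then have "\<forall>y\<in>A'. u (?f y) = 0"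
      using vs.independentD[OF B(2) fin A'(1), of "\<lambda>x. u (?f x)"] by blast
    then show False using A(3,4) A'(2) by auto
  qed
  have "carr sharp_V \<subseteq> ?f ` carr V"
  proof
    fix l assume l: "l \<in> carr sharp_V"
    have "l \<in> fs.span (?f ` B)"
    proof (rule ccontr)
      \<comment> \<open>Otherwise \<open>card B + 1\<close> independent elements would lie in the
        span of at most \<open>card B\<close> functionals.\<close>
      assume n: "l \<notin> fs.span (?f ` B)"
      then have i: "fs.independent (insert l (?f ` B))"
        using indep by (simp add: fs.independent_insert)
      have "insert l (?f ` B) \<subseteq> fs.span (d ` B)"
        using spanning l f_carr BV by blast
      then have "card (insert l (?f ` B)) \<le> card (d ` B)"
        using fs.independent_span_bound[OF _ i] B(1) by blast
      also have "\<dots> \<le> card B" using B(1) by (rule card_image_le)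
      also have "card B = card (?f ` B)" using inj BV by (metis card_image inj_on_subset)
      finally have "l \<in> ?f ` B" using B(1) by (simp add: card_insert_if split: if_splits)
      then show False using n fs.span_base by blast
    qed
    then show "l \<in> ?f ` carr V"
    proof (induction rule: fs.span_induct)
      case base
      have "?f v + ?f w \<in> ?f ` carr V" "?s c (?f v) \<in> ?f ` carr V"
        if "v \<in> carr V" "w \<in> carr V" for v w c
        using that f_add[of v w] f_smul[of v c] V.carr_add V.carr_smul by (metis imageI)+
      then show ?case
        using f0 V.carr_zero by (intro fs.subspaceI) (auto simp: image_iff[of 0] intro: bexI[of _ 0])
    next
      case (step x)
      then show ?case using BV by blast
    qed
  qed
  then have "bij_betw ?f (carr V) (carr sharp_V)"
    using inj f_carr by (auto simp: bij_betw_def)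
  then show ?thesis using f by (simp add: iso_mod_def)
qed

text \<open>The operator whose trace is \<open>fs_indicator\<close>.\<close>

definition flip_form :: "'h \<Rightarrow> ('v \<Rightarrow> 'v \<Rightarrow> 'k) \<Rightarrow> 'v \<Rightarrow> 'v \<Rightarrow> 'k" where
  "flip_form g f v w = (if v \<in> carr V \<and> w \<in> carr V then f w (act V g v) else 0)"

text \<open>In f(S(\<tau>(a)) w, g v) adjointness moves the algebra element to the right, where it
  becomes S(S(a)) because the two \<tau> cancel. Then S(S(a)) g = g a turns it into the action of a
  on v.\<close>

lemma flip_form_Hom_sharp:
  assumes f: "f \<in> Hom_sharp" and anti_anti_g: "\<And>h. anti H (anti H h) * g = g * h"
  shows "flip_form g f \<in> Hom_sharp"
proof -
  have bil: "linear_on_mod V (*) (f v)" "linear_on_mod V (*) (\<lambda>w. f w v)" if "v \<in> carr V" for v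
    using f that by (auto simp: Hom_sharp_iff bilinear_on_mods_def)
  have adj: "f (act V a v) w = f v (act V (anti H (\<tau> a)) w)" if "v \<in> carr V" "w \<in> carr V" for a v w
    using f that by (auto simp: Hom_sharp_iff)
  have "flip_form g f (act V a v) w = flip_form g f v (act V (anti H (\<tau> a)) w)"
    if "v \<in> carr V" "w \<in> carr V" for a v w
  proof -
    have "f (act V (anti H (\<tau> a)) w) (act V g v) = f w (act V (anti H (anti H a)) (act V g v))"
      using that by (simp add: adj V.act_closed tau_anti tau_tau flip: tau_anti)
    also have "act V (anti H (anti H a)) (act V g v) = act V g (act V a v)"
      using that by (simp add: anti_anti_g flip: V.act_mult)
    finally show ?thesis using that by (simp add: flip_form_def V.act_closed)
  qed
  moreover have "bilinear_on_mods V V (*) (flip_form g f)"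
    using bil by (simp add: bilinear_on_mods_def linear_on_mod_def flip_form_def V.carr_add V.carr_smul
        V.act_closed V.act_add V.act_smul)
  ultimately show ?thesis
    by (simp add: Hom_sharp_iff) (simp add: flip_form_def)
qed

lemma flip_form_flip_form:
  assumes f: "f \<in> Hom_sharp" and g: "\<And>w. w \<in> carr V \<Longrightarrow> act V (anti H (\<tau> g) * g) w = w"
  shows "flip_form g (flip_form g f) = f"
proof (intro ext)
  fix v w
  show "flip_form g (flip_form g f) v w = f v w"
  proof (cases "v \<in> carr V \<and> w \<in> carr V")
    case True
    then have "flip_form g (flip_form g f) v w = f v (act V (anti H (\<tau> g)) (act V g w))"
      using f by (simp add: flip_form_def V.act_closed Hom_sharp_iff)
    then show ?thesis using True g[of w] by (simp add: V.act_mult)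
  next
    case False
    then have "f v w = 0" using f by (auto simp: Hom_sharp_iff)
    then show ?thesis using False by (auto simp: flip_form_def)
  qed
qed

text \<open>Both radicals of f are submodules, and they are proper because f is nonzero. For the
  right radical, surjectivity of S is used to write every a as S(a').\<close>

lemma nonzero_nondeg:
  assumes V: "simple_module V" and f: "f \<in> Hom_sharp" "f \<noteq> 0"
  shows "nondeg_bilinear_form V f \<and> tau_adjoint_form H \<tau> V f"
proof -
  interpret vs: vector_space "smul V" by (rule V.smul_vector_space)
  have bilin: "bilinear_on_mods V V (*) f"
    and adj: "\<And>a v w. v \<in> carr V \<Longrightarrow> w \<in> carr V \<Longrightarrow> f (act V a v) w = f v (act V (anti H (\<tau> a)) w)"
    and off: "\<And>v w. v \<notin> carr V \<or> w \<notin> carr V \<Longrightarrow> f v w = 0"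
    using f by (auto simp: Hom_sharp_iff)
  have bil: "linear_on_mod V (*) (f v)" "linear_on_mod V (*) (\<lambda>w. f w v)" if "v \<in> carr V" for v
    using bilin that by (auto simp: bilinear_on_mods_def)
  have zero: "f v 0 = 0" "f 0 v = 0" if "v \<in> carr V" for v
    using linear_on_mod_zero[OF V.left_module_axioms vector_space_mult] bil[OF that] by blast+
  obtain x y where xy: "x \<in> carr V" "y \<in> carr V" "f x y \<noteq> 0"
    using f(2) off by (auto simp: fun_eq_iff)
  let ?L = "{v \<in> carr V. \<forall>w\<in>carr V. f v w = 0}" and ?R = "{w \<in> carr V. \<forall>v\<in>carr V. f v w = 0}"
  have "vs.subspace ?L" "vs.subspace ?R"
    using bil zero by (auto simp: vs.subspace_def linear_on_mod_def V.carr_zero V.carr_add V.carr_smul)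
  moreover have "f v (act V a w) = 0" if "v \<in> carr V" "w \<in> ?R" for a v w
  proof -
    obtain a' where "a = anti H a'" using anti_bij by (metis bij_pointE)
    then have "f v (act V a w) = f (act V (\<tau> a') v) w"
      using that by (simp add: adj tau_tau)
    then show ?thesis using that V.act_closed by simp
  qed
  ultimately have "submodule V ?L" "submodule V ?R"
    by (auto simp: submodule_def adj V.act_closed)
  moreover have "x \<notin> ?L" "y \<notin> ?R" using xy by auto
  ultimately have "?L = {0}" "?R = {0}"
    using V xy unfolding simple_module_def by blast+
  then show ?thesis
    using bilin by (auto simp: nondeg_bilinear_form_def tau_adjoint_iff adj)
qed

end

section \<open>Invariance of the pivotal element under the involution\<close>

lemma tau_pivotal_element:
  fixes H :: "('k::{alg_closed_field, field_char_0}, 'h::ring_1) qha"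
  assumes piv: "pivotal_element H j g" and can: "canonical_pivotal_structure H j"
    and invol: "qha_involution H \<tau>" and V: "fd_module H V" "simple_module V" and v: "v \<in> carr V"
  shows "act V (\<tau> g) v = act V g v"
proof -
  interpret pivotal_element H j g by (rule piv)
  interpret V: left_module H V using V by (simp add: fd_module_def)
  interpret I: involutive_module H V \<tau>
    by unfold_locales (rule invol)
  interpret vs: vector_space "smul V" by (rule V.smul_vector_space)
  \<comment> \<open>With the action on the target taken through S^2, both g and \<tau>(g) act as
    module maps defined on V, and Schur's lemma can compare them.\<close>
  define W where "W = V\<lparr>act := (\<lambda>a. act V (anti H (anti H a)))\<rparr>"
  have anti: "anti H (a + b) = anti H a + anti H b" "anti H (scl H c a) = scl H c (anti H a)" for a b c
    using anti_linear by (auto simp: lin_endo_iff)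
  have W: "left_module H W"
    by (rule left_module.intro) (simp_all add: W_def V.smul_vector_space V.carr_subspace V.act_closed
      V.act_add V.act_smul V.act_plus V.act_scl V.act_one V.act_mult anti anti_one anti_mult)
  define mul where "mul a v = (if v \<in> carr V then act V a v else 0)" for a v
  have mul_Hom: "mul a \<in> Hom_mod V W" if "\<And>h. anti H (anti H h) * a = a * h" for a
    using that by (auto simp: Hom_mod_def linear_on_mod_def mul_def W_def V.carr_add V.carr_smul
        V.act_closed V.act_add V.act_smul V.act_mult[symmetric])
  have "anti H (anti H h) * \<tau> g = \<tau> g * h" for h
    using arg_cong[OF anti_anti_g[of "\<tau> h"], of \<tau>] by (simp add: I.tau_mult I.tau_anti I.tau_tau)
  note homs = mul_Hom[OF anti_anti_g] mul_Hom[OF this]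
  have "mul g \<in> iso_mod V W"
  proof -
    \<comment> \<open>The inverse of g is h = S^-1(g), since g h = S(S(h)) g = S(g) g = 1.\<close>
    obtain h where h: "anti H h = g" using anti_bij by (metis bij_pointE)
    have gh: "g * h = 1" using anti_anti_g[of h] anti_g_mult by (simp add: h)
    have "anti H g * g * h = anti H g" by (simp only: mult.assoc gh mult_1_right)
    then have hg: "h * g = 1" by (simp add: anti_g_mult)
    have "bij_betw (mul g) (carr V) (carr V)"
      by (rule bij_betw_byWitness[where f' = "mul h"])
        (auto simp: mul_def V.act_closed gh hg V.act_one V.act_mult[symmetric])
    then show ?thesis using homs(1) by (simp add: iso_mod_def W_def)
  qed
  then obtain c where "\<And>w. w \<in> carr V \<Longrightarrow> mul (\<tau> g) w = smul W c (mul g w)"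
    using schur[OF V W _ homs(2)] by blast
  then have c: "act V (\<tau> g) w = smul V c (act V g w)" if "w \<in> carr V" for w
    using that by (auto simp: mul_def W_def)
  obtain M :: "('k, 'h) mod_obj" and \<theta> where M: "fd_module H M" and \<theta>: "\<theta> \<in> iso_mod V M"
    using fd_module_representative[OF V(1)] by blast
  interpret M: left_module H M using M by (simp add: fd_module_def)
  interpret Ms: vector_space "smul M" by (rule M.smul_vector_space)
  note \<theta>D = iso_modD[OF \<theta>]
  have cM: "act M (\<tau> g) m = smul M c (act M g m)" if m: "m \<in> carr M" for m
  proof -
    have "m \<in> \<theta> ` carr V" using m by (simp only: bij_betw_imp_surj_on[OF \<theta>D(1)])
    then obtain w where w: "w \<in> carr V" "m = \<theta> w" by blast
    then show ?thesis
      using \<theta>D(6)[OF w(1), of "\<tau> g"] \<theta>D(6)[OF w(1), of g] \<theta>D(5)[OF V.act_closed[OF w(1), of g], of c]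
      by (simp add: c)
  qed
  obtain B where B: "finite B" "Ms.independent B" "Ms.span B = carr M"
    using M by (auto simp: fd_module_def fin_dim_def basis_of_def)
  have BM: "B \<subseteq> carr M" using Ms.span_superset B(3) by blast
  define r where "r b v = Ms.representation B v b" for b v
  have r: "r b \<in> carr (dual H M)" for b
    using B by (auto simp: carr_dual linear_on_mod_def r_def Ms.representation_add
        Ms.representation_scale) (simp add: Ms.representation_def)
  have fdN: "fd_module H (natural_twist \<tau> M)"
    using M I.left_module_natural_twist[OF M.left_module_axioms]
    by (simp add: fd_module_def natural_twist_def)
  \<comment> \<open>Stated for every module on the space of \<open>M\<close>, so that one basis
    serves both \<open>M\<close> and its twist by \<tau>.\<close>
  have trace: "(\<Sum>b\<in>B. r b (act N (anti H (alp H)) (act N g (act N (bet H) b)))) = of_nat (card B)"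
    if N: "fd_module H N" and eq: "smul N = smul M" "carr N = carr M" for N :: "('k, 'h) mod_obj"
  proof -
    interpret N: left_module H N using N by (simp add: fd_module_def)
    have rN: "r b \<in> carr (dual H N)" for b
      using r[of b] eq by (simp add: carr_dual linear_on_mod_def)
    interpret D: left_module H "dual H N"
      by (rule left_module_dual[OF quasi_hopf_algebra_axioms N.left_module_axioms])
    have basis: "basis_of (smul N) (carr N) B" using B by (simp add: basis_of_def eq)
    have r_eq: "r b = (\<lambda>v. module.representation (smul N) B v b)" for b
      by (simp add: r_def fun_eq_iff eq)
    have "(\<Sum>b\<in>B. ev H (dual H N) (j N (act N (bet H) b)) (r b)) = of_nat (vector_space.dim (smul N) (carr N))"
      unfolding r_eq using can N basis unfolding canonical_pivotal_structure_def by blast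
    also have "vector_space.dim (smul N) (carr N) = card B"
      using Ms.dim_span_eq_card_independent[OF B(2)] by (simp add: eq B(3))
    also have "(\<Sum>b\<in>B. ev H (dual H N) (j N (act N (bet H) b)) (r b)) =
      (\<Sum>b\<in>B. r b (act N (anti H (alp H)) (act N g (act N (bet H) b))))"
    proof (rule sum.cong[OF refl])
      fix b assume "b \<in> B"
      then have b: "b \<in> carr N" using BM eq by auto
      show "ev H (dual H N) (j N (act N (bet H) b)) (r b) =
          r b (act N (anti H (alp H)) (act N g (act N (bet H) b)))"
        by (simp add: ev_def j_eq[OF N N.act_closed[OF b] D.act_closed[OF rN]] act_dual N.act_closed b)
    qed
    finally show ?thesis .
  qed
  \<comment> \<open>On the twist of \<open>M\<close> the element g acts as \<tau>(g), while \<beta>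
    and S(\<alpha>) act as before because \<tau> fixes \<alpha> and \<beta>. So the two
    normalisations differ exactly by the factor c.\<close>
  have "(of_nat (card B) :: 'k) = (\<Sum>b\<in>B. r b (act M (anti H (alp H)) (act M (\<tau> g) (act M (bet H) b))))"
    using trace[OF fdN] by (simp add: natural_twist_def I.tau_alp I.tau_bet flip: I.tau_anti)
  also have "\<dots> = (\<Sum>b\<in>B. c * r b (act M (anti H (alp H)) (act M g (act M (bet H) b))))"
    using BM by (intro sum.cong refl) (auto simp: cM M.act_closed M.act_smul subset_iff dualD(2)[OF r])
  also have "\<dots> = c * of_nat (card B)"
    by (simp add: trace[OF M] flip: sum_distrib_left)
  finally have "(c - 1) * of_nat (card B) = 0" by (simp add: algebra_simps)
  moreover have "card B \<noteq> 0"
  proof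
    assume "card B = 0"
    then have "carr M = {0}" using B(1,3) by simp
    then have "\<theta> x = \<theta> 0" if "x \<in> carr V" for x
      using \<theta>D(3)[OF that] \<theta>D(3)[OF V.carr_zero] by simp
    then have "x = 0" if "x \<in> carr V" for x
      using inj_onD[OF bij_betw_imp_inj_on[OF \<theta>D(1)]] that V.carr_zero by blast
    then have "carr V = {0}" using V.carr_zero by blast
    then show False using V(2) by (simp add: simple_module_def)
  qed
  ultimately have "c = 1" by simp
  then show ?thesis using c[OF v] by simp
qed

theorem theorem3p13:
  fixes H :: "('k::{alg_closed_field, field_char_0}, 'h::ring_1) qha"
    and g :: 'h
    and \<tau> :: "'h \<Rightarrow> 'h"
    and V :: "('k, 'h, 'v::ab_group_add) lmod"
  assumes "quasi_hopf_algebra H" and "fd_semisimple H"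
    and "canonical_pivotal_element H g"
    and "qha_involution H \<tau>"
    and "fd_module H V" and "simple_module V"
  shows
    "fs_indicator H g \<tau> V \<in> {0, 1, -1} \<and>
     (fs_indicator H g \<tau> V \<noteq> 0 \<longleftrightarrow> iso_mod (natural_twist \<tau> V) (dual H V) \<noteq> {}) \<and>
     (iso_mod (natural_twist \<tau> V) (dual H V) \<noteq> {} \<longleftrightarrow>
        (\<exists>b. nondeg_bilinear_form V b \<and> tau_adjoint_form H \<tau> V b)) \<and>
     (fs_indicator H g \<tau> V \<noteq> 0 \<or> iso_mod (natural_twist \<tau> V) (dual H V) \<noteq> {} \<or>
      (\<exists>b. nondeg_bilinear_form V b \<and> tau_adjoint_form H \<tau> V b) \<longrightarrow>
        (\<forall>b b'. nondeg_bilinear_form V b \<and> tau_adjoint_form H \<tau> V b \<and>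
                nondeg_bilinear_form V b' \<and> tau_adjoint_form H \<tau> V b' \<longrightarrow>
           (\<exists>c. c \<noteq> 0 \<and> (\<forall>v\<in>carr V. \<forall>w\<in>carr V. b' v w = c * b v w))) \<and>
        (\<forall>b. nondeg_bilinear_form V b \<and> tau_adjoint_form H \<tau> V b \<longrightarrow>
           (\<forall>v\<in>carr V. \<forall>w\<in>carr V.
              b w (act V g v) = fs_indicator H g \<tau> V * b v w)))"
proof -
  interpret quasi_hopf_algebra H by (rule assms)
  obtain j where can: "canonical_pivotal_structure H j"
    and j: "\<And>R \<theta>. fd_module H R \<Longrightarrow> \<theta> \<in> iso_mod (regular_module H) R \<Longrightarrow>
           bitransp H (regular_module H) R \<theta> (iota H (regular_module H) g) = j R (\<theta> 1)"
    using assms(3) unfolding canonical_pivotal_element_def by blast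
  have piv: "pivotal_element H j g"
    using assms(1,2) can j
    by (auto simp: pivotal_element_def pivotal_element_axioms_def canonical_pivotal_structure_def fd_semisimple_def)
  interpret pivotal_element H j g by (rule piv)
  interpret V: left_module H V using assms(5) by (simp add: fd_module_def)
  interpret I: involutive_module H V \<tau>
    by unfold_locales (rule assms)
  have fdV: "fin_dim (smul V) (carr V)" using assms(5) by (simp add: fd_module_def)
  \<comment> \<open>This is \<tau> applied to S(g) g = 1; on V the second factor \<tau>(g) may then
    be replaced by g.\<close>
  have "anti H (\<tau> g) * \<tau> g = 1"
    using arg_cong[OF anti_g_mult, of \<tau>] by (simp add: I.tau_mult I.tau_one I.tau_anti)
  then have g: "act V (anti H (\<tau> g) * g) w = w" if "w \<in> carr V" for w
    using that tau_pivotal_element[OF piv can assms(4-6) that] V.act_mult[OF that, of "anti H (\<tau> g)"] V.act_one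
    by metis
  let ?s = "fun_smul (fun_smul (*)) :: 'k \<Rightarrow> ('v \<Rightarrow> 'v \<Rightarrow> 'k) \<Rightarrow> ('v \<Rightarrow> 'v \<Rightarrow> 'k)"
  have s: "vector_space ?s" by (intro vector_space_fun_smul vector_space_mult)
  interpret s: vector_space ?s by (rule s)
  let ?\<nu> = "fs_indicator H g \<tau> V"
  let ?good = "\<lambda>b. nondeg_bilinear_form V b \<and> tau_adjoint_form H \<tau> V b"
  have \<nu>: "?\<nu> = trace_on ?s I.Hom_sharp (I.flip_form g)"
    by (simp add: fs_indicator_def I.sharp_simps(2) I.flip_form_def[abs_def])
  have good_iso: "I.restrict_form b \<in> iso_mod V I.sharp_V" if "?good b" for b
    using I.nondeg_iso[OF fdV] that by blast
  have V0: "carr V \<noteq> {0}" using assms(6) by (simp add: simple_module_def)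
  have iso_nonzero: "f \<in> I.Hom_sharp \<and> f \<noteq> 0" if "f \<in> iso_mod V I.sharp_V" for f
    using iso_modD(1,2)[OF that] V0 V.carr_zero by (auto simp: bij_betw_def inj_on_def)
  have iso: "f \<in> iso_mod V I.sharp_V" if f: "f \<in> I.Hom_sharp" "f \<noteq> 0" for f
  proof -
    have "I.restrict_form f = f"
      using f(1) by (auto simp: I.restrict_form_def I.Hom_sharp_iff fun_eq_iff)
    then show ?thesis using good_iso[OF I.nonzero_nondeg[OF assms(6) f]] by simp
  qed
  show ?thesis
  proof (cases "\<exists>f. f \<in> I.Hom_sharp \<and> f \<noteq> 0")
    \<comment> \<open>Without a nonzero module map the basis is empty and the indicator is 0, and
      (2) and (3) fail because each of them would provide such a map.\<close>
    case False
    moreover have "0 \<in> I.Hom_sharp"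
      by (simp add: I.Hom_sharp_iff bilinear_on_mods_def linear_on_mod_def)
    ultimately have Hom_sharp: "I.Hom_sharp = {0}" by blast
    have "?\<nu> = 0 * of_nat (card ({} :: ('v \<Rightarrow> 'v \<Rightarrow> 'k) set))"
      unfolding \<nu> by (rule trace_on_scalar[OF s]) (auto simp: Hom_sharp basis_of_def I.flip_form_def fun_eq_iff s.independent_empty)
    moreover have "iso_mod V I.sharp_V = {}" using iso_nonzero False by blast
    moreover have "\<not> ?good b" for b using good_iso \<open>iso_mod V I.sharp_V = {}\<close> by blast
    ultimately show ?thesis by (simp add: I.iso_natural_twist) blast
  next
    case True
    then obtain f where f: "f \<in> I.Hom_sharp" "f \<noteq> 0" by blast
    \<comment> \<open>The reference map \<open>f0\<close> is left free, because uniqueness has to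
      compare two given forms.\<close>
    have multiple: "\<exists>c. u = ?s c f0" if f0: "f0 \<in> I.Hom_sharp" "f0 \<noteq> 0" and u: "u \<in> I.Hom_sharp" for u f0
    proof -
      obtain c where c: "\<And>v. v \<in> carr V \<Longrightarrow> u v = smul I.sharp_V c (f0 v)"
        using schur[OF assms(5,6) I.left_module_sharp iso[OF f0] u] by blast
      have "u v w = c * f0 v w" for v w
        using c[of v] u f0(1) by (cases "v \<in> carr V") (auto simp: I.sharp_simps(2) fun_smul_def I.Hom_sharp_iff)
      then show ?thesis by (intro exI[of _ c]) (simp add: fun_smul_def fun_eq_iff)
    qed
    obtain c where c: "I.flip_form g f = ?s c f"
      using multiple[OF f I.flip_form_Hom_sharp[OF f(1) anti_anti_g]] by blast
    have flip_smul: "I.flip_form g (?s a u) = ?s a (I.flip_form g u)" for a u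
      by (auto simp: I.flip_form_def fun_smul_def fun_eq_iff)
    have flip: "I.flip_form g u = ?s c u" if u: "u \<in> I.Hom_sharp" for u
    proof -
      obtain a where "u = ?s a f" using multiple[OF f u] by blast
      then show ?thesis by (simp only: flip_smul c s.scale_scale mult.commute)
    qed
    have "?s (c * c) f = ?s 1 f"
      using I.flip_form_flip_form[OF f(1) g] by (simp add: c flip_smul)
    then have "c * c = 1" using f(2) s.scale_cancel_right[of "c * c" f 1] by simp
    then have c1: "c = 1 \<or> c = -1" by (simp add: square_eq_1_iff)
    \<comment> \<open>The space of module maps is a line, so the trace is the eigenvalue c
      itself.\<close>
    have "I.Hom_sharp = s.span {f}"
    proof
      show "I.Hom_sharp \<subseteq> s.span {f}"
        using multiple[OF f] s.span_scale[OF s.span_base[of f "{f}"]] by blast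
      have "?s a f \<in> I.Hom_sharp" for a
        using f(1) by (auto simp: I.Hom_sharp_iff bilinear_on_mods_def linear_on_mod_def fun_smul_def algebra_simps)
      then show "s.span {f} \<subseteq> I.Hom_sharp"
        by (auto simp: s.span_singleton)
    qed
    then have "basis_of ?s I.Hom_sharp {f}" using f(2) by (simp add: basis_of_def)
    then have "?\<nu> = c * of_nat (card {f})"
      unfolding \<nu> by (rule trace_on_scalar[OF s]) (simp_all add: flip)
    then have \<nu>c: "?\<nu> = c" by simp
    have good_Hom: "I.restrict_form b \<in> I.Hom_sharp \<and> I.restrict_form b \<noteq> 0" if "?good b" for b
      using iso_nonzero[OF good_iso[OF that]] .
    have unique: "\<exists>c. c \<noteq> 0 \<and> (\<forall>v\<in>carr V. \<forall>w\<in>carr V. b' v w = c * b v w)"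
      if b: "?good b" "?good b'" for b b'
    proof -
      obtain a where a: "I.restrict_form b' = ?s a (I.restrict_form b)"
        using multiple good_Hom[OF b(1)] good_Hom[OF b(2)] by blast
      then have "a \<noteq> 0" using good_Hom[OF b(2)] by auto
      moreover have "b' v w = a * b v w" if "v \<in> carr V" "w \<in> carr V" for v w
        using fun_cong[OF fun_cong[OF a, of v], of w] that by (simp add: I.restrict_form_def fun_smul_def)
      ultimately show ?thesis by blast
    qed
    have sym: "b w (act V g v) = ?\<nu> * b v w" if b: "?good b" and vw: "v \<in> carr V" "w \<in> carr V" for b v w
    proof -
      have "I.flip_form g (I.restrict_form b) v w = ?s c (I.restrict_form b) v w"
        using flip good_Hom[OF b] by simp
      then show ?thesis
        using vw by (simp add: I.flip_form_def I.restrict_form_def fun_smul_def V.act_closed \<nu>c)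
    qed
    have \<nu>_cases: "?\<nu> \<in> {0, 1, -1}" "?\<nu> \<noteq> 0" using c1 \<nu>c by auto
    have "iso_mod V I.sharp_V \<noteq> {}" using iso[OF f] by blast
    moreover have "\<exists>b. ?good b" using I.nonzero_nondeg[OF assms(6) f] by blast
    ultimately show ?thesis
      unfolding I.iso_natural_twist using \<nu>_cases unique sym
      by (intro conjI impI) (assumption | blast)+
  qed
qed

end
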